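(* Let $R$ be a commutative ring, let $\phi: R^m \to R^n$ and $\psi: R^p \to R^q$ be $R$-linear maps, and let $d \ge 1$ be an integer. Set $s = \binom{n+d-1}{d-1}$ and $e = \binom{n-1}{d-1}$. (1) Then $$I(\phi\otimes\psi) \subset I(\phi)^q I(\psi)^n, \qquad I(S^d(\phi)) \subset I(\phi)^s, \qquad I\left(\textstyle\bigwedge^d(\phi)\right) \subset I(\phi)^e,$$ and in each of the three inclusions equality holds up to integral closure, i.e. the two ideals have the same integral closure in $R$. (2) If $R$ contains the field $\mathbb{Q}$ of rational numbers, then equality holds in each of the three inclusions of (1).
   Context: For a linear map $\chi: F \to H$ between finitely generated free $R$-modules, $I_t(\chi)$ denotes the ideal of $R$ generated by the $t \times t$ minors of a matrix representing $\chi$ (this is independent of the choice of bases; $I_0(\chi)=R$, and $I_t(\chi)=0$ if $t$ exceeds the rank of $F$ or of $H$). One sets $I(\chi) = I_{N}(\chi)$, where $N$ is the rank of the target $H$. Thus $I(\phi) = I_n(\phi)$, $I(\psi) = I_q(\psi)$, $I(\phi\otimes\psi) = I_{nq}(\phi\otimes\psi)$, $I(S^d(\phi)) = I_{N}(S^d(\phi))$ with $N = \binom{n+d-1}{d}$, and $I(\bigwedge^d(\phi)) = I_{N}(\bigwedge^d(\phi))$ with $N = \binom{n}{d}$. Here $\phi\otimes\psi: R^m\otimes R^p \to R^n\otimes R^q$ is the tensor product map, and $S^d(\phi): S^d(R^m)\to S^d(R^n)$ and $\bigwedge^d(\phi): \bigwedge^d(R^m) \to \bigwedge^d (R^n)$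 are the $d$-th symmetric and exterior powers of $\phi$. The zeroth power of an ideal is $R$. *)

theory Defs
  imports "Jordan_Normal_Form.Determinant" "HOL-Library.Poly_Mapping"
begin

definition ideal_gen :: "'a::comm_ring_1 set \<Rightarrow> 'a set" where
  "ideal_gen S = Modules.module.span (*) S"

definition ideal_mult :: "'a::comm_ring_1 set \<Rightarrow> 'a set \<Rightarrow> 'a set" where
  "ideal_mult I J = ideal_gen {x * y | x y. x \<in> I \<and> y \<in> J}"

primrec ideal_power :: "'a::comm_ring_1 set \<Rightarrow> nat \<Rightarrow> 'a set" where
  "ideal_power I 0 = UNIV"
| "ideal_power I (Suc k) = ideal_mult I (ideal_power I k)"

definition integral_closure :: "'a::comm_ring_1 set \<Rightarrow> 'a set" where
  "integral_closure I =
    {x. \<exists>k\<ge>1. \<exists>c. (\<forall>i\<in>{1..k}. c i \<in> ideal_power I i) \<and>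
        x ^ k + (\<Sum>i = 1..k. c i * x ^ (k - i)) = 0}"

definition contains_rationals :: "'a::comm_ring_1 itself \<Rightarrow> bool" where
  "contains_rationals _ \<longleftrightarrow> (\<exists>h :: rat \<Rightarrow> 'a. inj_comm_ring_hom h)"

text \<open>The free module with finite basis \<open>B\<close> consists of the coordinate functions that
  vanish outside \<open>B\<close>; in particular \<open>R\<^sup>m\<close> is \<open>free_mod {..<m}\<close>.\<close>

definition free_mod :: "'b set \<Rightarrow> ('b \<Rightarrow> 'a::comm_ring_1) set" where
  "free_mod B = {v. \<forall>b. b \<notin> B \<longrightarrow> v b = 0}"

definition basis_vec :: "'b \<Rightarrow> 'b \<Rightarrow> 'a::comm_ring_1" where
  "basis_vec b = (\<lambda>x. if x = b then 1 else 0)"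

definition lin_map ::
  "'b set \<Rightarrow> 'c set \<Rightarrow> (('b \<Rightarrow> 'a::comm_ring_1) \<Rightarrow> ('c \<Rightarrow> 'a)) \<Rightarrow> bool" where
  "lin_map B C f \<longleftrightarrow>
    (\<forall>v \<in> free_mod B. f v \<in> free_mod C) \<and>
    (\<forall>v \<in> free_mod B. \<forall>w \<in> free_mod B. f (\<lambda>b. v b + w b) = (\<lambda>c. f v c + f w c)) \<and>
    (\<forall>r. \<forall>v \<in> free_mod B. f (\<lambda>b. r * v b) = (\<lambda>c. r * f v c))"

text \<open>The linear map that sends the basis vector with index \<open>b \<in> B\<close> to \<open>g b\<close>.\<close>

definition lin_extend :: "'b set \<Rightarrow> ('b \<Rightarrow> 'c \<Rightarrow> 'a) \<Rightarrow> ('b \<Rightarrow> 'a::comm_ring_1) \<Rightarrow> ('c \<Rightarrow> 'a)" where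
  "lin_extend B g v = (\<lambda>c. \<Sum>b\<in>B. v b * g b c)"

lemma lin_extend_basis_vec:
  assumes "finite B" "b \<in> B"
  shows "lin_extend B g (basis_vec b) = g b"
proof
  fix c
  have "lin_extend B g (basis_vec b) c = (\<Sum>x\<in>B. if x = b then g x c else 0)"
    unfolding lin_extend_def basis_vec_def by (intro sum.cong) auto
  then show "lin_extend B g (basis_vec b) c = g b c"
    using assms by simp
qed

lemma lin_map_eq_lin_extend:
  fixes f :: "('b \<Rightarrow> 'a::comm_ring_1) \<Rightarrow> ('c \<Rightarrow> 'a)"
  assumes f: "lin_map B C f" and B: "finite B" and v: "v \<in> free_mod B"
  shows "f v = lin_extend B (\<lambda>b. f (basis_vec b)) v"
proof -
  have scale: "f (\<lambda>b. r * w b) = (\<lambda>c. r * f w c)" if "w \<in> free_mod B" for r w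
    using f that unfolding lin_map_def by blast
  have add: "f (\<lambda>b. w b + w' b) = (\<lambda>c. f w c + f w' c)"
    if "w \<in> free_mod B" "w' \<in> free_mod B" for w w'
    using f that unfolding lin_map_def by blast
  have *: "f (\<lambda>x. \<Sum>b\<in>A. v b * basis_vec b x) = (\<lambda>c. \<Sum>b\<in>A. v b * f (basis_vec b) c)
      \<and> (\<lambda>x. \<Sum>b\<in>A. v b * basis_vec b x) \<in> free_mod B" if "finite A" "A \<subseteq> B" for A
    using that
  proof (induction A rule: finite_induct)
    case empty
    have "(\<lambda>_. 0 :: 'a) \<in> free_mod B" by (simp add: free_mod_def)
    from scale[OF this, of 0] show ?case by (simp add: free_mod_def)
  next
    case (insert a A)
    let ?w = "\<lambda>x. \<Sum>b\<in>A. v b * basis_vec b x"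
    have e: "(basis_vec a :: 'b \<Rightarrow> 'a) \<in> free_mod B"
      using insert.prems by (auto simp: free_mod_def basis_vec_def)
    then have ve: "(\<lambda>x. v a * basis_vec a x) \<in> free_mod B"
      by (auto simp: free_mod_def)
    have w: "?w \<in> free_mod B" using insert by simp
    have "f (\<lambda>x. v a * basis_vec a x + ?w x) = (\<lambda>c. f (\<lambda>x. v a * basis_vec a x) c + f ?w c)"
      using add[OF ve w] .
    moreover have "f (\<lambda>x. v a * basis_vec a x) = (\<lambda>c. v a * f (basis_vec a) c)"
      using scale[OF e] .
    moreover have "(\<lambda>x. v a * basis_vec a x + ?w x) \<in> free_mod B"
      using ve w unfolding free_mod_def by simp
    ultimately show ?case using insert by simp
  qed
  have "(\<lambda>x. \<Sum>b\<in>B. v b * basis_vec b x) = v"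
  proof
    fix x
    have "(\<Sum>b\<in>B. v b * basis_vec b x) = (\<Sum>b\<in>B. if b = x then v b else 0)"
      unfolding basis_vec_def by (intro sum.cong) auto
    then show "(\<Sum>b\<in>B. v b * basis_vec b x) = v x"
      using B v by (auto simp: free_mod_def)
  qed
  then show ?thesis using *[OF B subset_refl] by (simp add: lin_extend_def)
qed

text \<open>The rows and columns of a minor are chosen by injections \<open>\<rho>\<close> and \<open>\<kappa>\<close>. As the index sets
  carry no order, each minor occurs up to sign, which does not affect the ideal. The only minor of
  size 0 is 1, and there are no minors if \<open>t\<close> exceeds \<open>card B\<close> or \<open>card C\<close>.\<close>

definition minors ::
  "'b set \<Rightarrow> 'c set \<Rightarrow> nat \<Rightarrow> (('b \<Rightarrow> 'a::comm_ring_1) \<Rightarrow> ('c \<Rightarrow> 'a)) \<Rightarrow> 'a set" where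
  "minors B C t \<chi> =
    {det (mat t t (\<lambda>(i, j). \<chi> (basis_vec (\<kappa> j)) (\<rho> i))) | \<rho> \<kappa>.
       \<rho> \<in> {..<t} \<rightarrow> C \<and> inj_on \<rho> {..<t} \<and> \<kappa> \<in> {..<t} \<rightarrow> B \<and> inj_on \<kappa> {..<t}}"

definition minor_ideal ::
  "'b set \<Rightarrow> 'c set \<Rightarrow> nat \<Rightarrow> (('b \<Rightarrow> 'a::comm_ring_1) \<Rightarrow> ('c \<Rightarrow> 'a)) \<Rightarrow> 'a set" where
  "minor_ideal B C t \<chi> = ideal_gen (minors B C t \<chi>)"

definition max_minor_ideal ::
  "'b set \<Rightarrow> 'c set \<Rightarrow> (('b \<Rightarrow> 'a::comm_ring_1) \<Rightarrow> ('c \<Rightarrow> 'a)) \<Rightarrow> 'a set" where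
  "max_minor_ideal B C \<chi> = minor_ideal B C (card C) \<chi>"

text \<open>\<open>R\<^sup>m \<otimes> R\<^sup>p\<close> has the basis \<open>e\<^sub>j \<otimes> e\<^sub>l\<close>, indexed by the pairs \<open>(j, l)\<close>.\<close>

definition tensor_index :: "nat \<Rightarrow> nat \<Rightarrow> (nat \<times> nat) set" where
  "tensor_index m p = {..<m} \<times> {..<p}"

definition tensor_vec :: "(nat \<Rightarrow> 'a::comm_ring_1) \<Rightarrow> (nat \<Rightarrow> 'a) \<Rightarrow> (nat \<times> nat \<Rightarrow> 'a)" where
  "tensor_vec u v = (\<lambda>(i, k). u i * v k)"

definition tensor_map ::
  "nat \<Rightarrow> nat \<Rightarrow> ((nat \<Rightarrow> 'a::comm_ring_1) \<Rightarrow> (nat \<Rightarrow> 'a)) \<Rightarrow> ((nat \<Rightarrow> 'a) \<Rightarrow> (nat \<Rightarrow> 'a)) \<Rightarrow>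
    (nat \<times> nat \<Rightarrow> 'a) \<Rightarrow> (nat \<times> nat \<Rightarrow> 'a)" where
  "tensor_map m p \<phi> \<psi> =
    lin_extend (tensor_index m p)
      (\<lambda>(j, l). tensor_vec (\<phi> (basis_vec j)) (\<psi> (basis_vec l)))"

lemma tensor_map_tensor_vec:
  assumes "lin_map {..<m} {..<n} \<phi>" "lin_map {..<p} {..<q} \<psi>"
    and "u \<in> free_mod {..<m}" "v \<in> free_mod {..<p}"
  shows "tensor_map m p \<phi> \<psi> (tensor_vec u v) = tensor_vec (\<phi> u) (\<psi> v)"
proof
  fix x :: "nat \<times> nat"
  obtain i k where x: "x = (i, k)" by force
  have "\<phi> u i = (\<Sum>j<m. u j * \<phi> (basis_vec j) i)"
    using lin_map_eq_lin_extend[OF assms(1) _ assms(3)] by (simp add: lin_extend_def)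
  moreover have "\<psi> v k = (\<Sum>l<p. v l * \<psi> (basis_vec l) k)"
    using lin_map_eq_lin_extend[OF assms(2) _ assms(4)] by (simp add: lin_extend_def)
  ultimately show "tensor_map m p \<phi> \<psi> (tensor_vec u v) x = tensor_vec (\<phi> u) (\<psi> v) x"
    unfolding tensor_map_def lin_extend_def tensor_vec_def tensor_index_def x
    by (simp add: sum_product sum.cartesian_product case_prod_beta ac_simps)
qed

text \<open>The symmetric algebra of \<open>R\<^sup>m\<close> is the polynomial ring in variables \<open>X\<^sub>i\<close> with \<open>i < m\<close>, where
  \<open>e\<^sub>i\<close> corresponds to \<open>X\<^sub>i\<close>. Polynomials are elements of \<open>(nat \<Rightarrow>\<^sub>0 nat) \<Rightarrow>\<^sub>0 'a\<close>. The \<open>d\<close>-th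
  symmetric power has the monomials of degree \<open>d\<close> as its basis, indexed by exponent vectors.\<close>

definition sym_index :: "nat \<Rightarrow> nat \<Rightarrow> (nat \<Rightarrow>\<^sub>0 nat) set" where
  "sym_index m d =
    {\<alpha>. Poly_Mapping.keys \<alpha> \<subseteq> {..<m} \<and> (\<Sum>j<m. Poly_Mapping.lookup \<alpha> j) = d}"

definition linear_form :: "nat \<Rightarrow> (nat \<Rightarrow> 'a::comm_ring_1) \<Rightarrow> (nat \<Rightarrow>\<^sub>0 nat) \<Rightarrow>\<^sub>0 'a" where
  "linear_form n v = (\<Sum>i<n. Poly_Mapping.single (Poly_Mapping.single i 1) (v i))"

text \<open>The monomial \<open>\<Prod>\<^sub>j X\<^sub>j\<^bsup>\<alpha>\<^sub>j\<^esup>\<close> is mapped to \<open>\<Prod>\<^sub>j \<phi>(e\<^sub>j)\<^bsup>\<alpha>\<^sub>j\<^esup>\<close>.\<close>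

definition sym_power_map ::
  "nat \<Rightarrow> nat \<Rightarrow> nat \<Rightarrow> ((nat \<Rightarrow> 'a::comm_ring_1) \<Rightarrow> (nat \<Rightarrow> 'a)) \<Rightarrow>
    ((nat \<Rightarrow>\<^sub>0 nat) \<Rightarrow> 'a) \<Rightarrow> ((nat \<Rightarrow>\<^sub>0 nat) \<Rightarrow> 'a)" where
  "sym_power_map m n d \<phi> =
    lin_extend (sym_index m d)
      (\<lambda>\<alpha>. Poly_Mapping.lookup
         (\<Prod>j<m. linear_form n (\<phi> (basis_vec j)) ^ Poly_Mapping.lookup \<alpha> j))"

text \<open>The exterior algebra of \<open>R\<^sup>m\<close> has the basis \<open>e\<^sub>J = e\<^sub>j\<^sub>1 \<and> \<dots> \<and> e\<^sub>j\<^sub>d\<close>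
  for \<open>J = {j\<^sub>1 < \<dots> < j\<^sub>d} \<subseteq> {..<m}\<close>. If \<open>A\<close> and \<open>B\<close> are disjoint then \<open>e\<^sub>A \<and> e\<^sub>B\<close> is
  \<open>e\<^bsub>A \<union> B\<^esub>\<close> with the sign given by the number of pairs \<open>(a, b) \<in> A \<times> B\<close> with \<open>b < a\<close>;
  otherwise it is 0.\<close>

definition ext_index :: "nat \<Rightarrow> nat \<Rightarrow> nat set set" where
  "ext_index m d = {J. J \<subseteq> {..<m} \<and> card J = d}"

definition wedge ::
  "(nat set \<Rightarrow> 'a::comm_ring_1) \<Rightarrow> (nat set \<Rightarrow> 'a) \<Rightarrow> (nat set \<Rightarrow> 'a)" where
  "wedge f g =
    (\<lambda>I. \<Sum>A\<in>Pow I. (-1) ^ card {(a, b). a \<in> A \<and> b \<in> I - A \<and> b < a} * f A * g (I - A))"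

lemma wedge_basis_vec:
  fixes A B :: "nat set"
  assumes "finite A" "finite B"
  shows "(wedge (basis_vec A) (basis_vec B) :: nat set \<Rightarrow> 'a::comm_ring_1) =
    (\<lambda>I. if A \<inter> B = {}
         then (-1) ^ card {(a, b). a \<in> A \<and> b \<in> B \<and> b < a} * basis_vec (A \<union> B) I else 0)"
proof
  fix I :: "nat set"
  let ?s = "\<lambda>X. (-1) ^ card {(a, b). a \<in> X \<and> b \<in> I - X \<and> b < a} :: 'a"
  have "(wedge (basis_vec A) (basis_vec B) I :: 'a) =
      (\<Sum>X\<in>Pow I. if X = A then ?s X * basis_vec B (I - X) else 0)"
    unfolding wedge_def by (intro sum.cong) (auto simp: basis_vec_def)
  also have "\<dots> = (if A \<inter> B = {}
      then (-1) ^ card {(a, b). a \<in> A \<and> b \<in> B \<and> b < a} * basis_vec (A \<union> B) I else 0)"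
  proof (cases "finite I")
    case True
    have eq: "A \<subseteq> I \<and> I - A = B \<longleftrightarrow> A \<inter> B = {} \<and> I = A \<union> B" by blast
    show ?thesis
    proof (cases "A \<subseteq> I \<and> I - A = B")
      case T: True
      then have "A \<inter> B = {}" "I = A \<union> B" using eq by blast+
      then show ?thesis using True T by (simp add: basis_vec_def)
    next
      case F: False
      then have "\<not> (A \<inter> B = {} \<and> I = A \<union> B)" using eq by blast
      then show ?thesis using True F by (auto simp: basis_vec_def)
    qed
  next
    case False
    then have "I \<noteq> A \<union> B" using assms by auto
    then show ?thesis using False by (simp add: basis_vec_def)
  qed
  finally show "(wedge (basis_vec A) (basis_vec B) I :: 'a) = (if A \<inter> B = {}
      then (-1) ^ card {(a, b). a \<in> A \<and> b \<in> B \<and> b < a} * basis_vec (A \<union> B) I else 0)" .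
qed

definition ext_vec :: "nat \<Rightarrow> (nat \<Rightarrow> 'a::comm_ring_1) \<Rightarrow> (nat set \<Rightarrow> 'a)" where
  "ext_vec n v = (\<lambda>I. \<Sum>i<n. v i * basis_vec {i} I)"

definition wedge_list :: "(nat set \<Rightarrow> 'a::comm_ring_1) list \<Rightarrow> (nat set \<Rightarrow> 'a)" where
  "wedge_list fs = foldr wedge fs (basis_vec {})"

definition ext_power_map ::
  "nat \<Rightarrow> nat \<Rightarrow> nat \<Rightarrow> ((nat \<Rightarrow> 'a::comm_ring_1) \<Rightarrow> (nat \<Rightarrow> 'a)) \<Rightarrow>
    (nat set \<Rightarrow> 'a) \<Rightarrow> (nat set \<Rightarrow> 'a)" where
  "ext_power_map m n d \<phi> =
    lin_extend (ext_index m d)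
      (\<lambda>J. wedge_list (map (\<lambda>j. ext_vec n (\<phi> (basis_vec j))) (sorted_list_of_set J)))"

end

theory Submission
  imports Defs "HOL-Library.List_Lexorder" "HOL-Library.FuncSet"
begin

text \<open>A maximal minor of \<open>S\<^sup>d(\<phi>)\<close> is multilinear in columns of \<open>\<phi>\<close>, with integer coefficients
  indexed by words over the row indices. Row operations on \<open>\<phi>\<close> act on the target with trace 0, so
  the coefficient function is a highest weight function of rectangular weight. Over the integers
  such functions are spanned by products of \<open>n \<times> n\<close> brackets: the lexicographically leading word is
  a ballot word by \<open>sl\<^sub>2\<close> theory, a product of brackets with the same leading word is subtracted,
  and no division occurs. This gives the inclusions over every ring. For a matrix \<open>Y\<close> with columns in
  the column span of \<open>\<phi>\<close> the same expansion gives \<open>det (S\<^sup>d(Y)) = det(Y)\<^sup>s\<close>, which therefore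
  lies in \<open>I(S\<^sup>d(\<phi>))\<close>. Taking maximal minors for \<open>det(Y)\<close> yields the equality of integral
  closures. Polarizing \<open>det(Y)\<^sup>s\<close> and antisymmetrizing yields a positive integer multiple of
  each product of \<open>s\<close> maximal minors, hence equality over the rationals. Exterior powers and tensor
  products are treated in the same way.\<close>

section \<open>Highest weight functions on words\<close>

text \<open>The obstacle is that the inclusions are claimed over every commutative ring, so the
  representation theory has to take place over the integers. For this reason the d arguments of each
  of the N columns of a minor (N being the rank of the target) are treated as N * d independent
  vectors, even where some of them coincide; the minor then has integer coefficients on words,
  without factorial denominators. The exponents count letters: over the whole target basis every
  letter occurs equally often, namely s (or e) times, and N * d = n * s. For tensor products a
  coefficient depends on two words, one for each factor. Expanding in the first word must leave
  coefficients that are highest weight functions of the second, which is why the bracket expansion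
  carries a parameter and a subgroup \<open>W\<close>. For integral closures no minor is recovered
  exactly. A product g of s maximal minors satisfies that g^s lies in the s-th power of the smaller
  ideal, because the s-th power of each single factor lies in that ideal; this already forces equal
  integral closures.\<close>

definition words :: "nat \<Rightarrow> nat \<Rightarrow> nat list set" where
  "words n l = {w. set w \<subseteq> {..<n} \<and> length w = l}"

text \<open>The adjoint of the derivation that replaces a letter \<open>i\<close> by \<open>Suc i\<close>, a raising operator of
  \<open>sl\<^sub>n\<close>.\<close>

definition raise :: "nat \<Rightarrow> (nat list \<Rightarrow> int) \<Rightarrow> nat list \<Rightarrow> int" where
  "raise i f w = (\<Sum>p<length w. if w ! p = i then f (w[p := Suc i]) else 0)"

lemma finite_words: "finite (words n l)"
  unfolding words_def by (rule finite_lists_length_eq) simp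

lemma words_0: "words n 0 = {[]}"
  by (auto simp: words_def)

lemma Cons_in_words_Suc: "k # w \<in> words n (Suc l) \<longleftrightarrow> k < n \<and> w \<in> words n l"
  by (auto simp: words_def)

lemma words_SucE:
  assumes "w \<in> words n (Suc l)"
  obtains k v where "w = k # v" "k < n" "v \<in> words n l"
  using assms by (cases w) (auto simp: words_def)

lemma nth_words_less: "w \<in> words n l \<Longrightarrow> p < l \<Longrightarrow> w ! p < n"
  using nth_mem[of p w] subsetD[of "set w" "{..<n}" "w ! p"] by (simp add: words_def)

lemma raise_Nil: "raise i f [] = 0"
  by (simp add: raise_def)

lemma raise_Cons:
  "raise i f (k # w) = raise i (\<lambda>v. f (k # v)) w + (if k = i then f (Suc i # w) else 0)"
  unfolding raise_def by (simp add: sum.lessThan_Suc_shift del: sum.lessThan_Suc cong: if_cong)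

lemma raise_funpow_add:
  "(raise i ^^ r) (\<lambda>w. f w + c * g w) w = (raise i ^^ r) f w + c * (raise i ^^ r) g w"
proof (induction r arbitrary: f g)
  case (Suc r)
  have "raise i (\<lambda>w. f w + c * g w) = (\<lambda>w. raise i f w + c * raise i g w)"
    by (rule ext, unfold raise_def sum_distrib_left sum.distrib[symmetric])
       (auto intro!: sum.cong)
  then show ?case using Suc by (simp add: funpow_Suc_right del: funpow.simps)
qed simp

lemma raise_funpow_Cons_neq:
  assumes "k \<noteq> i"
  shows "(raise i ^^ r) f (k # w) = (raise i ^^ r) (\<lambda>v. f (k # v)) w"
proof (induction r arbitrary: f)
  case (Suc r)
  have "(\<lambda>v. raise i f (k # v)) = raise i (\<lambda>v. f (k # v))"
    using assms by (simp add: fun_eq_iff raise_Cons)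
  then show ?case using Suc[of "raise i f"] by (simp add: funpow_Suc_right del: funpow.simps)
qed simp

text \<open>At most one of the \<open>Suc r\<close> applications can act on the leading
  \<open>i\<close>, since afterwards that letter is \<open>Suc i\<close> and out of reach. The
  factor \<open>Suc r\<close> counts which application it is.\<close>

lemma raise_funpow_Cons_eq:
  "(raise i ^^ Suc r) f (i # w) =
    (raise i ^^ Suc r) (\<lambda>v. f (i # v)) w + int (Suc r) * (raise i ^^ r) (\<lambda>v. f (Suc i # v)) w"
proof (induction r arbitrary: f)
  case 0
  then show ?case by (simp add: raise_Cons)
next
  case (Suc r)
  have e1: "(\<lambda>v. raise i f (i # v)) = (\<lambda>v. raise i (\<lambda>v. f (i # v)) v + 1 * f (Suc i # v))"
    by (simp add: fun_eq_iff raise_Cons)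
  have e2: "(\<lambda>v. raise i f (Suc i # v)) = raise i (\<lambda>v. f (Suc i # v))"
    by (simp add: fun_eq_iff raise_Cons)
  have "(raise i ^^ Suc (Suc r)) f (i # w) = (raise i ^^ Suc r) (raise i f) (i # w)"
    by (subst funpow_Suc_right) simp
  also have "\<dots> = (raise i ^^ Suc r) (\<lambda>v. raise i f (i # v)) w
      + int (Suc r) * (raise i ^^ r) (\<lambda>v. raise i f (Suc i # v)) w"
    by (rule Suc)
  also have "(raise i ^^ Suc r) (\<lambda>v. raise i f (i # v)) w
     = (raise i ^^ Suc (Suc r)) (\<lambda>v. f (i # v)) w + (raise i ^^ Suc r) (\<lambda>v. f (Suc i # v)) w"
    unfolding e1 raise_funpow_add by (subst (3) funpow_Suc_right) simp
  also have "(raise i ^^ r) (\<lambda>v. raise i f (Suc i # v)) w = (raise i ^^ Suc r) (\<lambda>v. f (Suc i # v)) w"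
    unfolding e2 by (subst funpow_Suc_right) simp
  finally show ?case by (simp add: algebra_simps del: funpow.simps)
qed

lemma list_update_in_words:
  "w \<in> words n l \<Longrightarrow> k < n \<Longrightarrow> w[p := k] \<in> words n l"
  using set_update_subset_insert[of w p k] by (auto simp: words_def)

lemma raise_funpow_zero:
  assumes "\<And>w. w \<in> words n l \<Longrightarrow> f w = 0" "Suc i < n" "w \<in> words n l"
  shows "(raise i ^^ r) f w = 0"
  using assms(1,3)
proof (induction r arbitrary: f w)
  case (Suc r)
  have "raise i f w = 0" if "w \<in> words n l" for w
    unfolding raise_def using that list_update_in_words[OF that assms(2)] Suc.prems(1)
    by (intro sum.neutral) auto
  then show ?case using Suc.IH[of "raise i f"] Suc.prems(2)
    by (simp add: funpow_Suc_right del: funpow.simps)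
qed simp

text \<open>The \<open>sl\<^sub>2\<close> fact that the \<open>r\<close>-th power of the raising operator is injective on the weight spaces
  of weight at most \<open>-r\<close>. Powers are needed for the induction on the length.\<close>

lemma raise_funpow_inj:
  assumes "a + r \<le> b" "Suc i < n"
    and "\<And>w. w \<in> words n l \<Longrightarrow> (raise i ^^ r) f w = 0"
    and "\<And>w. w \<in> words n l \<Longrightarrow> f w \<noteq> 0 \<Longrightarrow> count_list w i = a \<and> count_list w (Suc i) = b"
    and "w \<in> words n l"
  shows "f w = 0"
  using assms
proof (induction l arbitrary: f a b r w)
  case 0
  show ?case
  proof (rule ccontr)
    assume "f w \<noteq> 0"
    with 0 have "b = 0" by (force simp: words_0)
    with 0 have "r = 0" by simp
    with 0 \<open>f w \<noteq> 0\<close> show False by auto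
  qed
next
  case (Suc l)
  note inW = Cons_in_words_Suc
  have z: "(raise i ^^ r) f (k # v) = 0" if "k < n" "v \<in> words n l" for k v
    using Suc.prems(3) that by (simp add: inW)
  have cnt: "count_list (k # v) i = a \<and> count_list (k # v) (Suc i) = b"
    if "k < n" "v \<in> words n l" "f (k # v) \<noteq> 0" for k v
    using Suc.prems(4)[of "k # v"] that unfolding inW by blast
  have neq: "f (k # v) = 0" if "k < n" "v \<in> words n l" "k \<noteq> i" "k \<noteq> Suc i" for k v
  proof (rule Suc.IH[of a r b "\<lambda>v. f (k # v)" v])
    show "(raise i ^^ r) (\<lambda>v. f (k # v)) w = 0" if "w \<in> words n l" for w
      using z[OF \<open>k < n\<close> that] raise_funpow_Cons_neq[OF \<open>k \<noteq> i\<close>] by metis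
    show "count_list w i = a \<and> count_list w (Suc i) = b" if "w \<in> words n l" "f (k # w) \<noteq> 0" for w
      using cnt[OF \<open>k < n\<close> that] \<open>k \<noteq> i\<close> \<open>k \<noteq> Suc i\<close> by simp
  qed (use Suc.prems that in auto)
  have upz: "(raise i ^^ r) (\<lambda>v. f (Suc i # v)) v = 0" if "v \<in> words n l" for v
    using z[OF Suc.prems(2) that] raise_funpow_Cons_neq[of "Suc i" i r f v] by simp
  have up: "f (Suc i # v) = 0"
    if "v \<in> words n l" "a + t \<le> b - 1" "\<And>v. v \<in> words n l \<Longrightarrow> (raise i ^^ t) (\<lambda>v. f (Suc i # v)) v = 0"
    for v t
  proof (rule Suc.IH[of a t "b - 1" "\<lambda>v. f (Suc i # v)" v])
    show "count_list w i = a \<and> count_list w (Suc i) = b - 1"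
      if "w \<in> words n l" "f (Suc i # w) \<noteq> 0" for w
      using cnt[OF Suc.prems(2) that] by auto
  qed (use Suc.prems(2) that in auto)
  have low: "f (i # v) = 0"
    if "v \<in> words n l" "a - 1 + t \<le> b" "\<And>v. v \<in> words n l \<Longrightarrow> (raise i ^^ t) (\<lambda>v. f (i # v)) v = 0"
    for v t
  proof (rule Suc.IH[of "a - 1" t b "\<lambda>v. f (i # v)" v])
    show "count_list w i = a - 1 \<and> count_list w (Suc i) = b"
      if "w \<in> words n l" "f (i # w) \<noteq> 0" for w
      using cnt[OF Suc_lessD[OF Suc.prems(2)] that] by auto
  qed (use Suc.prems(2) that in auto)
  \<comment> \<open>Let A and B be \<open>f\<close> on words starting with \<open>i\<close> and
    \<open>Suc i\<close>; their letter counts are (a-1, b) and (a, b-1). The hypothesis becomes the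
    pair raise^r B = 0 and raise^r A + r * raise^(r-1) B = 0. If a + r \<le> b - 1, the induction
    hypothesis kills B and then A.\<close>
  have main: "f (Suc i # v) = 0 \<and> f (i # v) = 0" if v: "v \<in> words n l" for v
  proof (cases "b = 0")
    case True
    then have "r = 0" using Suc.prems(1) by simp
    then show ?thesis using z v Suc.prems(2) by simp
  next
    case b: False
    show ?thesis
    proof (cases r)
      case 0
      then show ?thesis using z v Suc.prems(2) by simp
    next
      case (Suc t)
      have eq: "(raise i ^^ Suc t) (\<lambda>v. f (i # v)) v + int (Suc t) * (raise i ^^ t) (\<lambda>v. f (Suc i # v)) v = 0"
        if "v \<in> words n l" for v
        using z[of i v] that Suc.prems(2) raise_funpow_Cons_eq[of t i f v]
        unfolding Suc by simp
      have a0: "f (i # v) = 0" if "a = 0" "v \<in> words n l" for v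
        using cnt[of i v] that Suc.prems(2) by fastforce
      show ?thesis
      proof (cases "a + r \<le> b - 1")
        case True
        have u0: "\<And>v. v \<in> words n l \<Longrightarrow> f (Suc i # v) = 0"
          by (rule up[OF _ True upz])
        show ?thesis
        proof (cases "a = 0")
          case False
          have "f (i # v) = 0"
          proof (rule low[OF v, of r])
            show "(raise i ^^ r) (\<lambda>v. f (i # v)) v = 0" if v: "v \<in> words n l" for v
              using eq[OF v] raise_funpow_zero[of n l "\<lambda>v. f (Suc i # v)", OF u0 Suc.prems(2) v, of t] unfolding Suc by simp
          qed (use True in auto)
          then show ?thesis using u0 v by simp
        qed (use u0 v a0 in auto)
      next
        case False
        \<comment> \<open>In the boundary case the bound fails for B with exponent r. One more
          raising of the second equation removes B, so A vanishes with exponent r + 1; what remains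
          is r * raise^(r-1) B = 0, where the nonzero integer r is cancelled and the exponent r - 1
          fits the bound for B.\<close>
        with Suc.prems(1) have br: "b = a + r" by simp
        have l0: "f (i # v) = 0" if v: "v \<in> words n l" for v
        proof (cases "a = 0")
          case False
          show ?thesis
          proof (rule low[OF v, of "Suc r"])
            show "(raise i ^^ Suc r) (\<lambda>v. f (i # v)) v = 0" if v: "v \<in> words n l" for v
            proof -
              let ?g = "\<lambda>v. (raise i ^^ r) (\<lambda>v. f (i # v)) v + int r * (raise i ^^ t) (\<lambda>v. f (Suc i # v)) v"
              have g0: "?g v = 0" if "v \<in> words n l" for v using eq[OF that] unfolding Suc .
              have "raise i ?g v = 0" using raise_funpow_zero[of n l ?g, OF g0 Suc.prems(2) v, of 1] by simp
              moreover have "raise i ?g v = (raise i ^^ Suc r) (\<lambda>v. f (i # v)) v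
                  + int r * (raise i ^^ r) (\<lambda>v. f (Suc i # v)) v"
                using raise_funpow_add[of 1 i "(raise i ^^ r) (\<lambda>v. f (i # v))" "int r"
                    "(raise i ^^ t) (\<lambda>v. f (Suc i # v))" v] unfolding Suc by simp
              ultimately show ?thesis using upz[OF v] by simp
            qed
          qed (use False br in auto)
        qed (use a0 v in auto)
        have "f (Suc i # v) = 0"
        proof (rule up[OF v, of t])
          show "(raise i ^^ t) (\<lambda>v. f (Suc i # v)) v = 0" if v: "v \<in> words n l" for v
            using eq[OF v] raise_funpow_zero[of n l "\<lambda>v. f (i # v)", OF l0 Suc.prems(2) v, of "Suc t"] by simp
        qed (use br Suc in auto)
        then show ?thesis using l0 v by simp
      qed
    qed
  qed
  obtain k v where "w = k # v" "k < n" "v \<in> words n l" using Suc.prems(5) by (rule words_SucE)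
  then show ?case using neq main by (cases "k = i"; cases "k = Suc i") auto
qed

section \<open>Determinants and bracket products\<close>

lemma det_mat_cong:
  assumes "\<And>i j. i < N \<Longrightarrow> j < N \<Longrightarrow> A i j = B i j"
  shows "det (mat N N (\<lambda>(i, j). A i j)) = det (mat N N (\<lambda>(i, j). B i j))"
  using assms by (intro arg_cong[of _ _ det] eq_matI) auto

lemma det_replace_col_sum:
  fixes A :: "nat \<Rightarrow> nat \<Rightarrow> 'a::comm_ring_1"
  assumes "c < N"
  shows "det (mat N N (\<lambda>(i, j). if j = c then v i else A i j)) =
    (\<Sum>r<N. v r * cofactor (mat N N (\<lambda>(i, j). A i j)) r c)"
proof -
  let ?M = "mat N N (\<lambda>(i, j). if j = c then v i else A i j)"
  have "det ?M = (\<Sum>r<N. ?M $$ (r, c) * cofactor ?M r c)"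
    by (rule laplace_expansion_column) (use assms in auto)
  also have "\<dots> = (\<Sum>r<N. v r * cofactor (mat N N (\<lambda>(i, j). A i j)) r c)"
  proof (intro sum.cong refl)
    fix r assume "r \<in> {..<N}"
    have "mat_delete ?M r c = mat_delete (mat N N (\<lambda>(i, j). A i j)) r c"
      unfolding mat_delete_def using assms \<open>r \<in> {..<N}\<close> by (intro eq_matI) auto
    then show "?M $$ (r, c) * cofactor ?M r c = v r * cofactor (mat N N (\<lambda>(i, j). A i j)) r c"
      using assms \<open>r \<in> {..<N}\<close> by (simp add: cofactor_def)
  qed
  finally show ?thesis .
qed

lemma det_replace_row_sum:
  fixes A :: "nat \<Rightarrow> nat \<Rightarrow> 'a::comm_ring_1"
  assumes "r < N"
  shows "det (mat N N (\<lambda>(i, j). if i = r then v j else A i j)) =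
    (\<Sum>c<N. v c * cofactor (mat N N (\<lambda>(i, j). A i j)) r c)"
proof -
  let ?M = "mat N N (\<lambda>(i, j). if i = r then v j else A i j)"
  have "det ?M = (\<Sum>c<N. ?M $$ (r, c) * cofactor ?M r c)"
    by (rule laplace_expansion_row) (use assms in auto)
  also have "\<dots> = (\<Sum>c<N. v c * cofactor (mat N N (\<lambda>(i, j). A i j)) r c)"
  proof (intro sum.cong refl)
    fix c assume "c \<in> {..<N}"
    have "mat_delete ?M r c = mat_delete (mat N N (\<lambda>(i, j). A i j)) r c"
      unfolding mat_delete_def using assms \<open>c \<in> {..<N}\<close> by (intro eq_matI) auto
    then show "?M $$ (r, c) * cofactor ?M r c = v c * cofactor (mat N N (\<lambda>(i, j). A i j)) r c"
      using assms \<open>c \<in> {..<N}\<close> by (simp add: cofactor_def)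
  qed
  finally show ?thesis .
qed

text \<open>Both sides are the sum of \<open>V r c\<close> times the cofactor at (r, c), that is,
  the derivative of the determinant at A in the direction V.\<close>

lemma sum_det_replace_col_eq_row:
  fixes A V :: "nat \<Rightarrow> nat \<Rightarrow> 'a::comm_ring_1"
  shows "(\<Sum>c<N. det (mat N N (\<lambda>(i, j). if j = c then V i c else A i j))) =
    (\<Sum>r<N. det (mat N N (\<lambda>(i, j). if i = r then V r j else A i j)))"
proof -
  have "(\<Sum>c<N. det (mat N N (\<lambda>(i, j). if j = c then V i c else A i j))) =
      (\<Sum>c<N. \<Sum>r<N. V r c * cofactor (mat N N (\<lambda>(i, j). A i j)) r c)"
    by (intro sum.cong refl) (rule det_replace_col_sum, simp)
  also have "\<dots> = (\<Sum>r<N. \<Sum>c<N. V r c * cofactor (mat N N (\<lambda>(i, j). A i j)) r c)"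
    by (rule sum.swap)
  also have "\<dots> = (\<Sum>r<N. det (mat N N (\<lambda>(i, j). if i = r then V r j else A i j)))"
    by (intro sum.cong refl) (rule det_replace_row_sum[symmetric], simp)
  finally show ?thesis .
qed

text \<open>The derivative of the determinant at A in the direction L A is tr(L) det(A), by the
  orthogonality of rows and cofactors. This is how a trace-zero action annihilates
  determinants.\<close>

lemma sum_det_derivation:
  fixes A L :: "nat \<Rightarrow> nat \<Rightarrow> 'a::comm_ring_1"
  shows "(\<Sum>c<N. det (mat N N (\<lambda>(i, j). if j = c then \<Sum>k<N. L i k * A k c else A i j))) =
    (\<Sum>k<N. L k k) * det (mat N N (\<lambda>(i, j). A i j))"
proof -
  let ?A = "mat N N (\<lambda>(i, j). A i j)"
  have adj: "(\<Sum>c<N. A k c * cofactor ?A r c) = (if r = k then det ?A else 0)" if "r < N" "k < N" for r k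
  proof -
    have "(\<Sum>c<N. A k c * cofactor ?A r c) = det (mat N N (\<lambda>(i, j). if i = r then A k j else A i j))"
      by (rule det_replace_row_sum[symmetric]) fact
    also have "\<dots> = (if r = k then det ?A else 0)"
    proof (cases "r = k")
      case True
      then show ?thesis by (auto intro!: arg_cong[of _ _ det] eq_matI)
    next
      case False
      have "det (mat N N (\<lambda>(i, j). if i = r then A k j else A i j)) = 0"
        by (rule det_identical_rows[OF _ False that]) (use that False in auto)
      then show ?thesis using False by simp
    qed
    finally show ?thesis .
  qed
  have "(\<Sum>c<N. det (mat N N (\<lambda>(i, j). if j = c then \<Sum>k<N. L i k * A k c else A i j))) =
      (\<Sum>c<N. \<Sum>r<N. (\<Sum>k<N. L r k * A k c) * cofactor ?A r c)"
    by (intro sum.cong refl) (rule det_replace_col_sum, simp)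
  also have "\<dots> = (\<Sum>c<N. \<Sum>r<N. \<Sum>k<N. L r k * (A k c * cofactor ?A r c))"
    by (simp add: sum_distrib_right mult.assoc)
  also have "\<dots> = (\<Sum>r<N. \<Sum>k<N. \<Sum>c<N. L r k * (A k c * cofactor ?A r c))"
    by (rule trans[OF sum.swap]) (intro sum.cong refl sum.swap)
  also have "\<dots> = (\<Sum>r<N. \<Sum>k<N. if r = k then L r k * det ?A else 0)"
    by (intro sum.cong refl) (simp add: sum_distrib_left[symmetric] adj)
  also have "\<dots> = (\<Sum>k<N. L k k) * det ?A"
    by (simp add: sum_distrib_right)
  finally show ?thesis .
qed

lemma det_nonzero_permutes:
  fixes A :: "nat \<Rightarrow> nat \<Rightarrow> 'a::comm_ring_1"
  assumes "det (mat N N (\<lambda>(i, j). A i j)) \<noteq> 0"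
  obtains \<pi> where "\<pi> permutes {..<N}" "\<And>j. j < N \<Longrightarrow> A (\<pi> j) j \<noteq> 0"
proof -
  let ?M = "mat N N (\<lambda>(i, j). A i j)"
  have "(\<Sum>p | p permutes {0..<N}. signof p * (\<Prod>j<N. ?M $$ (p j, j))) \<noteq> 0"
    using assms det_col[of ?M N] by simp
  then obtain p where p: "p permutes {0..<N}" "(\<Prod>j<N. ?M $$ (p j, j)) \<noteq> 0"
    by (metis (no_types, lifting) mem_Collect_eq mult_zero_right sum.neutral)
  have "A (p j) j \<noteq> 0" if "j < N" for j
  proof
    assume "A (p j) j = 0"
    moreover have "p j < N" using permutes_in_image[OF p(1), of j] that by simp
    ultimately have "\<exists>j\<in>{..<N}. ?M $$ (p j, j) = 0" using that by force
    then show False using p(2) prod_zero[OF finite_lessThan] by metis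
  qed
  then show ?thesis using that p(1) by (metis atLeast0LessThan)
qed

section \<open>Highest weight functions of rectangular weight, ballot words and leading
  terms\<close>

definition highest_weight :: "nat \<Rightarrow> nat \<Rightarrow> (nat list \<Rightarrow> int) \<Rightarrow> bool" where
  "highest_weight n s f \<longleftrightarrow>
    (\<forall>w \<in> words n (n * s). (\<forall>i. Suc i < n \<longrightarrow> raise i f w = 0) \<and>
      (f w \<noteq> 0 \<longrightarrow> (\<forall>i<n. count_list w i = s)))"

text \<open>In \<open>tableau n s T\<close> the \<open>s\<close> columns of \<open>n\<close> boxes are filled with the positions of a word of length
  \<open>n * s\<close>; \<open>T k j\<close> is the position in column \<open>k\<close> and row \<open>j\<close>.\<close>

definition tableau :: "nat \<Rightarrow> nat \<Rightarrow> (nat \<Rightarrow> nat \<Rightarrow> nat) \<Rightarrow> bool" where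
  "tableau n s T \<longleftrightarrow> bij_betw (\<lambda>(k, j). T k j) ({..<s} \<times> {..<n}) {..<n * s}"

text \<open>The value of a product of s brackets when the vector at position p is the standard basis
  vector with index \<open>w ! p\<close>; hence it is the coefficient of the word w in the
  multilinear expansion of that product.\<close>

definition bracket_prod :: "nat \<Rightarrow> nat \<Rightarrow> (nat \<Rightarrow> nat \<Rightarrow> nat) \<Rightarrow> nat list \<Rightarrow> int" where
  "bracket_prod n s T w = (\<Prod>k<s. det (mat n n (\<lambda>(i, j). of_bool (w ! T k j = i))))"

lemma highest_weight_diff:
  assumes "highest_weight n s f" "highest_weight n s g"
  shows "highest_weight n s (\<lambda>w. f w - a * g w)"
proof -
  have "raise i (\<lambda>w. f w - a * g w) w = raise i f w - a * raise i g w" for i w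
    unfolding raise_def sum_distrib_left sum_subtractf[symmetric] by (intro sum.cong) auto
  then show ?thesis using assms unfolding highest_weight_def by fastforce
qed

lemma count_list_eq_card: "count_list w i = card {p. p < length w \<and> w ! p = i}"
  by (simp add: count_list_eq_length_filter length_filter_conv_card eq_commute[of i])

lemma tableau_sum:
  assumes "tableau n s T"
  shows "(\<Sum>p<n * s. f p) = (\<Sum>k<s. \<Sum>j<n. f (T k j))"
  using sum.reindex_bij_betw[of "\<lambda>(k, j). T k j" "{..<s} \<times> {..<n}" "{..<n * s}" f] assms
  by (simp add: tableau_def sum.cartesian_product case_prod_beta)

lemma tableau_prod:
  assumes "tableau n s T"
  shows "(\<Prod>p<n * s. f p) = (\<Prod>k<s. \<Prod>j<n. f (T k j))"
  using prod.reindex_bij_betw[of "\<lambda>(k, j). T k j" "{..<s} \<times> {..<n}" "{..<n * s}" f] assms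
  by (simp add: tableau_def prod.cartesian_product case_prod_beta)

lemma tableau_less: "tableau n s T \<Longrightarrow> k < s \<Longrightarrow> j < n \<Longrightarrow> T k j < n * s"
  by (force simp: tableau_def bij_betw_def)

lemma tableau_eq_iff:
  "tableau n s T \<Longrightarrow> k < s \<Longrightarrow> j < n \<Longrightarrow> k' < s \<Longrightarrow> j' < n \<Longrightarrow> T k j = T k' j' \<longleftrightarrow> k = k' \<and> j = j'"
  by (force simp: tableau_def bij_betw_def inj_on_def)

lemma bracket_prod_nonzero_permutes:
  assumes "bracket_prod n s T w \<noteq> 0" "k < s"
  obtains \<pi> where "\<pi> permutes {..<n}" "\<And>j. j < n \<Longrightarrow> w ! T k j = \<pi> j"
proof -
  have "det (mat n n (\<lambda>(i, j). of_bool (w ! T k j = i) :: int)) \<noteq> 0"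
    using assms by (auto simp: bracket_prod_def)
  then show ?thesis using that
    by (elim det_nonzero_permutes[where A = "\<lambda>i j. of_bool (w ! T k j = i)"]) auto
qed

text \<open>On each bracket, raising is the derivation by the elementary matrix with its single
  entry in row \<open>Suc i\<close> and column \<open>i\<close>, which has trace 0. A nonzero
  bracket contains every letter exactly once, so s of them contain every letter s times.\<close>

lemma highest_weight_bracket_prod:
  assumes T: "tableau n s T"
  shows "highest_weight n s (bracket_prod n s T)"
  unfolding highest_weight_def
proof (intro ballI conjI allI impI)
  fix w i assume w: "w \<in> words n (n * s)" and i: "Suc i < n"
  define U where "U k r c = (of_bool (w ! T k c = r) :: int)" for k r c
  define L where "L r r' = (of_bool (r = Suc i \<and> r' = i) :: int)" for r r'
  have LU: "(\<Sum>x<n. L r x * U k x c) = of_bool (r = Suc i \<and> w ! T k c = i)" for k r c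
  proof -
    have "(\<Sum>x<n. L r x * U k x c) = (\<Sum>x<n. if x = i then of_bool (r = Suc i \<and> w ! T k c = i) else 0)"
      by (intro sum.cong) (auto simp: L_def U_def)
    then show ?thesis using i by simp
  qed
  have "raise i (bracket_prod n s T) w =
      (\<Sum>k<s. \<Sum>j<n. if w ! T k j = i then bracket_prod n s T (w[T k j := Suc i]) else 0)"
    unfolding raise_def using w tableau_sum[OF T] by (simp add: words_def)
  also have "\<dots> = (\<Sum>k<s. \<Sum>j<n. det (mat n n (\<lambda>(a, b). if b = j then \<Sum>x<n. L a x * U k x j else U k a b))
      * (\<Prod>k' \<in> {..<s} - {k}. det (mat n n (\<lambda>(i, j). U k' i j))))"
  proof (intro sum.cong refl)
    fix k j assume kj: "k \<in> {..<s}" "j \<in> {..<n}"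
    let ?D = "det (mat n n (\<lambda>(a, b). if b = j then \<Sum>x<n. L a x * U k x j else U k a b))"
    show "(if w ! T k j = i then bracket_prod n s T (w[T k j := Suc i]) else 0) =
      ?D * (\<Prod>k' \<in> {..<s} - {k}. det (mat n n (\<lambda>(i, j). U k' i j)))"
    proof (cases "w ! T k j = i")
      case True
      have nth: "w[T k j := Suc i] ! T k' j' = (if k' = k \<and> j' = j then Suc i else w ! T k' j')"
        if "k' < s" "j' < n" for k' j'
        using tableau_eq_iff[OF T, of k j k' j'] tableau_less[OF T] kj that w
        by (auto simp: words_def nth_list_update)
      have "bracket_prod n s T (w[T k j := Suc i]) =
          det (mat n n (\<lambda>(a, b). of_bool (w[T k j := Suc i] ! T k b = a))) *
          (\<Prod>k' \<in> {..<s} - {k}. det (mat n n (\<lambda>(a, b). of_bool (w[T k j := Suc i] ! T k' b = a))))"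
        unfolding bracket_prod_def using kj by (subst prod.remove[of _ k]) auto
      also have "mat n n (\<lambda>(a, b). of_bool (w[T k j := Suc i] ! T k b = a) :: int) =
          mat n n (\<lambda>(a, b). if b = j then \<Sum>x<n. L a x * U k x j else U k a b)"
        unfolding LU using kj True by (intro eq_matI) (auto simp: nth U_def)
      also have "(\<Prod>k' \<in> {..<s} - {k}. det (mat n n (\<lambda>(a, b). of_bool (w[T k j := Suc i] ! T k' b = a) :: int))) =
          (\<Prod>k' \<in> {..<s} - {k}. det (mat n n (\<lambda>(i, j). U k' i j)))"
        by (intro prod.cong refl arg_cong[of _ _ det] eq_matI) (auto simp: nth U_def)
      finally show ?thesis using True by simp
    next
      case False
      have "?D = (\<Sum>r<n. (\<Sum>x<n. L r x * U k x j) * cofactor (mat n n (\<lambda>(i, j). U k i j)) r j)"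
        using kj by (intro det_replace_col_sum) auto
      also have "\<dots> = 0" using False by (simp add: LU)
      finally show ?thesis using False by simp
    qed
  qed
  also have "\<dots> = (\<Sum>k<s. 0)"
  proof (intro sum.cong refl)
    fix k
    have tr: "(\<Sum>x<n. L x x) = 0" by (auto simp: L_def intro!: sum.neutral)
    show "(\<Sum>j<n. det (mat n n (\<lambda>(a, b). if b = j then \<Sum>x<n. L a x * U k x j else U k a b))
      * (\<Prod>k' \<in> {..<s} - {k}. det (mat n n (\<lambda>(i, j). U k' i j)))) = 0"
      using sum_det_derivation[of n L "U k"] unfolding tr by (simp only: sum_distrib_right[symmetric] mult_zero_left)
  qed
  finally show "raise i (bracket_prod n s T) w = 0" by simp
next
  fix w i assume w: "w \<in> words n (n * s)" and nz: "bracket_prod n s T w \<noteq> 0" and i: "i < n"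
  have "count_list w i = (\<Sum>p<n * s. of_bool (w ! p = i))"
    using w Int_def[of "{..<n * s}" "{p. w ! p = i}"]
    by (simp add: count_list_eq_card words_def sum.If_cases of_bool_def)
  also have "\<dots> = (\<Sum>k<s. \<Sum>j<n. of_bool (w ! T k j = i))" by (rule tableau_sum[OF T])
  also have "\<dots> = (\<Sum>k<s. 1)"
  proof (intro sum.cong refl)
    fix k assume "k \<in> {..<s}"
    then obtain \<pi> where \<pi>: "\<pi> permutes {..<n}" "\<And>j. j < n \<Longrightarrow> w ! T k j = \<pi> j"
      using bracket_prod_nonzero_permutes[OF nz] by auto
    have "(\<Sum>j<n. of_bool (w ! T k j = i) :: nat) = (\<Sum>j<n. of_bool (\<pi> j = i))" using \<pi>(2) by simp
    also have "\<dots> = (\<Sum>j<n. of_bool (j = i))"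
      using sum.permute[OF \<pi>(1), of "\<lambda>j. of_bool (j = i)"] unfolding comp_def by (rule sym)
    finally show "(\<Sum>j<n. of_bool (w ! T k j = i) :: nat) = 1" using i by (simp add: of_bool_def)
  qed
  finally show "count_list w i = s" by simp
qed

lemma raise_suffix_leading:
  assumes f: "\<And>v i. v \<in> words n N \<Longrightarrow> Suc i < n \<Longrightarrow> raise i f v = 0"
    and lead: "\<And>v. v \<in> words n N \<Longrightarrow> f v \<noteq> 0 \<Longrightarrow> v \<le> w"
    and w: "w \<in> words n N" "w = x @ y"
    and v: "v \<in> words n (length y)" and i: "Suc i < n"
  shows "raise i (\<lambda>v. f (x @ v)) v = 0"
  using w v
proof (induction x arbitrary: y v rule: rev_induct)
  case Nil
  then show ?case using f i by (simp add: words_def)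
next
  case (snoc k x)
  have kv: "k # v \<in> words n (length (k # y))"
    using snoc.prems by (auto simp: words_def)
  have "raise i (\<lambda>v. f (x @ v)) (k # v) = 0"
    by (rule snoc.IH[OF snoc.prems(1) _ kv]) (use snoc.prems in simp)
  moreover have "f (x @ Suc i # v) = 0" if "k = i"
  proof (rule ccontr)
    assume nz: "f (x @ Suc i # v) \<noteq> 0"
    have "x @ Suc i # v \<in> words n N" using snoc.prems i by (auto simp: words_def)
    then have "x @ Suc i # v \<le> w" using lead nz by blast
    moreover have "w < x @ Suc i # v"
      unfolding snoc.prems(2) \<open>k = i\<close>
      by (induction x) auto
    ultimately show False by simp
  qed
  ultimately show ?case by (cases "k = i") (simp_all add: raise_Cons)
qed

text \<open>With the prefix x frozen, \<open>f\<close> is annihilated by \<open>raise i\<close> and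
  its letter counts are those of y. If y had more letters \<open>Suc i\<close> than
  \<open>i\<close>, \<open>raise_funpow_inj\<close> with exponent 1 would force
  \<open>f w = 0\<close>.\<close>

lemma leading_word_ballot:
  assumes f: "highest_weight n s f"
    and lead: "\<And>v. v \<in> words n (n * s) \<Longrightarrow> f v \<noteq> 0 \<Longrightarrow> v \<le> w"
    and w: "w \<in> words n (n * s)" "w = x @ y" and nz: "f w \<noteq> 0" and i: "Suc i < n"
  shows "count_list y (Suc i) \<le> count_list y i"
proof (rule ccontr)
  assume "\<not> ?thesis"
  then have less: "count_list y i + 1 \<le> count_list y (Suc i)" by simp
  have cnt: "count_list v j = s" if "v \<in> words n (n * s)" "f v \<noteq> 0" "j < n" for v j
    using f that by (auto simp: highest_weight_def)
  have y: "y \<in> words n (length y)" using w by (auto simp: words_def)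
  have "f (x @ y) = 0"
  proof (rule raise_funpow_inj[OF less i, of "length y" "\<lambda>v. f (x @ v)"])
    show "(raise i ^^ 1) (\<lambda>v. f (x @ v)) v = 0" if "v \<in> words n (length y)" for v
      using raise_suffix_leading[OF _ lead w that i] f by (auto simp: highest_weight_def)
    show "count_list v i = count_list y i \<and> count_list v (Suc i) = count_list y (Suc i)"
      if "v \<in> words n (length y)" "f (x @ v) \<noteq> 0" for v
    proof -
      have "x @ v \<in> words n (n * s)" using that(1) w by (auto simp: words_def)
      then have "count_list (x @ v) j = count_list (x @ y) j" if "j < n" for j
        using cnt[of "x @ v" j] cnt[OF w(1) nz that] \<open>f (x @ v) \<noteq> 0\<close> w(2) that by metis
      from this[of i] this[of "Suc i"] show ?thesis using i by simp
    qed
  qed (rule y)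
  then show False using nz w(2) by simp
qed

text \<open>Column k of the tableau collects the k-th occurrence, from the left, of each letter. The
  ballot condition on suffixes says exactly that within a column larger letters stand further to the
  left.\<close>

lemma ballot_tableau:
  assumes w: "w \<in> words n (n * s)" and cnt: "\<And>i. i < n \<Longrightarrow> count_list w i = s"
    and ballot: "\<And>x y i. w = x @ y \<Longrightarrow> Suc i < n \<Longrightarrow> count_list y (Suc i) \<le> count_list y i"
  obtains T where "tableau n s T" "\<And>k i. k < s \<Longrightarrow> i < n \<Longrightarrow> w ! T k i = i"
    "\<And>k i j. k < s \<Longrightarrow> i < j \<Longrightarrow> j < n \<Longrightarrow> T k j < T k i"
proof -
  define P where "P i = {p. p < n * s \<and> w ! p = i}" for i
  define xs where "xs i = sorted_list_of_set (P i)" for i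
  define T where "T k i = xs i ! k" for k i
  have len: "length w = n * s" using w by (simp add: words_def)
  have fin: "finite (P i)" for i by (simp add: P_def)
  have lxs: "length (xs i) = s" if "i < n" for i
    using cnt[OF that] fin[of i] by (simp add: xs_def count_list_eq_card P_def len)
  have setxs: "set (xs i) = P i" and dist: "distinct (xs i)" and sorted: "sorted_wrt (<) (xs i)" for i
    using fin[of i] by (simp_all add: xs_def)
  have TP: "T k i \<in> P i" if "k < s" "i < n" for k i
    using setxs[of i] lxs[OF that(2)] that(1) nth_mem unfolding T_def by metis
  have mono: "T k i < T k' i" if "k < k'" "k' < s" "i < n" for k k' i
    using sorted_wrt_nth_less[OF sorted, of k k' i] that lxs by (simp add: T_def)
  have PT: "\<exists>k<s. p = T k i" if "p \<in> P i" "i < n" for p i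
    using that setxs[of i] lxs[of i] unfolding T_def by (metis in_set_conv_nth)
  have "tableau n s T" unfolding tableau_def bij_betw_def
  proof
    show "inj_on (\<lambda>(k, j). T k j) ({..<s} \<times> {..<n})"
    proof (rule inj_onI, clarsimp)
      fix k j k' j' assume a: "T k j = T k' j'" "k < s" "j < n" "k' < s" "j' < n"
      then have j: "j = j'" using TP[of k j] TP[of k' j'] by (simp add: P_def)
      then show "k = k' \<and> j = j'"
        using mono[of k k' j] mono[of k' k j] a by (metis nat_neq_iff)
    qed
    show "(\<lambda>(k, j). T k j) ` ({..<s} \<times> {..<n}) = {..<n * s}"
    proof
      show "(\<lambda>(k, j). T k j) ` ({..<s} \<times> {..<n}) \<subseteq> {..<n * s}" using TP by (auto simp: P_def)
      show "{..<n * s} \<subseteq> (\<lambda>(k, j). T k j) ` ({..<s} \<times> {..<n})"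
      proof
        fix p assume p: "p \<in> {..<n * s}"
        then have "w ! p \<in> set w" using len by simp
        then have "w ! p < n" using w by (auto simp: words_def)
        moreover have "p \<in> P (w ! p)" using p by (simp add: P_def)
        ultimately obtain k where "k < s" "p = T k (w ! p)" using PT by blast
        then show "p \<in> (\<lambda>(k, j). T k j) ` ({..<s} \<times> {..<n})"
          using \<open>w ! p < n\<close> by force
      qed
    qed
  qed
  moreover have wT: "w ! T k i = i" if "k < s" "i < n" for k i
    using TP[OF that] by (simp add: P_def)
  moreover have step: "T k (Suc i) < T k i" if k: "k < s" and i: "Suc i < n" for k i
  proof (rule ccontr)
    assume "\<not> ?thesis"
    moreover have "T k (Suc i) \<noteq> T k i" using wT[OF k i] wT[OF k Suc_lessD[OF i]] by auto
    ultimately have gt: "T k i < T k (Suc i)" by simp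
    \<comment> \<open>The suffix starts just after the k-th letter \<open>i\<close> (counting from
      0), so it has at most s - k - 1 letters \<open>i\<close>. If the k-th \<open>Suc i\<close>
      came later, it would contain at least s - k letters \<open>Suc i\<close>, against the ballot
      condition.\<close>
    define m where "m = Suc (T k i)"
    have cd: "count_list (drop m w) j = card {p \<in> P j. m \<le> p}" for j
    proof -
      have "count_list (drop m w) j = card {p. p < length w - m \<and> w ! (m + p) = j}"
        unfolding count_list_eq_card by (intro arg_cong[of _ _ card]) auto
      also have "\<dots> = card ((\<lambda>p. m + p) ` {p. p < length w - m \<and> w ! (m + p) = j})"
        by (rule card_image[symmetric]) simp
      also have "(\<lambda>p. m + p) ` {p. p < length w - m \<and> w ! (m + p) = j} = {p \<in> P j. m \<le> p}"
      proof
        show "{p \<in> P j. m \<le> p} \<subseteq> (\<lambda>p. m + p) ` {p. p < length w - m \<and> w ! (m + p) = j}"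
        proof
          fix p assume p: "p \<in> {p \<in> P j. m \<le> p}"
          then show "p \<in> (\<lambda>p. m + p) ` {p. p < length w - m \<and> w ! (m + p) = j}"
            by (intro image_eqI[of _ _ "p - m"]) (auto simp: P_def len)
        qed
      qed (auto simp: P_def len)
      finally show ?thesis .
    qed
    have injT: "inj_on (\<lambda>k. T k j) {..<s}" if "j < n" for j
      using mono that by (intro inj_onI) (metis lessThan_iff nat_neq_iff)
    have "{p \<in> P i. m \<le> p} \<subseteq> (\<lambda>k. T k i) ` {Suc k..<s}"
    proof
      fix p assume "p \<in> {p \<in> P i. m \<le> p}"
      then obtain k' where k': "k' < s" "p = T k' i" "T k i < T k' i"
        using PT[of p i] i by (auto simp: m_def)
      then have "k < k'" using mono[of k' k i] k i by (metis Suc_lessD less_asym' nat_neq_iff)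
      then show "p \<in> (\<lambda>k. T k i) ` {Suc k..<s}" using k' by auto
    qed
    then have "card {p \<in> P i. m \<le> p} \<le> card ((\<lambda>k. T k i) ` {Suc k..<s})"
      by (intro card_mono) auto
    also have "\<dots> \<le> s - Suc k" using card_image_le[of "{Suc k..<s}"] by simp
    finally have le: "count_list (drop m w) i \<le> s - Suc k" unfolding cd .
    have "(\<lambda>k. T k (Suc i)) ` {k..<s} \<subseteq> {p \<in> P (Suc i). m \<le> p}"
    proof
      fix p assume "p \<in> (\<lambda>k. T k (Suc i)) ` {k..<s}"
      then obtain k' where k': "k \<le> k'" "k' < s" "p = T k' (Suc i)" by auto
      then have "T k (Suc i) \<le> p" using mono[of k k' "Suc i"] i by (cases "k = k'") auto
      then show "p \<in> {p \<in> P (Suc i). m \<le> p}" using gt k' TP i by (auto simp: m_def)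
    qed
    then have "card ((\<lambda>k. T k (Suc i)) ` {k..<s}) \<le> count_list (drop m w) (Suc i)"
      unfolding cd using fin by (intro card_mono) auto
    moreover have "card ((\<lambda>k. T k (Suc i)) ` {k..<s}) = s - k"
      by (subst card_image, rule inj_on_subset[OF injT[OF i]]) auto
    moreover have "count_list (drop m w) (Suc i) \<le> count_list (drop m w) i"
      by (rule ballot[of "take m w"]) (use i in auto)
    ultimately show False using le k by linarith
  qed
  moreover have "T k j < T k i" if "k < s" "i < j" "j < n" for k i j
    using that(2,3)
  proof (induction j rule: less_Suc_induct)
    case (1 j) then show ?case using step that(1) by simp
  qed simp_all
  ultimately show ?thesis using that by blast
qed

text \<open>At the first position where v differs from w, say in row j of some column, v reads the
  letter \<pi> j for a permutation \<pi> of that column. If \<pi> j > j, the box in row \<pi> j lies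
  further left, where v still agrees with w; so \<pi> fixes \<pi> j, against injectivity. Hence v is
  smaller there.\<close>

lemma bracket_prod_leading:
  assumes T: "tableau n s T" and w: "w \<in> words n (n * s)"
    and wT: "\<And>k i. k < s \<Longrightarrow> i < n \<Longrightarrow> w ! T k i = i"
    and dec: "\<And>k i j. k < s \<Longrightarrow> i < j \<Longrightarrow> j < n \<Longrightarrow> T k j < T k i"
  shows "bracket_prod n s T w = 1"
    and "v \<in> words n (n * s) \<Longrightarrow> bracket_prod n s T v \<noteq> 0 \<Longrightarrow> v \<le> w"
proof -
  have "mat n n (\<lambda>(i, j). of_bool (w ! T k j = i)) = (1\<^sub>m n :: int mat)" if "k < s" for k
    using wT[OF that] by (intro eq_matI) auto
  then show "bracket_prod n s T w = 1" by (simp add: bracket_prod_def)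
  assume v: "v \<in> words n (n * s)" and nz: "bracket_prod n s T v \<noteq> 0"
  show "v \<le> w"
  proof (cases "v = w")
    case False
    have len: "length v = length w" using v w by (simp add: words_def)
    then have ex: "\<exists>p. p < length w \<and> v ! p \<noteq> w ! p" using False by (metis nth_equalityI)
    define p where "p = (LEAST p. p < length w \<and> v ! p \<noteq> w ! p)"
    have p: "p < length w" "v ! p \<noteq> w ! p" using LeastI_ex[OF ex] by (auto simp: p_def)
    have before: "v ! p' = w ! p'" if "p' < p" for p'
      using not_less_Least[of p' "\<lambda>p. p < length w \<and> v ! p \<noteq> w ! p"] that p(1) by (auto simp: p_def)
    have "p \<in> (\<lambda>(k, j). T k j) ` ({..<s} \<times> {..<n})"
      using T p(1) w by (auto simp: tableau_def bij_betw_def words_def)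
    then obtain k j where kj: "k < s" "j < n" "p = T k j" by auto
    obtain \<pi> where \<pi>: "\<pi> permutes {..<n}" "\<And>j. j < n \<Longrightarrow> v ! T k j = \<pi> j"
      using bracket_prod_nonzero_permutes[OF nz kj(1)] by auto
    have "\<pi> j \<le> j"
    proof (rule ccontr)
      assume "\<not> \<pi> j \<le> j"
      then have gt: "j < \<pi> j" by simp
      moreover have "\<pi> j < n" using permutes_in_image[OF \<pi>(1), of j] kj(2) by simp
      ultimately have "\<pi> (\<pi> j) = \<pi> j"
        using \<pi>(2)[of "\<pi> j"] before[of "T k (\<pi> j)"] dec[of k j "\<pi> j"] wT[of k "\<pi> j"] kj by simp
      then have "\<pi> j = j" using permutes_inj[OF \<pi>(1)] by (simp add: inj_eq)
      then show False using gt by simp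
    qed
    moreover have "v ! p = \<pi> j" "w ! p = j" using \<pi>(2) wT kj by auto
    ultimately have "v ! p < w ! p" using p(2) by simp
    moreover have "take p v = take p w"
      using before p(1) len by (intro nth_equalityI) auto
    ultimately have "v < w"
      unfolding list_less_def lexord_take_index_conv using p(1) len by auto
    then show ?thesis by simp
  qed simp
qed

text \<open>Peeling off leading terms: the leading word of a highest weight function is a ballot word, hence
  also the leading word of a product of brackets with coefficient 1. In this way no division is
  needed, and the coefficients stay in the subgroup generated by the values.\<close>

lemma highest_weight_bracket_expansion:
  fixes c :: "nat list \<Rightarrow> 'u \<Rightarrow> int"
  assumes hw: "\<And>u. highest_weight n s (\<lambda>w. c w u)"
    and mem: "\<And>w. w \<in> words n (n * s) \<Longrightarrow> c w \<in> W"
    and W: "\<And>f g a. f \<in> W \<Longrightarrow> g \<in> W \<Longrightarrow> (\<lambda>u. f u - a * g u) \<in> W"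
  obtains ps where "\<And>T g. (T, g) \<in> set ps \<Longrightarrow> tableau n s T \<and> g \<in> W"
    "\<And>w u. w \<in> words n (n * s) \<Longrightarrow> c w u = (\<Sum>(T, g)\<leftarrow>ps. bracket_prod n s T w * g u)"
proof -
  let ?N = "n * s"
  \<comment> \<open>The induction measure counts all words up to the leading word, not only the
    support: subtracting a bracket product may create new nonzero values, but only at smaller
    words.\<close>
  define below where "below c = {v \<in> words n ?N. \<exists>w \<in> words n ?N. (\<exists>u. c w u \<noteq> 0) \<and> v \<le> w}"
    for c :: "nat list \<Rightarrow> 'u \<Rightarrow> int"
  have "\<exists>ps. (\<forall>(T, g) \<in> set ps. tableau n s T \<and> g \<in> W) \<and>
    (\<forall>w \<in> words n ?N. \<forall>u. c w u = (\<Sum>(T, g)\<leftarrow>ps. bracket_prod n s T w * g u))"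
    using hw mem
  proof (induction "card (below c)" arbitrary: c rule: less_induct)
    case less
    define S where "S = {w \<in> words n ?N. \<exists>u. c w u \<noteq> 0}"
    have finS: "finite S" unfolding S_def using finite_words by auto
    show ?case
    proof (cases "S = {}")
      case True
      then show ?thesis by (intro exI[of _ "[]"]) (auto simp: S_def)
    next
      case False
      \<comment> \<open>The leading word is taken over all parameters u at once, so that a single
        tableau and the single coefficient function \<open>c w\<close> remove it simultaneously for
        every u.\<close>
      define w where "w = Max S"
      have wS: "w \<in> S" unfolding w_def using finS False by (rule Max_in)
      then obtain u where w: "w \<in> words n ?N" and u: "c w u \<noteq> 0" by (auto simp: S_def)
      have lead: "v \<le> w" if "v \<in> words n ?N" "c v u' \<noteq> 0" for v u'
        unfolding w_def using finS that by (intro Max_ge) (auto simp: S_def)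
      have cnt: "count_list w i = s" if "i < n" for i
        using less.prems(1)[of u] w u that by (auto simp: highest_weight_def)
      have ballot: "count_list y (Suc i) \<le> count_list y i" if "w = x @ y" "Suc i < n" for x y i
        by (rule leading_word_ballot[OF less.prems(1)[of u] _ w that(1) u that(2)]) (use lead in auto)
      have "\<exists>T. tableau n s T \<and> (\<forall>k<s. \<forall>i<n. w ! T k i = i) \<and>
          (\<forall>k<s. \<forall>j<n. \<forall>i<j. T k j < T k i)"
        by (rule ballot_tableau[of w n s, OF w cnt ballot]; blast)
      then obtain T where T: "tableau n s T" "\<And>k i. k < s \<Longrightarrow> i < n \<Longrightarrow> w ! T k i = i"
        "\<And>k i j. k < s \<Longrightarrow> i < j \<Longrightarrow> j < n \<Longrightarrow> T k j < T k i"
        by metis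
      note B = bracket_prod_leading[OF T(1) w T(2,3)]
      define c' where "c' v u = c v u - c w u * bracket_prod n s T v" for v u
      have hw': "highest_weight n s (\<lambda>w. c' w u)" for u
        unfolding c'_def
        by (rule highest_weight_diff[OF less.prems(1) highest_weight_bracket_prod[OF T(1)]])
      have mem': "c' v \<in> W" if "v \<in> words n ?N" for v
      proof -
        have "c' v = (\<lambda>u. c v u - bracket_prod n s T v * c w u)"
          by (rule ext) (simp add: c'_def)
        then show ?thesis
          using W[OF less.prems(2)[OF that] less.prems(2)[OF w], of "bracket_prod n s T v"] by (simp only:)
      qed
      have lead': "v < w" if "v \<in> words n ?N" "c' v u' \<noteq> 0" for v u'
      proof -
        have "v \<le> w"
        proof (rule ccontr)
          assume "\<not> v \<le> w"
          then have "c v u' = 0" "bracket_prod n s T v = 0" using lead B(2) that(1) by auto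
          then show False using that(2) by (simp add: c'_def)
        qed
        moreover have "v \<noteq> w" using that(2) B(1) by (auto simp: c'_def)
        ultimately show ?thesis by simp
      qed
      have "w \<notin> below c'" unfolding below_def using lead' leD by blast
      moreover have "w \<in> below c" using w u by (auto simp: below_def)
      moreover have "below c' \<subseteq> below c"
      proof
        fix v assume "v \<in> below c'"
        then obtain w' where "v \<in> words n ?N" "w' \<le> w" "v \<le> w'"
          unfolding below_def using lead' less_imp_le by blast
        then show "v \<in> below c" unfolding below_def using w u order.trans by blast
      qed
      ultimately have "below c' \<subset> below c" by blast
      moreover have "finite (below c)" unfolding below_def using finite_words by auto
      ultimately have "card (below c') < card (below c)" by (rule psubset_card_mono[rotated])
      from less.hyps[OF this hw' mem'] obtain ps where
        ps: "\<forall>(T, g) \<in> set ps. tableau n s T \<and> g \<in> W"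
          "\<forall>w \<in> words n ?N. \<forall>u. c' w u = (\<Sum>(T, g)\<leftarrow>ps. bracket_prod n s T w * g u)"
        by blast
      show ?thesis
      proof (intro exI[of _ "(T, c w) # ps"] conjI ballI allI)
        show "case x of (T, g) \<Rightarrow> tableau n s T \<and> g \<in> W" if "x \<in> set ((T, c w) # ps)" for x
          using that ps(1) T(1) less.prems(2)[OF w] by auto
        show "c v u = (\<Sum>(T, g)\<leftarrow>(T, c w) # ps. bracket_prod n s T v * g u)" if "v \<in> words n ?N" for v u
          using ps(2)[rule_format, OF that, of u] by (simp add: c'_def algebra_simps)
      qed
    qed
  qed
  then show ?thesis using that by blast
qed

section \<open>Ideals\<close>

lemma module_mult: "Modules.module ((*) :: 'a::comm_ring_1 \<Rightarrow> 'a \<Rightarrow> 'a)"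
  by standard (simp_all add: algebra_simps)

definition is_ideal :: "'a::comm_ring_1 set \<Rightarrow> bool" where
  "is_ideal K \<longleftrightarrow> 0 \<in> K \<and> (\<forall>x\<in>K. \<forall>y\<in>K. x + y \<in> K) \<and> (\<forall>r. \<forall>x\<in>K. r * x \<in> K)"

lemma is_ideal_subspace: "is_ideal K \<longleftrightarrow> Modules.module.subspace (*) K"
  by (simp add: is_ideal_def Modules.module.subspace_def[OF module_mult])

lemma is_ideal_ideal_gen: "is_ideal (ideal_gen S)"
  by (simp add: is_ideal_subspace ideal_gen_def Modules.module.subspace_span[OF module_mult])

lemma ideal_gen_superset: "x \<in> S \<Longrightarrow> x \<in> ideal_gen S"
  by (simp add: ideal_gen_def Modules.module.span_base[OF module_mult])

lemma ideal_gen_minimal: "S \<subseteq> K \<Longrightarrow> is_ideal K \<Longrightarrow> ideal_gen S \<subseteq> K"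
  by (simp add: ideal_gen_def is_ideal_subspace Modules.module.span_minimal[OF module_mult])

lemma is_ideal_0: "is_ideal K \<Longrightarrow> 0 \<in> K"
  and is_ideal_add: "is_ideal K \<Longrightarrow> x \<in> K \<Longrightarrow> y \<in> K \<Longrightarrow> x + y \<in> K"
  and is_ideal_mult_left: "is_ideal K \<Longrightarrow> x \<in> K \<Longrightarrow> r * x \<in> K"
  by (auto simp: is_ideal_def)

lemma is_ideal_mult_right: "is_ideal K \<Longrightarrow> x \<in> K \<Longrightarrow> x * r \<in> K"
  using is_ideal_mult_left[of K x r] by (simp add: mult.commute)

lemma is_ideal_uminus: "is_ideal K \<Longrightarrow> x \<in> K \<Longrightarrow> - x \<in> K"
  using is_ideal_mult_left[of K x "-1"] by simp

lemma is_ideal_sum: "is_ideal K \<Longrightarrow> (\<And>x. x \<in> A \<Longrightarrow> f x \<in> K) \<Longrightarrow> sum f A \<in> K"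
  by (induction A rule: infinite_finite_induct) (auto simp: is_ideal_0 is_ideal_add)

lemma is_ideal_sum_list: "is_ideal K \<Longrightarrow> (\<And>x. x \<in> set xs \<Longrightarrow> f x \<in> K) \<Longrightarrow> (\<Sum>x\<leftarrow>xs. f x) \<in> K"
  by (induction xs) (auto simp: is_ideal_0 is_ideal_add)

lemma is_ideal_UNIV: "is_ideal UNIV"
  by (simp add: is_ideal_def)

text \<open>The colon ideal of K by a. Membership of a product in K becomes membership of one factor
  in a colon ideal, which allows the other factors to be fixed while one factor is reduced to
  generators.\<close>

lemma is_ideal_colon:
  assumes K: "is_ideal K"
  shows "is_ideal {x. x * a \<in> K}"
  unfolding is_ideal_def
proof (intro conjI ballI allI CollectI)
  show "0 * a \<in> K" using is_ideal_0[OF K] by simp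
  show "(x + y) * a \<in> K" if "x \<in> {x. x * a \<in> K}" "y \<in> {x. x * a \<in> K}" for x y
    unfolding distrib_right using that by (intro is_ideal_add[OF K]) simp_all
  show "r * x * a \<in> K" if "x \<in> {x. x * a \<in> K}" for r x
    using is_ideal_mult_left[OF K, of "x * a" r] that by (simp add: mult.assoc)
qed

lemma is_ideal_Collect_ball: "(\<And>a. a \<in> A \<Longrightarrow> is_ideal {x. P a x}) \<Longrightarrow> is_ideal {x. \<forall>a\<in>A. P a x}"
  by (simp add: is_ideal_def)

lemma is_ideal_eq_UNIV: "is_ideal K \<Longrightarrow> 1 \<in> K \<Longrightarrow> K = UNIV"
  using is_ideal_mult_left[of K 1] by auto

lemma is_ideal_ideal_mult: "is_ideal (ideal_mult I J)"
  by (simp add: ideal_mult_def is_ideal_ideal_gen)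

lemma ideal_multI: "x \<in> I \<Longrightarrow> y \<in> J \<Longrightarrow> x * y \<in> ideal_mult I J"
  unfolding ideal_mult_def by (rule ideal_gen_superset) blast

lemma ideal_mult_minimal:
  "is_ideal K \<Longrightarrow> (\<And>x y. x \<in> I \<Longrightarrow> y \<in> J \<Longrightarrow> x * y \<in> K) \<Longrightarrow> ideal_mult I J \<subseteq> K"
  unfolding ideal_mult_def by (rule ideal_gen_minimal) auto

lemma ideal_mult_mono: "I \<subseteq> I' \<Longrightarrow> J \<subseteq> J' \<Longrightarrow> ideal_mult I J \<subseteq> ideal_mult I' J'"
  by (intro ideal_mult_minimal is_ideal_ideal_mult) (auto intro: ideal_multI)

lemma ideal_mult_assoc: "ideal_mult (ideal_mult I J) K = ideal_mult I (ideal_mult J K)"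
proof
  have "ideal_mult I J \<subseteq> {x. \<forall>k\<in>K. x * k \<in> ideal_mult I (ideal_mult J K)}"
    by (intro ideal_mult_minimal is_ideal_Collect_ball is_ideal_colon is_ideal_ideal_mult)
       (auto simp: mult.assoc intro!: ideal_multI)
  then show "ideal_mult (ideal_mult I J) K \<subseteq> ideal_mult I (ideal_mult J K)"
    by (intro ideal_mult_minimal is_ideal_ideal_mult) auto
  have "ideal_mult J K \<subseteq> {x. \<forall>i\<in>I. x * i \<in> ideal_mult (ideal_mult I J) K}"
  proof (intro ideal_mult_minimal is_ideal_Collect_ball is_ideal_colon is_ideal_ideal_mult)
    fix x y assume "x \<in> J" "y \<in> K"
    then have "(i * x) * y \<in> ideal_mult (ideal_mult I J) K" if "i \<in> I" for i
      using that by (intro ideal_multI)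
    then show "x * y \<in> {x. \<forall>i\<in>I. x * i \<in> ideal_mult (ideal_mult I J) K}"
      by (simp add: ac_simps)
  qed
  then have "x * y \<in> ideal_mult (ideal_mult I J) K" if "x \<in> I" "y \<in> ideal_mult J K" for x y
    using that by (auto simp: mult.commute[of x])
  then show "ideal_mult I (ideal_mult J K) \<subseteq> ideal_mult (ideal_mult I J) K"
    by (intro ideal_mult_minimal is_ideal_ideal_mult)
qed

lemma ideal_mult_commute: "ideal_mult I J = ideal_mult J I"
proof -
  have "ideal_mult I J \<subseteq> ideal_mult J I" for I J :: "'a set"
    by (intro ideal_mult_minimal is_ideal_ideal_mult) (metis ideal_multI mult.commute)
  then show ?thesis by blast
qed

lemma ideal_mult_ideal_gen_minimal:
  assumes K: "is_ideal K" and "\<And>x y. x \<in> S \<Longrightarrow> y \<in> T \<Longrightarrow> x * y \<in> K"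
  shows "ideal_mult (ideal_gen S) (ideal_gen T) \<subseteq> K"
proof -
  have "ideal_gen S \<subseteq> {x. \<forall>y\<in>T. x * y \<in> K}"
    using assms by (intro ideal_gen_minimal is_ideal_Collect_ball is_ideal_colon) auto
  then have "y * x \<in> K" if "x \<in> ideal_gen S" "y \<in> T" for x y
    using that by (auto simp: mult.commute[of y])
  then have "ideal_gen T \<subseteq> {y. \<forall>x\<in>ideal_gen S. y * x \<in> K}"
    using K by (intro ideal_gen_minimal is_ideal_Collect_ball is_ideal_colon) auto
  then have "x * y \<in> K" if "x \<in> ideal_gen S" "y \<in> ideal_gen T" for x y
    using that by (auto simp: mult.commute[of x])
  then show ?thesis using K by (intro ideal_mult_minimal)
qed

lemma is_ideal_ideal_power: "is_ideal (ideal_power I k)"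
  by (cases k) (simp_all add: is_ideal_UNIV is_ideal_ideal_mult)

lemma ideal_power_mono: "I \<subseteq> J \<Longrightarrow> ideal_power I k \<subseteq> ideal_power J k"
  by (induction k) (auto intro: subsetD[OF ideal_mult_mono])

lemma prod_in_ideal_power: "(\<And>k. k < s \<Longrightarrow> f k \<in> I) \<Longrightarrow> (\<Prod>k<s. f k) \<in> ideal_power I s"
  by (induction s) (auto simp: mult.commute[of _ "f _"] intro: ideal_multI)

text \<open>The induction is over all target ideals K, since peeling off one generator replaces K by
  a colon ideal.\<close>

lemma ideal_power_ideal_gen_minimal:
  assumes "is_ideal K" and "\<And>f. (\<And>k. k < s \<Longrightarrow> f k \<in> S) \<Longrightarrow> (\<Prod>k<s. f k) \<in> K"
  shows "ideal_power (ideal_gen S) s \<subseteq> K"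
  using assms
proof (induction s arbitrary: K)
  case 0
  then show ?case using is_ideal_eq_UNIV by force
next
  case (Suc s)
  have "ideal_power (ideal_gen S) s \<subseteq> {x. \<forall>a\<in>S. x * a \<in> K}"
  proof (rule Suc.IH)
    show "is_ideal {x. \<forall>a\<in>S. x * a \<in> K}"
      using Suc.prems(1) by (intro is_ideal_Collect_ball is_ideal_colon)
    fix f assume f: "\<And>k. k < s \<Longrightarrow> f k \<in> S"
    have "(\<Prod>k<Suc s. (f(s := a)) k) \<in> K" if "a \<in> S" for a
      using f that by (intro Suc.prems(2)) (auto simp: less_Suc_eq)
    then show "(\<Prod>k<s. f k) \<in> {x. \<forall>a\<in>S. x * a \<in> K}" by simp
  qed
  then have "a * x \<in> K" if "x \<in> ideal_power (ideal_gen S) s" "a \<in> S" for x a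
    using that by (auto simp: mult.commute[of a])
  then have "ideal_gen S \<subseteq> {a. \<forall>x\<in>ideal_power (ideal_gen S) s. a * x \<in> K}"
    using Suc.prems(1) by (intro ideal_gen_minimal is_ideal_Collect_ball is_ideal_colon) auto
  then show ?case using Suc.prems(1) by (auto intro: subsetD[OF ideal_mult_minimal])
qed

lemma ideal_power_add: "is_ideal I \<Longrightarrow> ideal_mult (ideal_power I a) (ideal_power I b) = ideal_power I (a + b)"
proof (induction a)
  case 0
  have "ideal_mult UNIV (ideal_power I b) \<subseteq> ideal_power I b"
    by (intro ideal_mult_minimal is_ideal_ideal_power is_ideal_mult_left)
  moreover have "x \<in> ideal_mult UNIV (ideal_power I b)" if "x \<in> ideal_power I b" for x
    using ideal_multI[of 1 UNIV x] that by simp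
  ultimately show ?case by auto
qed (simp add: ideal_mult_assoc)

section \<open>Multilinear expansion of minors\<close>

lemma det_sum_cols:
  fixes x :: "nat \<Rightarrow> 'b \<Rightarrow> 'a::comm_ring_1"
  assumes "\<And>c. c < N \<Longrightarrow> finite (A c)"
  shows "det (mat N N (\<lambda>(r, c). \<Sum>w\<in>A c. x c w * y c w r)) =
    (\<Sum>W\<in>Pi\<^sub>E {..<N} A. (\<Prod>c<N. x c (W c)) * det (mat N N (\<lambda>(r, c). y c (W c) r)))"
proof -
  let ?P = "{p. p permutes {0..<N}}"
  have lt: "p c < N" if "p permutes {0..<N}" "c < N" for p c
    using permutes_in_image[OF that(1), of c] that(2) by simp
  have "det (mat N N (\<lambda>(r, c). \<Sum>w\<in>A c. x c w * y c w r)) =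
      (\<Sum>p\<in>?P. signof p * (\<Prod>c<N. \<Sum>w\<in>A c. x c w * y c w (p c)))"
    by (subst det_col[of _ N]) (auto intro!: sum.cong prod.cong simp: lt)
  also have "\<dots> = (\<Sum>p\<in>?P. \<Sum>W\<in>Pi\<^sub>E {..<N} A. (\<Prod>c<N. x c (W c)) * (signof p * (\<Prod>c<N. y c (W c) (p c))))"
  proof (intro sum.cong refl)
    fix p
    have "(\<Prod>c<N. \<Sum>w\<in>A c. x c w * y c w (p c)) =
        (\<Sum>W\<in>Pi\<^sub>E {..<N} A. (\<Prod>c<N. x c (W c)) * (\<Prod>c<N. y c (W c) (p c)))"
      using assms by (subst prod_sum_PiE) (simp_all add: prod.distrib)
    then show "signof p * (\<Prod>c<N. \<Sum>w\<in>A c. x c w * y c w (p c)) =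
        (\<Sum>W\<in>Pi\<^sub>E {..<N} A. (\<Prod>c<N. x c (W c)) * (signof p * (\<Prod>c<N. y c (W c) (p c))))"
      by (simp only: sum_distrib_left) (intro sum.cong refl mult.left_commute)
  qed
  also have "\<dots> = (\<Sum>W\<in>Pi\<^sub>E {..<N} A. (\<Prod>c<N. x c (W c)) * (\<Sum>p\<in>?P. signof p * (\<Prod>c<N. y c (W c) (p c))))"
    by (subst sum.swap) (simp add: sum_distrib_left)
  also have "\<dots> = (\<Sum>W\<in>Pi\<^sub>E {..<N} A. (\<Prod>c<N. x c (W c)) * det (mat N N (\<lambda>(r, c). y c (W c) r)))"
    by (subst det_col[of _ N]) (auto intro!: sum.cong prod.cong simp: lt)
  finally show ?thesis .
qed

lemma of_int_det: "of_int (det (mat N N (\<lambda>(i, j). A i j))) =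
    (det (mat N N (\<lambda>(i, j). of_int (A i j))) :: 'a::comm_ring_1)"
proof -
  have lt: "p c < N" if "p permutes {0..<N}" "c < N" for p c
    using permutes_in_image[OF that(1), of c] that(2) by simp
  show ?thesis
    by (subst (1 2) det_col[of _ N]) (auto simp: lt intro!: sum.cong prod.cong)
qed

section \<open>Minors as multilinear functions of one long word\<close>

definition chunk :: "nat \<Rightarrow> nat list \<Rightarrow> nat \<Rightarrow> nat list" where
  "chunk d w c = map (\<lambda>b. w ! (c * d + b)) [0..<d]"

text \<open>The coefficient of the word w in a minor: the letter at position
  \<open>c * d + b\<close> is the basis vector substituted for argument b of column c. The map \<mu>
  may vary with the column because for tensor products the letter of the second factor is absorbed
  into it.\<close>

definition chunk_det :: "nat \<Rightarrow> nat \<Rightarrow> (nat \<Rightarrow> nat list \<Rightarrow> nat \<Rightarrow> int) \<Rightarrow> nat list \<Rightarrow> int" where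
  "chunk_det N d \<mu> w = det (mat N N (\<lambda>(r, c). \<mu> c (chunk d w c) r))"

lemma length_chunk [simp]: "length (chunk d w c) = d"
  by (simp add: chunk_def)

lemma nth_chunk [simp]: "b < d \<Longrightarrow> chunk d w c ! b = w ! (c * d + b)"
  by (simp add: chunk_def)

lemma chunk_index_less:
  assumes "c < N" "b < d"
  shows "c * d + b < N * (d::nat)"
proof -
  have "c * d + b < Suc c * d" using assms by simp
  also have "\<dots> \<le> N * d" using assms by (intro mult_le_mono1) simp
  finally show ?thesis .
qed

lemma chunk_in_words:
  assumes "w \<in> words n (N * d)" "c < N"
  shows "chunk d w c \<in> words n d"
proof -
  have "w ! (c * d + b) \<in> set w" if "b < d" for b
    using assms chunk_index_less[OF assms(2) that] by (simp add: words_def)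
  then have "set (chunk d w c) \<subseteq> set w" by (auto simp: chunk_def)
  then show ?thesis using assms(1) by (auto simp: words_def)
qed

lemma sum_lessThan_mult: "(\<Sum>p<N * d. f p) = (\<Sum>c<N. \<Sum>b<d. f (c * d + b))" for N d :: nat
proof -
  have "(\<Sum>b<d. f (c * d + b)) = sum f {c * d..<c * d + d}" for c
    using sum.shift_bounds_nat_ivl[of f 0 "c * d" d] by (simp add: lessThan_atLeast0 add.commute)
  then show ?thesis by (simp add: sum.nat_group)
qed

lemma prod_lessThan_mult: "(\<Prod>p<N * d. f p) = (\<Prod>c<N. \<Prod>b<d. f (c * d + b))" for N d :: nat
proof -
  have "(\<Prod>b<d. f (c * d + b)) = prod f {c * d..<c * d + d}" for c
    using prod.shift_bounds_nat_ivl[of f 0 "c * d" d] by (simp add: lessThan_atLeast0 add.commute)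
  then show ?thesis by (simp add: prod.nat_group)
qed

lemma sum_PiE_words:
  "(\<Sum>W\<in>Pi\<^sub>E {..<N} (\<lambda>_. words n d). F W) =
    (\<Sum>w\<in>words n (N * d). F (restrict (chunk d w) {..<N}))"
proof (rule sum.reindex_bij_witness[of _ "\<lambda>w. restrict (chunk d w) {..<N}"
      "\<lambda>W. map (\<lambda>p. W (p div d) ! (p mod d)) [0..<N * d]"])
  fix W assume W: "W \<in> Pi\<^sub>E {..<N} (\<lambda>_. words n d)"
  show eq: "restrict (chunk d (map (\<lambda>p. W (p div d) ! (p mod d)) [0..<N * d])) {..<N} = W"
  proof (rule extensionalityI[of _ "{..<N}"])
    fix c assume c: "c \<in> {..<N}"
    then have "length (W c) = d" using W by (auto simp: words_def)
    then show "restrict (chunk d (map (\<lambda>p. W (p div d) ! (p mod d)) [0..<N * d])) {..<N} c = W c"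
      using c chunk_index_less[of c N _ d] by (intro nth_equalityI) auto
  qed (use W in \<open>simp_all add: PiE_iff\<close>)
  show "map (\<lambda>p. W (p div d) ! (p mod d)) [0..<N * d] \<in> words n (N * d)"
  proof -
    have "W (p div d) ! (p mod d) < n" if "p < N * d" for p
    proof -
      have "d > 0" using that by (cases d) auto
      moreover have "p div d < N" using that by (simp add: less_mult_imp_div_less)
      ultimately have "W (p div d) ! (p mod d) \<in> set (W (p div d))" "set (W (p div d)) \<subseteq> {..<n}"
        using W by (auto simp: words_def PiE_iff)
      then show ?thesis by blast
    qed
    then show ?thesis by (auto simp: words_def)
  qed
  show "F (restrict (chunk d (map (\<lambda>p. W (p div d) ! (p mod d)) [0..<N * d])) {..<N}) = F W"
    by (simp only: eq)
next
  fix w assume w: "w \<in> words n (N * d)"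
  show "map (\<lambda>p. restrict (chunk d w) {..<N} (p div d) ! (p mod d)) [0..<N * d] = w"
  proof (rule nth_equalityI)
    fix p assume "p < length (map (\<lambda>p. restrict (chunk d w) {..<N} (p div d) ! (p mod d)) [0..<N * d])"
    then have p: "p < N * d" by simp
    then have "d > 0" by (cases d) auto
    moreover have "p div d < N" using p by (simp add: less_mult_imp_div_less)
    ultimately show "map (\<lambda>p. restrict (chunk d w) {..<N} (p div d) ! (p mod d)) [0..<N * d] ! p = w ! p"
      using p by simp
  qed (use w in \<open>simp add: words_def\<close>)
  show "restrict (chunk d w) {..<N} \<in> Pi\<^sub>E {..<N} (\<lambda>_. words n d)"
    using chunk_in_words[OF w] by auto
qed

lemma det_chunk_expansion:
  fixes v :: "nat \<Rightarrow> nat \<Rightarrow> 'a::comm_ring_1"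
  shows "det (mat N N (\<lambda>(r, c). \<Sum>w\<in>words n d. (\<Prod>b<d. v (c * d + b) (w ! b)) * of_int (\<mu> c w r))) =
    (\<Sum>w\<in>words n (N * d). (\<Prod>p<N * d. v p (w ! p)) * of_int (chunk_det N d \<mu> w))"
proof -
  have "det (mat N N (\<lambda>(r, c). \<Sum>w\<in>words n d. (\<Prod>b<d. v (c * d + b) (w ! b)) * of_int (\<mu> c w r))) =
    (\<Sum>W\<in>Pi\<^sub>E {..<N} (\<lambda>_. words n d). (\<Prod>c<N. \<Prod>b<d. v (c * d + b) (W c ! b)) *
      det (mat N N (\<lambda>(r, c). of_int (\<mu> c (W c) r))))"
    by (rule det_sum_cols) (rule finite_words)
  also have "\<dots> = (\<Sum>w\<in>words n (N * d). (\<Prod>c<N. \<Prod>b<d. v (c * d + b) (restrict (chunk d w) {..<N} c ! b)) *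
      det (mat N N (\<lambda>(r, c). of_int (\<mu> c (restrict (chunk d w) {..<N} c) r))))"
    by (rule sum_PiE_words)
  also have "\<dots> = (\<Sum>w\<in>words n (N * d). (\<Prod>p<N * d. v p (w ! p)) * of_int (chunk_det N d \<mu> w))"
    unfolding chunk_det_def of_int_det prod_lessThan_mult
    by (intro sum.cong refl arg_cong2[of _ _ _ _ "(*)"] prod.cong arg_cong[of _ _ det] eq_matI) auto
  finally show ?thesis .
qed

lemma chunk_list_update:
  assumes "length w = N * d" "c < N" "b < d" "c' < N"
  shows "chunk d (w[c * d + b := x]) c' = (if c' = c then (chunk d w c)[b := x] else chunk d w c')"
proof -
  have "c * d + b = c' * d + b' \<longleftrightarrow> c = c' \<and> b = b'" if "b' < d" for b'
  proof
    assume eq: "c * d + b = c' * d + b'"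
    from arg_cong[OF eq, of "\<lambda>p. p div d"] arg_cong[OF eq, of "\<lambda>p. p mod d"]
    show "c = c' \<and> b = b'" using assms that by simp
  qed simp
  then show ?thesis using assms chunk_index_less[OF assms(2,3)]
    by (intro nth_equalityI) (auto simp: nth_list_update)
qed

lemma count_list_chunks:
  assumes "length w = N * d"
  shows "count_list w i = (\<Sum>c<N. count_list (chunk d w c) i)"
proof -
  have cl: "count_list w i = (\<Sum>p<length w. of_bool (w ! p = i))" for w :: "nat list"
    using Int_def[of "{..<length w}" "{p. w ! p = i}"]
    by (simp add: count_list_eq_card of_bool_def sum.If_cases)
  show ?thesis unfolding cl assms sum_lessThan_mult by simp
qed

text \<open>Raising inside chunk c multiplies column c by the matrix \<open>L i\<close>; summed over
  c this is the derivation of \<open>sum_det_derivation\<close>, which vanishes by the trace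
  condition. For the weight, a nonzero Leibniz term pairs the columns with all rows, so the letter
  counts add up to the total weight of all rows.\<close>

lemma highest_weight_chunk_det:
  assumes size: "N * d = n * s"
    and deriv: "\<And>c w i r. c < N \<Longrightarrow> w \<in> words n d \<Longrightarrow> Suc i < n \<Longrightarrow> r < N \<Longrightarrow>
      raise i (\<lambda>w. \<mu> c w r) w = (\<Sum>k<N. L i r k * \<mu> c w k)"
    and trace: "\<And>i. Suc i < n \<Longrightarrow> (\<Sum>k<N. L i k k) = 0"
    and weight: "\<And>c w i r. c < N \<Longrightarrow> w \<in> words n d \<Longrightarrow> i < n \<Longrightarrow> r < N \<Longrightarrow> \<mu> c w r \<noteq> 0 \<Longrightarrow>
      count_list w i = wt r i"
    and weight_sum: "\<And>i. i < n \<Longrightarrow> (\<Sum>r<N. wt r i) = s"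
  shows "highest_weight n s (chunk_det N d \<mu>)"
  unfolding highest_weight_def
proof (intro ballI conjI allI impI)
  fix w i assume w: "w \<in> words n (n * s)" and i: "Suc i < n"
  have len: "length w = N * d" using w size by (simp add: words_def)
  have ch: "chunk d w c \<in> words n d" if "c < N" for c
    using chunk_in_words[of w n N d] w that size by simp
  define U where "U r c = \<mu> c (chunk d w c) r" for r c
  have "raise i (chunk_det N d \<mu>) w =
      (\<Sum>c<N. \<Sum>b<d. if w ! (c * d + b) = i then chunk_det N d \<mu> (w[c * d + b := Suc i]) else 0)"
    unfolding raise_def len sum_lessThan_mult ..
  also have "\<dots> = (\<Sum>c<N. det (mat N N (\<lambda>(r, c'). if c' = c then \<Sum>k<N. L i r k * U k c else U r c')))"
  proof (intro sum.cong refl)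
    fix c assume "c \<in> {..<N}"
    then have c: "c < N" by simp
    let ?cof = "\<lambda>r. cofactor (mat N N (\<lambda>(r, c). U r c)) r c"
    have "(\<Sum>b<d. if w ! (c * d + b) = i then chunk_det N d \<mu> (w[c * d + b := Suc i]) else 0) =
       (\<Sum>b<d. \<Sum>r<N. (if chunk d w c ! b = i then \<mu> c ((chunk d w c)[b := Suc i]) r else 0) * ?cof r)"
    proof (intro sum.cong refl)
      fix b assume "b \<in> {..<d}"
      then have b: "b < d" by simp
      have "chunk_det N d \<mu> (w[c * d + b := Suc i]) =
        det (mat N N (\<lambda>(r, c'). if c' = c then \<mu> c ((chunk d w c)[b := Suc i]) r else U r c'))"
        unfolding chunk_det_def U_def
        by (intro arg_cong[of _ _ det] eq_matI) (auto simp: chunk_list_update[OF len c b])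
      also have "\<dots> = (\<Sum>r<N. \<mu> c ((chunk d w c)[b := Suc i]) r * ?cof r)"
        by (rule det_replace_col_sum[OF c])
      finally show "(if w ! (c * d + b) = i then chunk_det N d \<mu> (w[c * d + b := Suc i]) else 0) =
        (\<Sum>r<N. (if chunk d w c ! b = i then \<mu> c ((chunk d w c)[b := Suc i]) r else 0) * ?cof r)"
        using b by simp
    qed
    also have "\<dots> = (\<Sum>r<N. raise i (\<lambda>w. \<mu> c w r) (chunk d w c) * ?cof r)"
      by (subst sum.swap) (simp add: raise_def sum_distrib_right)
    also have "\<dots> = (\<Sum>r<N. (\<Sum>k<N. L i r k * U k c) * ?cof r)"
      using deriv[OF c ch[OF c] i] by (simp add: U_def)
    also have "\<dots> = det (mat N N (\<lambda>(r, c'). if c' = c then \<Sum>k<N. L i r k * U k c else U r c'))"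
      by (rule det_replace_col_sum[OF c, symmetric])
    finally show "(\<Sum>b<d. if w ! (c * d + b) = i then chunk_det N d \<mu> (w[c * d + b := Suc i]) else 0) =
      det (mat N N (\<lambda>(r, c'). if c' = c then \<Sum>k<N. L i r k * U k c else U r c'))" .
  qed
  also have "\<dots> = 0" unfolding sum_det_derivation trace[OF i] by simp
  finally show "raise i (chunk_det N d \<mu>) w = 0" .
next
  fix w i assume w: "w \<in> words n (n * s)" and nz: "chunk_det N d \<mu> w \<noteq> 0" and i: "i < n"
  have len: "length w = N * d" using w size by (simp add: words_def)
  obtain \<pi> where \<pi>: "\<pi> permutes {..<N}" "\<And>c. c < N \<Longrightarrow> \<mu> c (chunk d w c) (\<pi> c) \<noteq> 0"
    using det_nonzero_permutes[of N "\<lambda>r c. \<mu> c (chunk d w c) r"] nz unfolding chunk_det_def by metis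
  have "count_list w i = (\<Sum>c<N. count_list (chunk d w c) i)" by (rule count_list_chunks[OF len])
  also have "\<dots> = (\<Sum>c<N. wt (\<pi> c) i)"
  proof (intro sum.cong refl)
    fix c assume "c \<in> {..<N}"
    then show "count_list (chunk d w c) i = wt (\<pi> c) i"
      using weight[of c "chunk d w c" i "\<pi> c"] \<pi>(2) i w size permutes_in_image[OF \<pi>(1), of c]
        chunk_in_words[of w n N d c] by simp
  qed
  also have "\<dots> = (\<Sum>c<N. wt c i)"
    using sum.permute[OF \<pi>(1), of "\<lambda>c. wt c i"] unfolding comp_def by (rule sym)
  finally show "count_list w i = s" using weight_sum[OF i] by simp
qed

section \<open>Evaluating multilinear sums whose coefficients are highest weight functions\<close>

lemma det_coordinate_expansion:
  fixes x :: "nat \<Rightarrow> nat \<Rightarrow> 'a::comm_ring_1"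
  shows "det (mat n n (\<lambda>(i, j). x j i)) = (\<Sum>u\<in>Pi\<^sub>E {..<n} (\<lambda>_. {..<n}).
    (\<Prod>j<n. x j (u j)) * of_int (det (mat n n (\<lambda>(i, j). of_bool (u j = i)))))"
proof -
  have "mat n n (\<lambda>(i, j). x j i) = mat n n (\<lambda>(i, j). \<Sum>a\<in>{..<n}. x j a * of_bool (a = i))"
    by (intro eq_matI) (auto simp: of_bool_def if_distrib[of "\<lambda>x. _ * x"] sum.delta cong: if_cong)
  then show ?thesis by (simp only: of_int_det of_int_of_bool det_sum_cols finite_lessThan)
qed

text \<open>Selecting columns by f is multiplication by a 0-1 matrix. The map f need not be
  injective; if it is not, both determinants on the selected columns vanish.\<close>

lemma det_cols_reindex:
  fixes y :: "nat \<Rightarrow> nat \<Rightarrow> 'a::comm_ring_1"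
  assumes f: "\<And>j. j < n \<Longrightarrow> f j < n"
  shows "det (mat n n (\<lambda>(i, j). y (f j) i)) =
    det (mat n n (\<lambda>(i, j). y j i)) * of_int (det (mat n n (\<lambda>(i, j). of_bool (f j = i))))"
proof -
  let ?Y = "mat n n (\<lambda>(i, j). y j i)" and ?P = "mat n n (\<lambda>(i, j). of_bool (f j = i))"
  have "mat n n (\<lambda>(i, j). y (f j) i) = ?Y * ?P"
  proof (rule eq_matI)
    fix i j assume "i < dim_row (?Y * ?P)" "j < dim_col (?Y * ?P)"
    then have ij: "i < n" "j < n" by simp_all
    have "(?Y * ?P) $$ (i, j) = (\<Sum>x\<in>{0..<n}. y x i * of_bool (f j = x))"
      using ij by (simp add: scalar_prod_def)
    also have "\<dots> = (\<Sum>x\<in>{0..<n}. if x = f j then y x i else 0)"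
      by (intro sum.cong) auto
    also have "\<dots> = y (f j) i" using f[OF ij(2)] by simp
    finally show "mat n n (\<lambda>(i, j). y (f j) i) $$ (i, j) = (?Y * ?P) $$ (i, j)" using ij by simp
  qed simp_all
  then show ?thesis unfolding of_int_det of_int_of_bool by (simp add: det_mult[of _ n])
qed

text \<open>Expanding the s determinants in coordinates chooses a letter for every box of the
  tableau; transported along T these choices are the words of length n * s.\<close>

lemma sum_bracket_prod:
  fixes v :: "nat \<Rightarrow> nat \<Rightarrow> 'a::comm_ring_1"
  assumes T: "tableau n s T"
  shows "(\<Sum>w\<in>words n (n * s). (\<Prod>p<n * s. v p (w ! p)) * of_int (bracket_prod n s T w)) =
    (\<Prod>k<s. det (mat n n (\<lambda>(i, j). v (T k j) i)))"
proof -
  let ?U = "Pi\<^sub>E {..<n} (\<lambda>_. {..<n})"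
  have bij: "bij_betw (\<lambda>(k, j). T k j) ({..<s} \<times> {..<n}) {..<n * s}"
    using T by (simp add: tableau_def)
  define R where "R = inv_into ({..<s} \<times> {..<n}) (\<lambda>(k, j). T k j)"
  have R1: "R (T k j) = (k, j)" if "k < s" "j < n" for k j
    using bij_betw_inv_into_left[OF bij, of "(k, j)"] that by (simp add: R_def)
  have R2: "R p \<in> {..<s} \<times> {..<n}" "(case R p of (k, j) \<Rightarrow> T k j) = p" if "p < n * s" for p
    using bij_betw_inv_into_right[OF bij, of p] bij_betwE[OF bij_betw_inv_into[OF bij]] that
    by (auto simp: R_def)
  have "(\<Prod>k<s. det (mat n n (\<lambda>(i, j). v (T k j) i))) =
      (\<Prod>k<s. \<Sum>u\<in>?U. (\<Prod>j<n. v (T k j) (u j)) * of_int (det (mat n n (\<lambda>(i, j). of_bool (u j = i)))))"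
    by (rule prod.cong[OF refl]) (rule det_coordinate_expansion)
  also have "\<dots> = (\<Sum>G\<in>Pi\<^sub>E {..<s} (\<lambda>_. ?U). \<Prod>k<s. (\<Prod>j<n. v (T k j) (G k j)) *
      of_int (det (mat n n (\<lambda>(i, j). of_bool (G k j = i)))))"
    by (rule prod_sum_PiE) (auto intro: finite_PiE)
  also have "\<dots> = (\<Sum>w\<in>words n (n * s). (\<Prod>p<n * s. v p (w ! p)) * of_int (bracket_prod n s T w))"
  proof (rule sum.reindex_bij_witness[of _ "\<lambda>w. \<lambda>k\<in>{..<s}. \<lambda>j\<in>{..<n}. w ! T k j"
        "\<lambda>G. map (\<lambda>p. case R p of (k, j) \<Rightarrow> G k j) [0..<n * s]"])
    fix G assume G: "G \<in> Pi\<^sub>E {..<s} (\<lambda>_. ?U)"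
    let ?w = "map (\<lambda>p. case R p of (k, j) \<Rightarrow> G k j) [0..<n * s]"
    have nth: "?w ! T k j = G k j" if "k < s" "j < n" for k j
      using tableau_less[OF T that] R1[OF that] by simp
    show "(\<lambda>k\<in>{..<s}. \<lambda>j\<in>{..<n}. ?w ! T k j) = G"
    proof (rule extensionalityI[of _ "{..<s}"])
      fix k assume k: "k \<in> {..<s}"
      show "(\<lambda>k\<in>{..<s}. \<lambda>j\<in>{..<n}. ?w ! T k j) k = G k"
      proof (rule extensionalityI[of _ "{..<n}"])
        show "G k \<in> extensional {..<n}" using G k by (auto simp: PiE_iff)
      qed (use k nth in auto)
    qed (use G in \<open>simp_all add: PiE_iff\<close>)
    show "?w \<in> words n (n * s)"
    proof -
      have "(case R p of (k, j) \<Rightarrow> G k j) < n" if "p < n * s" for p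
        using R2(1)[OF that] G by (auto simp: PiE_iff)
      then show ?thesis by (auto simp: words_def)
    qed
    show "(\<Prod>p<n * s. v p (?w ! p)) * of_int (bracket_prod n s T ?w) =
      (\<Prod>k<s. (\<Prod>j<n. v (T k j) (G k j)) * of_int (det (mat n n (\<lambda>(i, j). of_bool (G k j = i)))))"
      unfolding tableau_prod[OF T] prod.distrib bracket_prod_def of_int_prod
      using nth by (intro arg_cong2[of _ _ _ _ "(*)"] prod.cong refl arg_cong[of _ _ of_int]
          arg_cong[of _ _ det] eq_matI) auto
  next
    fix w assume w: "w \<in> words n (n * s)"
    show "map (\<lambda>p. case R p of (k, j) \<Rightarrow> (\<lambda>k\<in>{..<s}. \<lambda>j\<in>{..<n}. w ! T k j) k j) [0..<n * s] = w"
    proof (rule nth_equalityI)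
      fix p assume "p < length (map (\<lambda>p. case R p of (k, j) \<Rightarrow> (\<lambda>k\<in>{..<s}. \<lambda>j\<in>{..<n}. w ! T k j) k j) [0..<n * s])"
      then have p: "p < n * s" by simp
      from R2[OF p] obtain k j where "R p = (k, j)" "k < s" "j < n" "T k j = p" by auto
      then show "map (\<lambda>p. case R p of (k, j) \<Rightarrow> (\<lambda>k\<in>{..<s}. \<lambda>j\<in>{..<n}. w ! T k j) k j) [0..<n * s] ! p = w ! p"
        using p by simp
    qed (use w in \<open>simp add: words_def\<close>)
    have "w ! T k j < n" if "k < s" "j < n" for k j
      using nth_mem[of "T k j" w] tableau_less[OF T that] w subsetD[of "set w" "{..<n}" "w ! T k j"]
      by (simp add: words_def)
    then show "(\<lambda>k\<in>{..<s}. \<lambda>j\<in>{..<n}. w ! T k j) \<in> Pi\<^sub>E {..<s} (\<lambda>_. ?U)" by auto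
  qed
  finally show ?thesis ..
qed

lemma sum_list_bracket_swap:
  "(\<Sum>w\<in>A. X w * of_int (\<Sum>(T, g)\<leftarrow>ps. h T w * g u)) =
    (\<Sum>(T, g)\<leftarrow>ps. (\<Sum>w\<in>A. X w * of_int (h T w)) * (of_int (g u) :: 'a::comm_ring_1))"
  by (induction ps) (auto simp: algebra_simps sum.distrib sum_distrib_left)

text \<open>One list \<open>ps\<close> serves all vectors v at once and also expands the integers
  \<open>c w u\<close> themselves. The latter allows the coefficients to be summed up again after a
  substitution for v, as in \<open>highest_weight_sum_basis\<close>.\<close>

lemma highest_weight_sum_expansion:
  fixes c :: "nat list \<Rightarrow> 'u \<Rightarrow> int"
  assumes hw: "\<And>u. highest_weight n s (\<lambda>w. c w u)"
    and mem: "\<And>w. w \<in> words n (n * s) \<Longrightarrow> c w \<in> W"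
    and W: "\<And>f g a. f \<in> W \<Longrightarrow> g \<in> W \<Longrightarrow> (\<lambda>u. f u - a * g u) \<in> W"
  shows "\<exists>ps. (\<forall>(T, g)\<in>set ps. tableau n s T \<and> g \<in> W) \<and>
    (\<forall>w\<in>words n (n * s). \<forall>u. c w u = (\<Sum>(T, g)\<leftarrow>ps. bracket_prod n s T w * g u)) \<and>
    (\<forall>(v :: nat \<Rightarrow> nat \<Rightarrow> 'a::comm_ring_1) u.
      (\<Sum>w\<in>words n (n * s). (\<Prod>p<n * s. v p (w ! p)) * of_int (c w u)) =
      (\<Sum>(T, g)\<leftarrow>ps. (\<Prod>k<s. det (mat n n (\<lambda>(i, j). v (T k j) i))) * of_int (g u)))"
proof -
  obtain ps where ps: "\<And>T g. (T, g) \<in> set ps \<Longrightarrow> tableau n s T \<and> g \<in> W"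
    "\<And>w u. w \<in> words n (n * s) \<Longrightarrow> c w u = (\<Sum>(T, g)\<leftarrow>ps. bracket_prod n s T w * g u)"
    using highest_weight_bracket_expansion[OF assms] by blast
  have "(\<Sum>w\<in>words n (n * s). (\<Prod>p<n * s. v p (w ! p)) * of_int (c w u)) =
      (\<Sum>(T, g)\<leftarrow>ps. (\<Prod>k<s. det (mat n n (\<lambda>(i, j). v (T k j) i))) * of_int (g u))"
    for v :: "nat \<Rightarrow> nat \<Rightarrow> 'a::comm_ring_1" and u
  proof -
    have "(\<Sum>w\<in>words n (n * s). (\<Prod>p<n * s. v p (w ! p)) * of_int (c w u)) =
      (\<Sum>w\<in>words n (n * s). (\<Prod>p<n * s. v p (w ! p)) *
        of_int (\<Sum>(T, g)\<leftarrow>ps. bracket_prod n s T w * g u))"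
      using ps(2) by (intro sum.cong refl) simp
    also have "\<dots> = (\<Sum>(T, g)\<leftarrow>ps. (\<Sum>w\<in>words n (n * s). (\<Prod>p<n * s. v p (w ! p)) *
        of_int (bracket_prod n s T w)) * of_int (g u))"
      by (rule sum_list_bracket_swap)
    also have "\<dots> = (\<Sum>(T, g)\<leftarrow>ps. (\<Prod>k<s. det (mat n n (\<lambda>(i, j). v (T k j) i))) * of_int (g u))"
    proof -
      have "(\<Sum>w\<in>words n (n * s). (\<Prod>p<n * s. v p (w ! p)) * of_int (bracket_prod n s T w)) =
          (\<Prod>k<s. det (mat n n (\<lambda>(i, j). v (T k j) i)))" if "(T, g) \<in> set ps" for T g
        using ps(1)[OF that] by (intro sum_bracket_prod) simp
      then show ?thesis
        by (intro arg_cong[of _ _ sum_list] map_cong refl) (auto split: prod.splits)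
    qed
    finally show ?thesis .
  qed
  with ps show ?thesis by blast
qed

lemma highest_weight_sum_in_ideal:
  fixes v :: "nat \<Rightarrow> nat \<Rightarrow> 'a::comm_ring_1"
  assumes f: "highest_weight n s f" and K: "is_ideal K"
    and det: "\<And>T. tableau n s T \<Longrightarrow> (\<Prod>k<s. det (mat n n (\<lambda>(i, j). v (T k j) i))) \<in> K"
  shows "(\<Sum>w\<in>words n (n * s). (\<Prod>p<n * s. v p (w ! p)) * of_int (f w)) \<in> K"
proof -
  obtain ps where ps: "\<forall>(T, g)\<in>set ps. tableau n s T \<and> g \<in> UNIV"
    "\<forall>(v :: nat \<Rightarrow> nat \<Rightarrow> 'a) (u :: unit).
      (\<Sum>w\<in>words n (n * s). (\<Prod>p<n * s. v p (w ! p)) * of_int (f w)) =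
      (\<Sum>(T, g)\<leftarrow>ps. (\<Prod>k<s. det (mat n n (\<lambda>(i, j). v (T k j) i))) * of_int (g u))"
    using highest_weight_sum_expansion[of n s "\<lambda>w (u :: unit). f w" UNIV, OF f UNIV_I UNIV_I, where 'a = 'a] by blast
  have T: "tableau n s T" if "(T, g) \<in> set ps" for T g
    using ps(1) that by blast
  show ?thesis unfolding ps(2)[rule_format, of v "()"]
    by (intro is_ideal_sum_list[OF K]) (auto intro!: is_ideal_mult_right[OF K] det dest!: T)
qed

text \<open>A matrix acts on functions of rectangular weight by the s-th power of its determinant.
  Substituting the vectors \<open>y (\<omega> ! p)\<close> turns each bracket into det(Y) times the
  bracket evaluated at \<omega>, and the remaining integer sum is the expansion of
  \<open>f \<omega>\<close>.\<close>

lemma highest_weight_sum_basis: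
  fixes y :: "nat \<Rightarrow> nat \<Rightarrow> 'a::comm_ring_1"
  assumes f: "highest_weight n s f" and \<omega>: "\<omega> \<in> words n (n * s)"
  shows "(\<Sum>w\<in>words n (n * s). (\<Prod>p<n * s. y (\<omega> ! p) (w ! p)) * of_int (f w)) =
    det (mat n n (\<lambda>(i, j). y j i)) ^ s * of_int (f \<omega>)"
proof -
  obtain ps where ps: "\<forall>(T, g)\<in>set ps. tableau n s T \<and> g \<in> UNIV"
    "\<forall>w\<in>words n (n * s). \<forall>u. f w = (\<Sum>(T, g)\<leftarrow>ps. bracket_prod n s T w * g u)"
    "\<forall>(v :: nat \<Rightarrow> nat \<Rightarrow> 'a) (u :: unit).
      (\<Sum>w\<in>words n (n * s). (\<Prod>p<n * s. v p (w ! p)) * of_int (f w)) =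
      (\<Sum>(T, g)\<leftarrow>ps. (\<Prod>k<s. det (mat n n (\<lambda>(i, j). v (T k j) i))) * of_int (g u))"
    using highest_weight_sum_expansion[of n s "\<lambda>w (u :: unit). f w" UNIV, OF f UNIV_I UNIV_I, where 'a = 'a] by blast
  let ?Y = "mat n n (\<lambda>(i, j). y j i)"
  have d: "(\<Prod>k<s. det (mat n n (\<lambda>(i, j). y (\<omega> ! T k j) i))) = det ?Y ^ s * of_int (bracket_prod n s T \<omega>)"
    if T: "tableau n s T" for T
  proof -
    have "det (mat n n (\<lambda>(i, j). y (\<omega> ! T k j) i)) =
        det ?Y * of_int (det (mat n n (\<lambda>(i, j). of_bool (\<omega> ! T k j = i))))" if k: "k < s" for k
      by (rule det_cols_reindex[of n "\<lambda>j. \<omega> ! T k j"]) (rule nth_words_less[OF \<omega> tableau_less[OF T k]])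
    then show ?thesis by (simp add: bracket_prod_def prod.distrib)
  qed
  have T: "tableau n s T" if "(T, g) \<in> set ps" for T g
    using ps(1) that by blast
  have "(\<Sum>w\<in>words n (n * s). (\<Prod>p<n * s. y (\<omega> ! p) (w ! p)) * of_int (f w)) =
      (\<Sum>(T, g)\<leftarrow>ps. det ?Y ^ s * of_int (bracket_prod n s T \<omega>) * of_int (g ()))"
    unfolding ps(3)[rule_format, of "\<lambda>p. y (\<omega> ! p)" "()"]
    by (intro arg_cong[of _ _ sum_list] map_cong refl) (auto split: prod.splits dest!: T simp: d)
  also have "\<dots> = det ?Y ^ s * of_int (\<Sum>(T, g)\<leftarrow>ps. bracket_prod n s T \<omega> * g ())"
    by (induction ps) (auto simp: algebra_simps)
  finally show ?thesis using ps(2)[rule_format, OF \<omega>, of "()"] by simp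
qed

section \<open>Functors given by integral multilinear maps\<close>

definition multilinear :: "nat \<Rightarrow> nat \<Rightarrow> (nat list \<Rightarrow> 'c \<Rightarrow> int) \<Rightarrow> (nat \<Rightarrow> nat \<Rightarrow> 'a::comm_ring_1) \<Rightarrow> 'c \<Rightarrow> 'a" where
  "multilinear n d \<mu> v \<beta> = (\<Sum>w\<in>words n d. (\<Prod>b<d. v b (w ! b)) * of_int (\<mu> w \<beta>))"

text \<open>The matrix \<open>L i\<close> describes the action of \<open>raise i\<close> on the target module with basis \<open>C\<close>, \<open>wt\<close> gives
  the weights of the basis elements, and \<open>can \<beta>\<close> is a word that is mapped to the basis element \<open>\<beta>\<close>.\<close>

locale multilinear_functor =
  fixes n d s :: nat and C :: "'c set" and \<mu> :: "nat list \<Rightarrow> 'c \<Rightarrow> int"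
    and L :: "nat \<Rightarrow> 'c \<Rightarrow> 'c \<Rightarrow> int" and wt :: "'c \<Rightarrow> nat \<Rightarrow> nat" and can :: "'c \<Rightarrow> nat list"
  assumes finite_C: "finite C"
    and deriv: "\<And>w i \<beta>. w \<in> words n d \<Longrightarrow> Suc i < n \<Longrightarrow> \<beta> \<in> C \<Longrightarrow>
      raise i (\<lambda>w. \<mu> w \<beta>) w = (\<Sum>\<gamma>\<in>C. L i \<beta> \<gamma> * \<mu> w \<gamma>)"
    and diag: "\<And>i \<beta>. Suc i < n \<Longrightarrow> \<beta> \<in> C \<Longrightarrow> L i \<beta> \<beta> = 0"
    and weight: "\<And>w i \<beta>. w \<in> words n d \<Longrightarrow> \<beta> \<in> C \<Longrightarrow> \<mu> w \<beta> \<noteq> 0 \<Longrightarrow> i < n \<Longrightarrow> count_list w i = wt \<beta> i"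
    and weight_sum: "\<And>i. i < n \<Longrightarrow> (\<Sum>\<beta>\<in>C. wt \<beta> i) = s"
    and can_words: "\<And>\<beta>. \<beta> \<in> C \<Longrightarrow> can \<beta> \<in> words n d"
    and can: "\<And>\<beta> \<gamma>. \<beta> \<in> C \<Longrightarrow> \<gamma> \<in> C \<Longrightarrow> \<mu> (can \<gamma>) \<beta> = of_bool (\<beta> = \<gamma>)"
begin

text \<open>Counts the letters of all canonical words in two ways: each has d letters, and every one
  of the n letters occurs s times in total.\<close>

lemma card_mult_degree: "card C * d = n * s"
proof -
  have "d = (\<Sum>i<n. wt \<beta> i)" if "\<beta> \<in> C" for \<beta>
  proof -
    have "set (can \<beta>) \<subseteq> {..<n}" "length (can \<beta>) = d" using can_words[OF that] by (auto simp: words_def)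
    then have "d = (\<Sum>i<n. count_list (can \<beta>) i)"
      using sum_count_set[of "can \<beta>" "{..<n}"] by simp
    also have "\<dots> = (\<Sum>i<n. wt \<beta> i)"
      using weight[OF can_words[OF that] that] can[OF that that] by simp
    finally show ?thesis .
  qed
  then have "(\<Sum>\<beta>\<in>C. d) = (\<Sum>\<beta>\<in>C. \<Sum>i<n. wt \<beta> i)" by (rule sum.cong[OF refl])
  also have "\<dots> = (\<Sum>i<n. \<Sum>\<beta>\<in>C. wt \<beta> i)" by (rule sum.swap)
  finally show ?thesis using weight_sum by simp
qed

context
  fixes \<rho> :: "nat \<Rightarrow> 'c"
  assumes \<rho>: "bij_betw \<rho> {..<card C} C"
begin

lemma highest_weight_det: "highest_weight n s (chunk_det (card C) d (\<lambda>_ w r. \<mu> w (\<rho> r)))"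
proof (rule highest_weight_chunk_det[where L = "\<lambda>i r k. L i (\<rho> r) (\<rho> k)" and wt = "\<lambda>r. wt (\<rho> r)"])
  have in_C: "\<rho> r \<in> C" if "r < card C" for r using bij_betwE[OF \<rho>] that by simp
  show "raise i (\<lambda>w. \<mu> w (\<rho> r)) w = (\<Sum>k<card C. L i (\<rho> r) (\<rho> k) * \<mu> w (\<rho> k))"
    if "w \<in> words n d" "Suc i < n" "r < card C" for w i r
    using deriv[OF that(1,2) in_C[OF that(3)]]
    by (simp add: sum.reindex_bij_betw[OF \<rho>, of "\<lambda>\<gamma>. L i (\<rho> r) \<gamma> * \<mu> w \<gamma>"])
  show "(\<Sum>k<card C. L i (\<rho> k) (\<rho> k)) = 0" if "Suc i < n" for i
    using diag that in_C by (intro sum.neutral) auto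
  show "count_list w i = wt (\<rho> r) i" if "w \<in> words n d" "i < n" "r < card C" "\<mu> w (\<rho> r) \<noteq> 0" for w i r
    using weight in_C that by blast
  show "(\<Sum>r<card C. wt (\<rho> r) i) = s" if "i < n" for i
    using weight_sum[OF that] by (simp add: sum.reindex_bij_betw[OF \<rho>, of "\<lambda>\<beta>. wt \<beta> i"])
qed (rule card_mult_degree)

text \<open>The d arguments of all columns are laid out as one sequence of n * s vectors, with
  position p holding argument \<open>p mod d\<close> of column \<open>p div d\<close>. Every bracket
  of the expansion takes n of these vectors, hence lies in I, and each term has s brackets.\<close>

lemma det_multilinear_in_ideal_power:
  fixes v :: "nat \<Rightarrow> nat \<Rightarrow> nat \<Rightarrow> 'a::comm_ring_1"
  assumes v: "\<And>c b. c < card C \<Longrightarrow> b < d \<Longrightarrow> v c b \<in> V"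
    and V: "\<And>x. (\<And>j. j < n \<Longrightarrow> x j \<in> V) \<Longrightarrow> det (mat n n (\<lambda>(i, j). x j i)) \<in> I"
  shows "det (mat (card C) (card C) (\<lambda>(r, c). multilinear n d \<mu> (v c) (\<rho> r))) \<in> ideal_power I s"
proof -
  define v' where "v' p = v (p div d) (p mod d)" for p
  have v': "v' p \<in> V" if "p < n * s" for p
  proof -
    have p: "p < card C * d" using that card_mult_degree by simp
    then have "d > 0" by (cases d) auto
    then show ?thesis using v less_mult_imp_div_less[OF p] by (simp add: v'_def)
  qed
  have "det (mat (card C) (card C) (\<lambda>(r, c). multilinear n d \<mu> (v c) (\<rho> r))) =
    det (mat (card C) (card C) (\<lambda>(r, c). \<Sum>w\<in>words n d. (\<Prod>b<d. v' (c * d + b) (w ! b)) * of_int (\<mu> w (\<rho> r))))"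
    by (intro arg_cong[of _ _ det] eq_matI) (auto simp: multilinear_def v'_def intro!: sum.cong prod.cong)
  also have "\<dots> = (\<Sum>w\<in>words n (n * s). (\<Prod>p<n * s. v' p (w ! p)) *
      of_int (chunk_det (card C) d (\<lambda>_ w r. \<mu> w (\<rho> r)) w))"
    by (rule det_chunk_expansion[where \<mu> = "\<lambda>_ w r. \<mu> w (\<rho> r)" and N = "card C" and n = n and d = d,
          unfolded card_mult_degree])
  also have "\<dots> \<in> ideal_power I s"
  proof (rule highest_weight_sum_in_ideal[OF highest_weight_det is_ideal_ideal_power])
    fix T assume T: "tableau n s T"
    show "(\<Prod>k<s. det (mat n n (\<lambda>(i, j). v' (T k j) i))) \<in> ideal_power I s"
      using tableau_less[OF T] v' by (intro prod_in_ideal_power V) auto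
  qed
  finally show ?thesis .
qed

text \<open>The word \<omega> concatenates the canonical words of the basis, so the minor describes
  the functor applied to Y. By \<open>highest_weight_sum_basis\<close> it is det(Y)^s times the
  coefficient at \<omega>, and that coefficient is the determinant of the functor at the identity,
  namely 1.\<close>

lemma det_multilinear_basis:
  fixes y :: "nat \<Rightarrow> nat \<Rightarrow> 'a::comm_ring_1"
  shows "det (mat (card C) (card C) (\<lambda>(r, c). multilinear n d \<mu> (\<lambda>b. y (can (\<rho> c) ! b)) (\<rho> r))) =
    det (mat n n (\<lambda>(i, j). y j i)) ^ s"
proof -
  have in_C: "\<rho> r \<in> C" if "r < card C" for r using bij_betwE[OF \<rho>] that by simp
  have \<rho>_eq: "\<rho> r = \<rho> c \<longleftrightarrow> r = c" if "r < card C" "c < card C" for r c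
    using bij_betw_imp_inj_on[OF \<rho>] that by (auto simp: inj_on_def)
  define \<omega> where "\<omega> = map (\<lambda>p. can (\<rho> (p div d)) ! (p mod d)) [0..<card C * d]"
  have can_nth: "can (\<rho> c) ! b < n" if "c < card C" "b < d" for c b
    using nth_words_less[OF can_words[OF in_C[OF that(1)]] that(2)] .
  have \<omega>: "\<omega> \<in> words n (n * s)"
  proof -
    have "can (\<rho> (p div d)) ! (p mod d) < n" if "p < card C * d" for p
    proof -
      have "d > 0" using that by (cases d) auto
      then show ?thesis using can_nth less_mult_imp_div_less[OF that] by simp
    qed
    then show ?thesis by (auto simp: words_def \<omega>_def card_mult_degree[symmetric])
  qed
  have ch: "chunk d \<omega> c = can (\<rho> c)" if c: "c < card C" for c
    using can_words[OF in_C[OF c]] chunk_index_less[OF c, of _ d]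
    by (intro nth_equalityI) (auto simp: \<omega>_def words_def)
  have "det (mat (card C) (card C) (\<lambda>(r, c). multilinear n d \<mu> (\<lambda>b. y (can (\<rho> c) ! b)) (\<rho> r))) =
    det (mat (card C) (card C) (\<lambda>(r, c). \<Sum>w\<in>words n d.
      (\<Prod>b<d. y (\<omega> ! (c * d + b)) (w ! b)) * of_int (\<mu> w (\<rho> r))))"
  proof (rule det_mat_cong)
    fix r c assume rc: "r < card C" "c < card C"
    have "\<omega> ! (c * d + b) = can (\<rho> c) ! b" if "b < d" for b
      using nth_chunk[OF that, of \<omega> c] ch[OF rc(2)] by simp
    then show "multilinear n d \<mu> (\<lambda>b. y (can (\<rho> c) ! b)) (\<rho> r) =
      (\<Sum>w\<in>words n d. (\<Prod>b<d. y (\<omega> ! (c * d + b)) (w ! b)) * of_int (\<mu> w (\<rho> r)))"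
      by (simp add: multilinear_def)
  qed
  also have "\<dots> = (\<Sum>w\<in>words n (n * s). (\<Prod>p<n * s. y (\<omega> ! p) (w ! p)) *
      of_int (chunk_det (card C) d (\<lambda>_ w r. \<mu> w (\<rho> r)) w))"
    by (rule det_chunk_expansion[where \<mu> = "\<lambda>_ w r. \<mu> w (\<rho> r)" and v = "\<lambda>p. y (\<omega> ! p)"
          and N = "card C" and n = n and d = d, unfolded card_mult_degree])
  also have "\<dots> = det (mat n n (\<lambda>(i, j). y j i)) ^ s * of_int (chunk_det (card C) d (\<lambda>_ w r. \<mu> w (\<rho> r)) \<omega>)"
    by (rule highest_weight_sum_basis[OF highest_weight_det \<omega>])
  also have "chunk_det (card C) d (\<lambda>_ w r. \<mu> w (\<rho> r)) \<omega> = 1"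
  proof -
    have "mat (card C) (card C) (\<lambda>(r, c). \<mu> (chunk d \<omega> c) (\<rho> r)) = 1\<^sub>m (card C)"
      by (intro eq_matI) (auto simp: ch can in_C \<rho>_eq)
    then show ?thesis by (simp add: chunk_det_def)
  qed
  finally show ?thesis by simp
qed

end

end

section \<open>Polarization\<close>

lemma sum_Pow_alternating:
  "finite D \<Longrightarrow> (\<Sum>S\<in>Pow D. (-1) ^ card S) = (of_bool (D = {}) :: 'a::comm_ring_1)"
proof (induction D rule: finite_induct)
  case (insert a D)
  have inj: "inj_on (insert a) (Pow D)" using insert.hyps(2) by (auto simp: inj_on_def)
  have card: "card (insert a S) = Suc (card S)" if "S \<in> Pow D" for S
  proof -
    have "finite S" "a \<notin> S" using that insert.hyps finite_subset by auto
    then show ?thesis by simp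
  qed
  have "(\<Sum>S\<in>Pow (insert a D). (-1) ^ card S) =
      (\<Sum>S\<in>Pow D. (-1) ^ card S) + (\<Sum>S\<in>insert a ` Pow D. (-1) ^ card S :: 'a)"
    unfolding Pow_insert using insert.hyps by (intro sum.union_disjoint) auto
  also have "(\<Sum>S\<in>insert a ` Pow D. (-1) ^ card S :: 'a) = (\<Sum>S\<in>Pow D. - ((-1) ^ card S))"
    unfolding sum.reindex[OF inj] by (intro sum.cong refl) (simp add: card)
  finally show ?case by (simp add: sum_negf)
qed simp

text \<open>The row group of a rectangle with n rows and s columns: an independent permutation of
  the columns in each row. With the two numbers exchanged it also serves as the column
  group.\<close>

definition perm_families :: "nat \<Rightarrow> nat \<Rightarrow> (nat \<Rightarrow> nat \<Rightarrow> nat) set" where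
  "perm_families n s = Pi\<^sub>E {..<n} (\<lambda>_. {\<pi>. \<pi> permutes {..<s}})"

definition fillings :: "nat \<Rightarrow> nat \<Rightarrow> (nat \<Rightarrow> nat \<Rightarrow> nat) set" where
  "fillings n s = Pi\<^sub>E {..<s} (\<lambda>_. Pi\<^sub>E {..<n} (\<lambda>_. {..<n}))"

definition permute_rows :: "nat \<Rightarrow> nat \<Rightarrow> (nat \<Rightarrow> nat \<Rightarrow> nat) \<Rightarrow> (nat \<Rightarrow> nat \<Rightarrow> nat) \<Rightarrow> nat \<Rightarrow> nat \<Rightarrow> nat" where
  "permute_rows n s \<sigma> u = (\<lambda>k\<in>{..<s}. \<lambda>j\<in>{..<n}. u (\<sigma> j k) j)"

text \<open>This is 0 unless every column of the filling is a permutation of the n letters, and then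
  the product of the signs of the columns.\<close>

definition filling_sign :: "nat \<Rightarrow> nat \<Rightarrow> (nat \<Rightarrow> nat \<Rightarrow> nat) \<Rightarrow> int" where
  "filling_sign n s u = (\<Prod>k<s. det (mat n n (\<lambda>(i, j). of_bool (u k j = i))))"

definition row_symmetrized_sign :: "nat \<Rightarrow> nat \<Rightarrow> (nat \<Rightarrow> nat \<Rightarrow> nat) \<Rightarrow> int" where
  "row_symmetrized_sign n s u = (\<Sum>\<sigma>\<in>perm_families n s. filling_sign n s (permute_rows n s \<sigma> u))"

text \<open>This number appears as the factor of the product of determinants once the polarized
  power has been symmetrized over rows and alternated over columns, as with a Young symmetrizer of
  rectangular shape.\<close>

definition polarization_const :: "nat \<Rightarrow> nat \<Rightarrow> int" where
  "polarization_const n s = (\<Sum>u\<in>fillings n s. row_symmetrized_sign n s u * filling_sign n s u)"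

lemma finite_perm_families: "finite (perm_families n s)"
  unfolding perm_families_def by (intro finite_PiE) (auto intro: finite_permutations)

lemma finite_fillings: "finite (fillings n s)"
  unfolding fillings_def by (intro finite_PiE) auto

lemma perm_familiesD: "\<sigma> \<in> perm_families n s \<Longrightarrow> j < n \<Longrightarrow> \<sigma> j permutes {..<s}"
  by (auto simp: perm_families_def)

lemma perm_families_less: "\<sigma> \<in> perm_families n s \<Longrightarrow> j < n \<Longrightarrow> k < s \<Longrightarrow> \<sigma> j k < s"
  using permutes_in_image[OF perm_familiesD, of \<sigma> n s j k] by simp

lemma permute_rows_in_fillings:
  assumes "\<And>j. j < n \<Longrightarrow> \<sigma> j permutes {..<s}" "u \<in> fillings n s"
  shows "permute_rows n s \<sigma> u \<in> fillings n s"
proof -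
  have "u (\<sigma> j k) j < n" if "k < s" "j < n" for k j
    using permutes_in_image[OF assms(1)[OF that(2)], of k] assms(2) that by (auto simp: fillings_def PiE_iff)
  then show ?thesis by (simp add: permute_rows_def fillings_def)
qed

lemma fillings_eqI:
  assumes "u \<in> fillings n s" "u' \<in> fillings n s"
    and "\<And>k j. k < s \<Longrightarrow> j < n \<Longrightarrow> u k j = u' k j"
  shows "u = u'"
proof (rule PiE_ext[OF assms(1,2)[unfolded fillings_def]])
  fix k assume k: "k \<in> {..<s}"
  show "u k = u' k"
  proof (rule PiE_ext[of _ "{..<n}" "\<lambda>_. {..<n}"])
    show "u k \<in> {..<n} \<rightarrow>\<^sub>E {..<n}" "u' k \<in> {..<n} \<rightarrow>\<^sub>E {..<n}"
      using assms(1,2) k unfolding fillings_def by (blast dest: PiE_mem)+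
  qed (use k assms(3) in auto)
qed

lemma sum_fillings_permute_rows:
  assumes "\<sigma> \<in> perm_families n s"
  shows "(\<Sum>u\<in>fillings n s. F (permute_rows n s \<sigma> u)) = (\<Sum>u\<in>fillings n s. F u)"
proof (rule sum.reindex_bij_witness[of _ "permute_rows n s (\<lambda>j. inv_into UNIV (\<sigma> j))" "permute_rows n s \<sigma>"])
  have \<sigma>: "\<sigma> j permutes {..<s}" if "j < n" for j using perm_familiesD[OF assms that] .
  have inv: "inv_into UNIV (\<sigma> j) permutes {..<s}" if "j < n" for j using permutes_inv[OF \<sigma>[OF that]] .
  have less: "\<sigma> j k < s" "inv_into UNIV (\<sigma> j) k < s" if "j < n" "k < s" for j k
    using permutes_in_image[OF \<sigma>[OF that(1)], of k] permutes_in_image[OF inv[OF that(1)], of k] that by simp_all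
  show "permute_rows n s \<sigma> u \<in> fillings n s" if "u \<in> fillings n s" for u
    by (rule permute_rows_in_fillings[OF \<sigma> that])
  show "permute_rows n s (\<lambda>j. inv_into UNIV (\<sigma> j)) u \<in> fillings n s" if "u \<in> fillings n s" for u
    by (rule permute_rows_in_fillings[OF inv that])
  show "permute_rows n s (\<lambda>j. inv_into UNIV (\<sigma> j)) (permute_rows n s \<sigma> u) = u" if "u \<in> fillings n s" for u
  proof (rule fillings_eqI[of _ n s])
    show "permute_rows n s (\<lambda>j. inv_into UNIV (\<sigma> j)) (permute_rows n s \<sigma> u) \<in> fillings n s"
      by (intro permute_rows_in_fillings \<sigma> inv that)
  qed (use that less permutes_inverses[OF \<sigma>] in \<open>simp_all add: permute_rows_def\<close>)
  show "permute_rows n s \<sigma> (permute_rows n s (\<lambda>j. inv_into UNIV (\<sigma> j)) u) = u" if "u \<in> fillings n s" for u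
  proof (rule fillings_eqI[of _ n s])
    show "permute_rows n s \<sigma> (permute_rows n s (\<lambda>j. inv_into UNIV (\<sigma> j)) u) \<in> fillings n s"
      by (intro permute_rows_in_fillings \<sigma> inv that)
  qed (use that less permutes_inverses[OF \<sigma>] in \<open>simp_all add: permute_rows_def\<close>)
qed simp

lemma row_symmetrized_sign_permute_rows:
  assumes \<sigma>: "\<sigma> \<in> perm_families n s"
  shows "row_symmetrized_sign n s (permute_rows n s \<sigma> u) = row_symmetrized_sign n s u"
  unfolding row_symmetrized_sign_def
proof (rule sum.reindex_bij_witness[of _ "\<lambda>\<tau>. \<lambda>j\<in>{..<n}. inv_into UNIV (\<sigma> j) \<circ> \<tau> j" "\<lambda>\<tau>. \<lambda>j\<in>{..<n}. \<sigma> j \<circ> \<tau> j"])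
  have p: "\<sigma> j permutes {..<s}" if "j < n" for j using perm_familiesD[OF \<sigma> that] .
  fix \<tau> assume \<tau>: "\<tau> \<in> perm_families n s"
  show "(\<lambda>j\<in>{..<n}. \<sigma> j \<circ> \<tau> j) \<in> perm_families n s"
    using perm_familiesD[OF \<tau>] p by (auto simp: perm_families_def intro: permutes_compose)
  show "(\<lambda>j\<in>{..<n}. inv_into UNIV (\<sigma> j) \<circ> \<tau> j) \<in> perm_families n s"
    using perm_familiesD[OF \<tau>] p by (auto simp: perm_families_def intro: permutes_compose permutes_inv)
  show "(\<lambda>j\<in>{..<n}. inv_into UNIV (\<sigma> j) \<circ> (\<lambda>j\<in>{..<n}. \<sigma> j \<circ> \<tau> j) j) = \<tau>"
    by (rule extensionalityI[of _ "{..<n}"])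
       (use \<tau> permutes_inv_o(2)[OF p] in \<open>simp_all add: perm_families_def PiE_iff o_assoc\<close>)
  show "(\<lambda>j\<in>{..<n}. \<sigma> j \<circ> (\<lambda>j\<in>{..<n}. inv_into UNIV (\<sigma> j) \<circ> \<tau> j) j) = \<tau>"
    by (rule extensionalityI[of _ "{..<n}"])
       (use \<tau> permutes_inv_o(1)[OF p] in \<open>simp_all add: perm_families_def PiE_iff o_assoc\<close>)
  show "filling_sign n s (permute_rows n s (\<lambda>j\<in>{..<n}. \<sigma> j \<circ> \<tau> j) u) =
      filling_sign n s (permute_rows n s \<tau> (permute_rows n s \<sigma> u))"
    unfolding filling_sign_def permute_rows_def using perm_families_less[OF \<tau>]
    by (intro prod.cong refl arg_cong[of _ _ det] eq_matI) auto
qed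

text \<open>Averaging over the row permutations turns the constant into a sum of squares.\<close>

lemma polarization_const_pos: "polarization_const n s > 0"
proof -
  let ?G = "perm_families n s" and ?U = "fillings n s"
  let ?R = "row_symmetrized_sign n s" and ?B = "filling_sign n s"
  \<comment> \<open>Each row of this filling is constant, so it is fixed by all row permutations,
    and each of its columns is the identity. Its symmetrized sign is therefore the order of the row
    group.\<close>
  define u0 :: "nat \<Rightarrow> nat \<Rightarrow> nat" where "u0 = (\<lambda>k\<in>{..<s}. \<lambda>j\<in>{..<n}. j)"
  have id: "(\<lambda>j\<in>{..<n}. id) \<in> ?G" by (auto simp: perm_families_def permutes_id)
  then have G: "card ?G > 0" using finite_perm_families[of n s] by (auto simp: card_gt_0_iff)
  have "of_nat (card ?G) * polarization_const n s = (\<Sum>\<sigma>\<in>?G. \<Sum>u\<in>?U. ?R u * ?B (permute_rows n s \<sigma> u))"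
  proof -
    have "polarization_const n s = (\<Sum>u\<in>?U. ?R u * ?B (permute_rows n s \<sigma> u))" if "\<sigma> \<in> ?G" for \<sigma>
      using sum_fillings_permute_rows[OF that, where F = "\<lambda>u. ?R u * ?B u"]
      by (simp add: polarization_const_def row_symmetrized_sign_permute_rows[OF that])
    from sum.cong[OF refl this, of ?G] show ?thesis by simp
  qed
  also have "\<dots> = (\<Sum>u\<in>?U. ?R u * ?R u)"
    by (subst sum.swap) (simp add: row_symmetrized_sign_def sum_distrib_left)
  also have "\<dots> > 0"
  proof (rule sum_pos2[of _ u0])
    show "u0 \<in> ?U" by (auto simp: u0_def fillings_def)
    have "?B (permute_rows n s \<sigma> u0) = 1" if "\<sigma> \<in> ?G" for \<sigma>
    proof -
      have "mat n n (\<lambda>(i, j). of_bool (permute_rows n s \<sigma> u0 k j = i)) = (1\<^sub>m n :: int mat)" if "k < s" for k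
        using perm_families_less[OF \<open>\<sigma> \<in> ?G\<close> _ that] that by (intro eq_matI) (auto simp: permute_rows_def u0_def)
      then show ?thesis by (simp add: filling_sign_def)
    qed
    then have "?R u0 = of_nat (card ?G)" by (simp add: row_symmetrized_sign_def)
    then show "0 < ?R u0 * ?R u0" using G by simp
  qed (simp_all add: finite_fillings)
  finally show ?thesis using G by (simp add: zero_less_mult_iff)
qed

text \<open>Polarization of the \<open>s\<close>-th power of the determinant: the part that is linear in each of the
  vectors \<open>w k j\<close> is extracted by inclusion and exclusion, which avoids dividing by factorials.\<close>

lemma polarized_det_power_in_ideal:
  fixes X :: "'a::comm_ring_1 set"
  assumes X: "is_ideal X" and V0: "(\<lambda>_. 0) \<in> V"
    and V: "\<And>x y. x \<in> V \<Longrightarrow> y \<in> V \<Longrightarrow> (\<lambda>i. x i + y i) \<in> V"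
    and pow: "\<And>y. (\<And>j. j < n \<Longrightarrow> y j \<in> V) \<Longrightarrow> det (mat n n (\<lambda>(i, j). y j i)) ^ s \<in> X"
    and w: "\<And>k j. k < s \<Longrightarrow> j < n \<Longrightarrow> w k j \<in> V"
  shows "(\<Sum>\<sigma>\<in>perm_families n s. \<Prod>l<s. det (mat n n (\<lambda>(i, j). w (\<sigma> j l) j i))) \<in> X"
proof -
  let ?A = "{..<n} \<times> {..<s}" and ?K = "Pi\<^sub>E {..<n} (\<lambda>_. {..<s})"
  let ?\<T> = "Pi\<^sub>E {..<s} (\<lambda>_. ?K)"
  \<comment> \<open>The pairs (j, k) for which the vector \<open>w k j\<close> occurs in the term
    indexed by \<tau>.\<close>
  define gr where "gr \<tau> = (\<lambda>(j, l). (j, \<tau> l j)) ` ?A" for \<tau> :: "nat \<Rightarrow> nat \<Rightarrow> nat"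
  define D where "D \<tau> = (\<Prod>l<s. det (mat n n (\<lambda>(i, j). w (\<tau> l j) j i)))" for \<tau>
  \<comment> \<open>Column j is the sum of the vectors \<open>w k j\<close> over k, without those
    marked by S. In the alternating sum over S, a term survives only if it uses all n * s
    vectors.\<close>
  define y where "y S j = (\<lambda>i. \<Sum>k<s. of_bool ((j, k) \<notin> S) * w k j i)" for S j
  have fin\<T>: "finite ?\<T>" by (intro finite_PiE) auto
  have "y S j \<in> V" if "j < n" for S j
  proof -
    have "(\<lambda>i. \<Sum>k<t. of_bool ((j, k) \<notin> S) * w k j i) \<in> V" if "t \<le> s" for t
      using that
    proof (induction t)
      case (Suc t)
      have "(\<lambda>i. of_bool ((j, t) \<notin> S) * w t j i) \<in> V"
        using w[of t j] V0 Suc.prems \<open>j < n\<close> by (cases "(j, t) \<in> S") auto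
      then show ?case using V Suc by simp
    qed (use V0 in simp)
    then show ?thesis by (simp add: y_def)
  qed
  then have "(\<Sum>S\<in>Pow ?A. (-1) ^ card S * det (mat n n (\<lambda>(i, j). y S j i)) ^ s) \<in> X"
    by (intro is_ideal_sum[OF X] is_ideal_mult_left[OF X] pow)
  moreover have "det (mat n n (\<lambda>(i, j). y S j i)) ^ s = (\<Sum>\<tau>\<in>?\<T>. of_bool (S \<inter> gr \<tau> = {}) * D \<tau>)" for S
  proof -
    have "det (mat n n (\<lambda>(i, j). y S j i)) =
        (\<Sum>\<kappa>\<in>?K. (\<Prod>j<n. of_bool ((j, \<kappa> j) \<notin> S)) * det (mat n n (\<lambda>(i, j). w (\<kappa> j) j i)))"
      unfolding y_def by (rule det_sum_cols) simp
    then have "det (mat n n (\<lambda>(i, j). y S j i)) ^ s =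
        (\<Prod>l<s. \<Sum>\<kappa>\<in>?K. (\<Prod>j<n. of_bool ((j, \<kappa> j) \<notin> S)) * det (mat n n (\<lambda>(i, j). w (\<kappa> j) j i)))"
      by simp
    also have "\<dots> = (\<Sum>\<tau>\<in>?\<T>. \<Prod>l<s. (\<Prod>j<n. of_bool ((j, \<tau> l j) \<notin> S)) * det (mat n n (\<lambda>(i, j). w (\<tau> l j) j i)))"
      by (rule prod_sum_PiE) (auto intro: finite_PiE)
    also have "\<dots> = (\<Sum>\<tau>\<in>?\<T>. of_bool (S \<inter> gr \<tau> = {}) * D \<tau>)"
    proof (intro sum.cong refl)
      fix \<tau>
      have "(\<Prod>l<s. \<Prod>j<n. of_bool ((j, \<tau> l j) \<notin> S) :: 'a) = of_bool (S \<inter> gr \<tau> = {})"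
      proof (cases "S \<inter> gr \<tau> = {}")
        case True
        then have "(j, \<tau> l j) \<notin> S" if "j < n" "l < s" for j l using that by (auto simp: gr_def)
        then show ?thesis using True by simp
      next
        case False
        then obtain j l where jl: "j < n" "l < s" "(j, \<tau> l j) \<in> S" by (auto simp: gr_def)
        then have "(\<Prod>j<n. of_bool ((j, \<tau> l j) \<notin> S) :: 'a) = 0" by (intro prod_zero) auto
        then have "(\<Prod>l<s. \<Prod>j<n. of_bool ((j, \<tau> l j) \<notin> S) :: 'a) = 0" using jl by (intro prod_zero) auto
        then show ?thesis using False by simp
      qed
      then show "(\<Prod>l<s. (\<Prod>j<n. of_bool ((j, \<tau> l j) \<notin> S)) * det (mat n n (\<lambda>(i, j). w (\<tau> l j) j i))) =
          of_bool (S \<inter> gr \<tau> = {}) * D \<tau>"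
        by (simp add: prod.distrib D_def)
    qed
    finally show ?thesis .
  qed
  ultimately have "(\<Sum>S\<in>Pow ?A. (-1) ^ card S * (\<Sum>\<tau>\<in>?\<T>. of_bool (S \<inter> gr \<tau> = {}) * D \<tau>)) \<in> X"
    by simp
  also have "(\<Sum>S\<in>Pow ?A. (-1) ^ card S * (\<Sum>\<tau>\<in>?\<T>. of_bool (S \<inter> gr \<tau> = {}) * D \<tau>)) =
      (\<Sum>\<tau>\<in>?\<T>. (\<Sum>S\<in>Pow ?A. (-1) ^ card S * of_bool (S \<inter> gr \<tau> = {})) * D \<tau>)"
    by (simp only: sum_distrib_left sum_distrib_right mult.assoc) (rule sum.swap)
  also have "\<dots> = (\<Sum>\<tau>\<in>?\<T>. of_bool (?A \<subseteq> gr \<tau>) * D \<tau>)"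
  proof (intro sum.cong refl arg_cong2[of _ _ _ _ "(*)"])
    fix \<tau> assume "\<tau> \<in> ?\<T>"
    have "(\<Sum>S\<in>Pow ?A. (-1) ^ card S * of_bool (S \<inter> gr \<tau> = {}) :: 'a) = (\<Sum>S\<in>Pow (?A - gr \<tau>). (-1) ^ card S)"
      by (intro sum.mono_neutral_cong_right) auto
    also have "\<dots> = of_bool (?A \<subseteq> gr \<tau>)" by (subst sum_Pow_alternating) auto
    finally show "(\<Sum>S\<in>Pow ?A. (-1) ^ card S * of_bool (S \<inter> gr \<tau> = {}) :: 'a) = of_bool (?A \<subseteq> gr \<tau>)" .
  qed
  also have "\<dots> = (\<Sum>\<tau>\<in>{\<tau> \<in> ?\<T>. ?A \<subseteq> gr \<tau>}. D \<tau>)"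
    using fin\<T> by (intro sum.mono_neutral_cong_right) auto
  \<comment> \<open>In a surviving term each row uses all s vectors with s factors, so the choice in
    the row is a surjection of a finite set onto itself, hence a permutation.\<close>
  also have "\<dots> = (\<Sum>\<sigma>\<in>perm_families n s. \<Prod>l<s. det (mat n n (\<lambda>(i, j). w (\<sigma> j l) j i)))"
  proof (rule sum.reindex_bij_witness[of _ "\<lambda>\<sigma>. \<lambda>l\<in>{..<s}. \<lambda>j\<in>{..<n}. \<sigma> j l"
        "\<lambda>\<tau>. \<lambda>j\<in>{..<n}. \<lambda>l. if l < s then \<tau> l j else l"])
    fix \<tau> assume "\<tau> \<in> {\<tau> \<in> ?\<T>. ?A \<subseteq> gr \<tau>}"
    then have \<tau>: "\<tau> \<in> ?\<T>" and gr: "?A \<subseteq> gr \<tau>" by auto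
    have \<tau>_less: "\<tau> l j < s" if "l < s" "j < n" for l j using \<tau> that by (auto simp: PiE_iff)
    show "(\<lambda>l\<in>{..<s}. \<lambda>j\<in>{..<n}. (\<lambda>j\<in>{..<n}. \<lambda>l. if l < s then \<tau> l j else l) j l) = \<tau>"
    proof (rule extensionalityI[of _ "{..<s}"])
      fix l assume l: "l \<in> {..<s}"
      show "(\<lambda>l\<in>{..<s}. \<lambda>j\<in>{..<n}. (\<lambda>j\<in>{..<n}. \<lambda>l. if l < s then \<tau> l j else l) j l) l = \<tau> l"
        by (rule extensionalityI[of _ "{..<n}"]) (use \<tau> l in \<open>simp_all add: PiE_iff\<close>)
    qed (use \<tau> in \<open>simp_all add: PiE_iff\<close>)
    show "(\<lambda>j\<in>{..<n}. \<lambda>l. if l < s then \<tau> l j else l) \<in> perm_families n s"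
      unfolding perm_families_def
    proof (rule restrict_PiE_iff[THEN iffD2], intro ballI CollectI)
      fix j assume j: "j \<in> {..<n}"
      let ?f = "\<lambda>l. if l < s then \<tau> l j else l"
      have surj: "{..<s} \<subseteq> ?f ` {..<s}"
      proof
        fix k assume "k \<in> {..<s}"
        then have "(j, k) \<in> gr \<tau>" using gr j by blast
        then show "k \<in> ?f ` {..<s}" by (auto simp: gr_def)
      qed
      have "?f ` {..<s} = {..<s}" using surj \<tau>_less j by auto
      then have "bij_betw ?f {..<s} {..<s}"
        by (simp add: bij_betw_def eq_card_imp_inj_on)
      then show "?f permutes {..<s}" by (intro bij_imp_permutes) auto
    qed
    show "(\<Prod>l<s. det (mat n n (\<lambda>(i, j). w ((\<lambda>j\<in>{..<n}. \<lambda>l. if l < s then \<tau> l j else l) j l) j i))) = D \<tau>"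
      unfolding D_def by (intro prod.cong refl arg_cong[of _ _ det] eq_matI) auto
  next
    fix \<sigma> assume \<sigma>: "\<sigma> \<in> perm_families n s"
    show "(\<lambda>j\<in>{..<n}. \<lambda>l. if l < s then (\<lambda>l\<in>{..<s}. \<lambda>j\<in>{..<n}. \<sigma> j l) l j else l) = \<sigma>"
    proof (rule extensionalityI[of _ "{..<n}"])
      fix j assume j: "j \<in> {..<n}"
      show "(\<lambda>j\<in>{..<n}. \<lambda>l. if l < s then (\<lambda>l\<in>{..<s}. \<lambda>j\<in>{..<n}. \<sigma> j l) l j else l) j = \<sigma> j"
        using j permutes_not_in[OF perm_familiesD[OF \<sigma>, of j]] by auto
    qed (use \<sigma> in \<open>simp_all add: perm_families_def PiE_iff\<close>)
    have "?A \<subseteq> gr (\<lambda>l\<in>{..<s}. \<lambda>j\<in>{..<n}. \<sigma> j l)"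
    proof
      fix x assume "x \<in> ?A"
      then obtain j k where x: "x = (j, k)" and jk: "j < n" "k < s" by auto
      then obtain l where "l < s" "k = \<sigma> j l"
        using permutes_image[OF perm_familiesD[OF \<sigma>, of j]] by (metis imageE lessThan_iff)
      then show "x \<in> gr (\<lambda>l\<in>{..<s}. \<lambda>j\<in>{..<n}. \<sigma> j l)"
        unfolding gr_def using x jk by (intro image_eqI[of _ _ "(j, l)"]) auto
    qed
    then show "(\<lambda>l\<in>{..<s}. \<lambda>j\<in>{..<n}. \<sigma> j l) \<in> {\<tau> \<in> ?\<T>. ?A \<subseteq> gr \<tau>}"
      using perm_families_less[OF \<sigma>] by auto
  qed
  finally show ?thesis .
qed

text \<open>The polarized sum mixes the vectors of different factors. Alternating, for each k, over
  the permutations of the vectors \<open>w k 0\<close>, ..., \<open>w k (n - 1)\<close> collapses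
  every mixed product to an integer multiple of the wanted one. In coordinates u, the sum over row
  permutations yields \<open>row_symmetrized_sign\<close> of u, and the alternation yields the
  product of determinants times \<open>filling_sign\<close> of u.\<close>

lemma polarization:
  fixes X :: "'a::comm_ring_1 set"
  assumes X: "is_ideal X" and V0: "(\<lambda>_. 0) \<in> V"
    and V: "\<And>x y. x \<in> V \<Longrightarrow> y \<in> V \<Longrightarrow> (\<lambda>i. x i + y i) \<in> V"
    and pow: "\<And>y. (\<And>j. j < n \<Longrightarrow> y j \<in> V) \<Longrightarrow> det (mat n n (\<lambda>(i, j). y j i)) ^ s \<in> X"
    and w: "\<And>k j. k < s \<Longrightarrow> j < n \<Longrightarrow> w k j \<in> V"
  shows "of_int (polarization_const n s) * (\<Prod>k<s. det (mat n n (\<lambda>(i, j). w k j i))) \<in> X"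
proof -
  let ?G = "perm_families n s" and ?U = "fillings n s" and ?T = "perm_families s n"
  let ?B = "filling_sign n s"
  let ?sgn = "\<lambda>\<tau>. \<Prod>k<s. (signof (\<tau> k) :: 'a)"
  have "(\<Sum>\<tau>\<in>?T. ?sgn \<tau> * (\<Sum>\<sigma>\<in>?G. \<Prod>l<s. det (mat n n (\<lambda>(i, j). w (\<sigma> j l) (\<tau> (\<sigma> j l) j) i)))) \<in> X"
  proof (rule is_ideal_sum[OF X], rule is_ideal_mult_left[OF X])
    fix \<tau> assume \<tau>: "\<tau> \<in> ?T"
    show "(\<Sum>\<sigma>\<in>?G. \<Prod>l<s. det (mat n n (\<lambda>(i, j). w (\<sigma> j l) (\<tau> (\<sigma> j l) j) i))) \<in> X"
      by (rule polarized_det_power_in_ideal[OF X V0 V pow, where w = "\<lambda>k j. w k (\<tau> k j)"])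
         (use w perm_families_less[OF \<tau>] in auto)
  qed
  also have "(\<Sum>\<tau>\<in>?T. ?sgn \<tau> * (\<Sum>\<sigma>\<in>?G. \<Prod>l<s. det (mat n n (\<lambda>(i, j). w (\<sigma> j l) (\<tau> (\<sigma> j l) j) i)))) =
      (\<Sum>\<tau>\<in>?T. ?sgn \<tau> * (\<Sum>\<sigma>\<in>?G. \<Sum>u\<in>?U. (\<Prod>k<s. \<Prod>j<n. w k (\<tau> k j) (u k j)) *
        of_int (?B (permute_rows n s \<sigma> u))))"
  proof (intro sum.cong refl arg_cong2[of _ _ _ _ "(*)"])
    fix \<tau> \<sigma> assume \<tau>: "\<tau> \<in> ?T" and \<sigma>: "\<sigma> \<in> ?G"
    let ?F = "\<lambda>u. (\<Prod>l<s. (\<Prod>j<n. w (\<sigma> j l) (\<tau> (\<sigma> j l) j) (u l j))) * of_int (?B u)"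
    have "(\<Prod>l<s. det (mat n n (\<lambda>(i, j). w (\<sigma> j l) (\<tau> (\<sigma> j l) j) i))) =
      (\<Prod>l<s. \<Sum>u\<in>Pi\<^sub>E {..<n} (\<lambda>_. {..<n}). (\<Prod>j<n. w (\<sigma> j l) (\<tau> (\<sigma> j l) j) (u j)) *
         of_int (det (mat n n (\<lambda>(i, j). of_bool (u j = i)))))"
      by (intro prod.cong refl det_coordinate_expansion)
    also have "\<dots> = (\<Sum>u\<in>?U. \<Prod>l<s. (\<Prod>j<n. w (\<sigma> j l) (\<tau> (\<sigma> j l) j) (u l j)) *
         of_int (det (mat n n (\<lambda>(i, j). of_bool (u l j = i)))))"
      unfolding fillings_def by (rule prod_sum_PiE) (auto intro: finite_PiE)
    also have "\<dots> = (\<Sum>u\<in>?U. ?F u)"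
      by (simp only: prod.distrib filling_sign_def of_int_prod)
    \<comment> \<open>Moving \<sigma> from the vectors to the coordinates u makes the monomial in
      the vectors independent of \<sigma>; only the sign still depends on it.\<close>
    also have "\<dots> = (\<Sum>u\<in>?U. ?F (permute_rows n s \<sigma> u))"
      by (rule sum_fillings_permute_rows[OF \<sigma>, symmetric])
    also have "\<dots> = (\<Sum>u\<in>?U. (\<Prod>k<s. \<Prod>j<n. w k (\<tau> k j) (u k j)) * of_int (?B (permute_rows n s \<sigma> u)))"
    proof (intro sum.cong refl arg_cong2[of _ _ _ _ "(*)"])
      fix u
      have "(\<Prod>l<s. \<Prod>j<n. w (\<sigma> j l) (\<tau> (\<sigma> j l) j) (permute_rows n s \<sigma> u l j)) =
          (\<Prod>j<n. \<Prod>l<s. w (\<sigma> j l) (\<tau> (\<sigma> j l) j) (u (\<sigma> j l) j))"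
        by (subst prod.swap) (simp add: permute_rows_def)
      also have "\<dots> = (\<Prod>j<n. \<Prod>k<s. w k (\<tau> k j) (u k j))"
      proof (rule prod.cong[OF refl])
        fix j assume "j \<in> {..<n}"
        then show "(\<Prod>l<s. w (\<sigma> j l) (\<tau> (\<sigma> j l) j) (u (\<sigma> j l) j)) = (\<Prod>k<s. w k (\<tau> k j) (u k j))"
          using prod.permute[OF perm_familiesD[OF \<sigma>, of j], of "\<lambda>k. w k (\<tau> k j) (u k j)"]
          by (simp add: comp_def)
      qed
      also have "\<dots> = (\<Prod>k<s. \<Prod>j<n. w k (\<tau> k j) (u k j))" by (rule prod.swap)
      finally show "(\<Prod>l<s. \<Prod>j<n. w (\<sigma> j l) (\<tau> (\<sigma> j l) j) (permute_rows n s \<sigma> u l j)) =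
          (\<Prod>k<s. \<Prod>j<n. w k (\<tau> k j) (u k j))" .
    qed
    finally show "(\<Prod>l<s. det (mat n n (\<lambda>(i, j). w (\<sigma> j l) (\<tau> (\<sigma> j l) j) i))) =
      (\<Sum>u\<in>?U. (\<Prod>k<s. \<Prod>j<n. w k (\<tau> k j) (u k j)) * of_int (?B (permute_rows n s \<sigma> u)))" .
  qed
  also have "\<dots> = (\<Sum>\<tau>\<in>?T. \<Sum>u\<in>?U. ?sgn \<tau> * (\<Prod>k<s. \<Prod>j<n. w k (\<tau> k j) (u k j)) *
      of_int (row_symmetrized_sign n s u))"
  proof (intro sum.cong refl)
    fix \<tau>
    have "(\<Sum>\<sigma>\<in>?G. \<Sum>u\<in>?U. (\<Prod>k<s. \<Prod>j<n. w k (\<tau> k j) (u k j)) * (of_int (?B (permute_rows n s \<sigma> u)) :: 'a)) =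
        (\<Sum>u\<in>?U. (\<Prod>k<s. \<Prod>j<n. w k (\<tau> k j) (u k j)) * of_int (row_symmetrized_sign n s u))"
      by (subst sum.swap) (simp add: row_symmetrized_sign_def sum_distrib_left)
    then show "?sgn \<tau> * (\<Sum>\<sigma>\<in>?G. \<Sum>u\<in>?U. (\<Prod>k<s. \<Prod>j<n. w k (\<tau> k j) (u k j)) *
          of_int (?B (permute_rows n s \<sigma> u))) =
        (\<Sum>u\<in>?U. ?sgn \<tau> * (\<Prod>k<s. \<Prod>j<n. w k (\<tau> k j) (u k j)) * of_int (row_symmetrized_sign n s u))"
      by (simp only: sum_distrib_left mult.assoc)
  qed
  also have "\<dots> = (\<Sum>u\<in>?U. (\<Sum>\<tau>\<in>?T. \<Prod>k<s. signof (\<tau> k) * (\<Prod>j<n. w k (\<tau> k j) (u k j))) *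
      of_int (row_symmetrized_sign n s u))"
    by (subst sum.swap) (simp only: sum_distrib_right prod.distrib)
  also have "\<dots> = (\<Sum>u\<in>?U. ((\<Prod>k<s. det (mat n n (\<lambda>(i, j). w k j i))) * of_int (?B u)) *
      of_int (row_symmetrized_sign n s u))"
  proof (intro sum.cong refl arg_cong2[of _ _ _ _ "(*)"])
    fix u assume u: "u \<in> ?U"
    have "(\<Sum>\<tau>\<in>?T. \<Prod>k<s. signof (\<tau> k) * (\<Prod>j<n. w k (\<tau> k j) (u k j))) =
        (\<Prod>k<s. \<Sum>p | p permutes {..<n}. signof p * (\<Prod>j<n. w k (p j) (u k j)))"
      unfolding perm_families_def by (rule prod_sum_PiE[symmetric]) (auto intro: finite_permutations)
    also have "\<dots> = (\<Prod>k<s. det (mat n n (\<lambda>(i, j). w k j i)) * of_int (det (mat n n (\<lambda>(i, j). of_bool (u k j = i)))))"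
    proof (intro prod.cong refl)
      fix k assume k: "k \<in> {..<s}"
      have less: "u k j < n" if "j < n" for j using u k that by (auto simp: fillings_def PiE_iff)
      have plt: "p j < n" if "p permutes {0..<n}" "j < n" for p j
        using permutes_in_image[OF that(1), of j] that(2) by simp
      have "(\<Sum>p | p permutes {..<n}. signof p * (\<Prod>j<n. w k (p j) (u k j))) =
          det (mat n n (\<lambda>(i, j). w k i (u k j)))"
        by (subst det_col[of _ n]) (auto simp: lessThan_atLeast0 plt intro!: sum.cong prod.cong)
      also have "\<dots> = det (mat n n (\<lambda>(i, j). w k i j)) * of_int (det (mat n n (\<lambda>(i, j). of_bool (u k j = i))))"
        by (rule det_cols_reindex[where y = "\<lambda>j i. w k i j"]) (rule less)
      \<comment> \<open>The alternation permutes the vectors, not the coordinates, so the vectors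
        first appear as the rows of the matrix.\<close>
      also have "det (mat n n (\<lambda>(i, j). w k i j)) = det (transpose_mat (mat n n (\<lambda>(i, j). w k i j)))"
        by (rule det_transpose[of _ n, symmetric]) simp
      also have "transpose_mat (mat n n (\<lambda>(i, j). w k i j)) = mat n n (\<lambda>(i, j). w k j i)"
        by (intro eq_matI) auto
      finally show "(\<Sum>p | p permutes {..<n}. signof p * (\<Prod>j<n. w k (p j) (u k j))) =
          det (mat n n (\<lambda>(i, j). w k j i)) * of_int (det (mat n n (\<lambda>(i, j). of_bool (u k j = i))))" .
    qed
    also have "\<dots> = (\<Prod>k<s. det (mat n n (\<lambda>(i, j). w k j i))) * of_int (?B u)"
      by (simp only: prod.distrib filling_sign_def of_int_prod)
    finally show "(\<Sum>\<tau>\<in>?T. \<Prod>k<s. signof (\<tau> k) * (\<Prod>j<n. w k (\<tau> k j) (u k j))) =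
        (\<Prod>k<s. det (mat n n (\<lambda>(i, j). w k j i))) * of_int (?B u)" .
  qed
  also have "\<dots> = of_int (polarization_const n s) * (\<Prod>k<s. det (mat n n (\<lambda>(i, j). w k j i)))"
    unfolding polarization_const_def of_int_sum of_int_mult sum_distrib_right
    by (intro sum.cong refl) (simp only: mult_ac)
  finally show ?thesis .
qed

section \<open>Integral closure\<close>

lemma ideal_gen_ideal: "is_ideal J \<Longrightarrow> ideal_gen J = J"
  using ideal_gen_minimal[of J J] ideal_gen_superset[of _ J] by blast

lemma ideal_gen_mono: "S \<subseteq> T \<Longrightarrow> ideal_gen S \<subseteq> ideal_gen T"
  by (intro ideal_gen_minimal is_ideal_ideal_gen) (auto intro: ideal_gen_superset)

lemma prod_in_ideal_power_card:
  "finite A \<Longrightarrow> (\<And>a. a \<in> A \<Longrightarrow> f a \<in> I) \<Longrightarrow> prod f A \<in> ideal_power I (card A)"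
  by (induction A rule: finite_induct) (auto intro: ideal_multI)

lemma power_in_ideal_power: "x \<in> I \<Longrightarrow> x ^ k \<in> ideal_power I k"
  by (induction k) (auto intro: ideal_multI)

lemma ideal_power_ideal_gen:
  "ideal_power (ideal_gen S) s = ideal_gen ((\<lambda>f. \<Prod>k<s. f k) ` Pi\<^sub>E {..<s} (\<lambda>_. S))"
proof
  show "ideal_power (ideal_gen S) s \<subseteq> ideal_gen ((\<lambda>f. \<Prod>k<s. f k) ` Pi\<^sub>E {..<s} (\<lambda>_. S))"
  proof (intro ideal_power_ideal_gen_minimal is_ideal_ideal_gen ideal_gen_superset)
    fix f assume f: "\<And>k. k < s \<Longrightarrow> f k \<in> S"
    have "(\<Prod>k<s. f k) = (\<Prod>k<s. restrict f {..<s} k)" by simp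
    then show "(\<Prod>k<s. f k) \<in> (\<lambda>f. \<Prod>k<s. f k) ` Pi\<^sub>E {..<s} (\<lambda>_. S)"
      using f by (intro image_eqI[of _ _ "restrict f {..<s}"]) auto
  qed
  show "ideal_gen ((\<lambda>f. \<Prod>k<s. f k) ` Pi\<^sub>E {..<s} (\<lambda>_. S)) \<subseteq> ideal_power (ideal_gen S) s"
    by (intro ideal_gen_minimal is_ideal_ideal_power)
       (auto intro!: prod_in_ideal_power ideal_gen_superset)
qed

lemma ideal_mult_ideal_gen:
  "ideal_mult (ideal_gen S) (ideal_gen T) = ideal_gen {x * y | x y. x \<in> S \<and> y \<in> T}"
proof
  show "ideal_mult (ideal_gen S) (ideal_gen T) \<subseteq> ideal_gen {x * y | x y. x \<in> S \<and> y \<in> T}"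
    by (intro ideal_mult_ideal_gen_minimal is_ideal_ideal_gen ideal_gen_superset) auto
  show "ideal_gen {x * y | x y. x \<in> S \<and> y \<in> T} \<subseteq> ideal_mult (ideal_gen S) (ideal_gen T)"
    by (intro ideal_gen_minimal is_ideal_ideal_mult) (auto intro!: ideal_multI ideal_gen_superset)
qed

lemma is_ideal_combinations:
  assumes K: "\<And>i. i \<in> S \<Longrightarrow> is_ideal (K i)"
  shows "is_ideal {y. \<exists>c. (\<forall>i\<in>S. c i \<in> K i) \<and> y = (\<Sum>i\<in>S. c i * b i)}" (is "is_ideal ?K")
  unfolding is_ideal_def
proof (intro conjI ballI allI CollectI)
  show "\<exists>c. (\<forall>i\<in>S. c i \<in> K i) \<and> 0 = (\<Sum>i\<in>S. c i * b i)"
    using is_ideal_0[OF K] by (intro exI[of _ "\<lambda>_. 0"]) simp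
  fix y z assume "y \<in> ?K" "z \<in> ?K"
  then obtain c c' where "\<forall>i\<in>S. c i \<in> K i" "y = (\<Sum>i\<in>S. c i * b i)"
    "\<forall>i\<in>S. c' i \<in> K i" "z = (\<Sum>i\<in>S. c' i * b i)" by blast
  then show "\<exists>c. (\<forall>i\<in>S. c i \<in> K i) \<and> y + z = (\<Sum>i\<in>S. c i * b i)"
    using is_ideal_add[OF K] by (intro exI[of _ "\<lambda>i. c i + c' i"]) (simp add: distrib_right sum.distrib)
next
  fix r y assume "y \<in> ?K"
  then obtain c where "\<forall>i\<in>S. c i \<in> K i" "y = (\<Sum>i\<in>S. c i * b i)" by blast
  then show "\<exists>c. (\<forall>i\<in>S. c i \<in> K i) \<and> r * y = (\<Sum>i\<in>S. c i * b i)"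
    using is_ideal_mult_left[OF K] by (intro exI[of _ "\<lambda>i. r * c i"]) (simp add: sum_distrib_left mult.assoc)
qed

lemma ideal_mult_finite_gen:
  assumes J: "is_ideal J" and F: "finite F" and y: "y \<in> ideal_mult J (ideal_gen F)"
  shows "\<exists>a. (\<forall>f\<in>F. a f \<in> J) \<and> y = (\<Sum>f\<in>F. a f * f)"
proof -
  let ?K = "{y. \<exists>a. (\<forall>f\<in>F. a f \<in> J) \<and> y = (\<Sum>f\<in>F. a f * f)}"
  have K: "is_ideal ?K" by (rule is_ideal_combinations) (rule J)
  have "ideal_mult (ideal_gen J) (ideal_gen F) \<subseteq> ?K"
  proof (rule ideal_mult_ideal_gen_minimal[OF K])
    fix j f assume j: "j \<in> J" and f: "f \<in> F"
    have "j * f = (\<Sum>f'\<in>F. (if f' = f then j else 0) * f')"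
      using F f by (simp add: if_distrib[of "\<lambda>x. x * _"] cong: if_cong)
    then show "j * f \<in> ?K"
      using j is_ideal_0[OF J] by (intro CollectI exI[of _ "\<lambda>f'. if f' = f then j else 0"]) auto
  qed
  then show ?thesis using y ideal_gen_ideal[OF J] by auto
qed

lemma ideal_power_insert:
  assumes J: "is_ideal J" and y: "y \<in> ideal_power (ideal_gen (insert x J)) b"
  obtains c where "\<And>i. i \<le> b \<Longrightarrow> c i \<in> ideal_power J i" "y = (\<Sum>i\<le>b. c i * x ^ (b - i))"
proof -
  let ?K = "{y. \<exists>c. (\<forall>i\<in>{..b}. c i \<in> ideal_power J i) \<and> y = (\<Sum>i\<le>b. c i * x ^ (b - i))}"
  have K: "is_ideal ?K" by (rule is_ideal_combinations) (rule is_ideal_ideal_power)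
  have "ideal_power (ideal_gen (insert x J)) b \<subseteq> ?K"
  proof (rule ideal_power_ideal_gen_minimal[OF K])
    fix f assume f: "\<And>k. k < b \<Longrightarrow> f k \<in> insert x J"
    \<comment> \<open>The factors taken from J; all remaining ones equal x, so the product
      contributes to the term with index \<open>card A\<close>.\<close>
    define A where "A = {k. k < b \<and> f k \<in> J}"
    have A: "A \<subseteq> {..<b}" "finite A" by (auto simp: A_def)
    have le: "card A \<le> b" using card_mono[OF _ A(1)] by simp
    have "(\<Prod>k<b. f k) = prod f ({..<b} - A) * prod f A"
      using prod.subset_diff[OF A(1)] by simp
    also have "prod f ({..<b} - A) = (\<Prod>k\<in>{..<b} - A. x)"
      using f by (intro prod.cong refl) (auto simp: A_def)
    also have "\<dots> = x ^ (b - card A)" using A by (simp add: card_Diff_subset)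
    also have "x ^ (b - card A) * prod f A =
        (\<Sum>i\<le>b. if i = card A then prod f A * x ^ (b - i) else 0)"
      using le by (simp add: mult.commute)
    also have "\<dots> = (\<Sum>i\<le>b. (if i = card A then prod f A else 0) * x ^ (b - i))"
      by (intro sum.cong refl) simp
    finally have eq: "(\<Prod>k<b. f k) = (\<Sum>i\<le>b. (if i = card A then prod f A else 0) * x ^ (b - i))" .
    have mem: "prod f A \<in> ideal_power J (card A)"
      using A by (intro prod_in_ideal_power_card) (auto simp: A_def)
    show "(\<Prod>k<b. f k) \<in> ?K"
      using eq mem is_ideal_0[OF is_ideal_ideal_power[of J]]
      by (intro CollectI exI[of _ "\<lambda>i. if i = card A then prod f A else 0"]) auto
  qed
  then have "y \<in> ?K" using y by auto
  then show ?thesis using that by blast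
qed

text \<open>An element of J (J + (x))^b is a combination of powers of x in which the additional
  factor from J raises every index by one, so the coefficient of x^(b+1-i) lies in J^i with i \<ge>
  1. Moving everything to one side gives an equation of integral dependence.\<close>

lemma in_integral_closureI:
  assumes J: "is_ideal J" and x: "x ^ Suc b \<in> ideal_mult J (ideal_power (ideal_gen (insert x J)) b)"
  shows "x \<in> integral_closure J"
proof -
  let ?K = "{y. \<exists>c. (\<forall>i\<in>{1..Suc b}. c i \<in> ideal_power J i) \<and> y = (\<Sum>i = 1..Suc b. c i * x ^ (Suc b - i))}"
  have K: "is_ideal ?K" by (rule is_ideal_combinations) (rule is_ideal_ideal_power)
  have "ideal_mult J (ideal_power (ideal_gen (insert x J)) b) \<subseteq> ?K"
  proof (rule ideal_mult_minimal[OF K])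
    fix j y assume j: "j \<in> J" and y: "y \<in> ideal_power (ideal_gen (insert x J)) b"
    obtain c where c: "\<And>i. i \<le> b \<Longrightarrow> c i \<in> ideal_power J i" "y = (\<Sum>i\<le>b. c i * x ^ (b - i))"
      using ideal_power_insert[OF J y] by blast
    have "j * y = (\<Sum>i\<le>b. j * c i * x ^ (b - i))" by (simp add: c(2) sum_distrib_left mult.assoc)
    also have "\<dots> = (\<Sum>i = 1..Suc b. j * c (i - 1) * x ^ (Suc b - i))"
      by (rule sum.reindex_bij_witness[of _ "\<lambda>i. i - 1" Suc]) auto
    finally have eq: "j * y = (\<Sum>i = 1..Suc b. j * c (i - 1) * x ^ (Suc b - i))" .
    have "j * c (i - 1) \<in> ideal_power J i" if "i \<in> {1..Suc b}" for i
      using ideal_multI[OF j c(1), of "i - 1"] that by (cases i) auto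
    with eq show "j * y \<in> ?K" by (intro CollectI exI[of _ "\<lambda>i. j * c (i - 1)"]) blast
  qed
  with x obtain c where c: "\<forall>i\<in>{1..Suc b}. c i \<in> ideal_power J i"
    "x ^ Suc b = (\<Sum>i = 1..Suc b. c i * x ^ (Suc b - i))" by blast
  show ?thesis unfolding integral_closure_def
  proof (intro CollectI exI conjI)
    show "1 \<le> Suc b" by simp
    show "\<forall>i\<in>{1..Suc b}. - c i \<in> ideal_power J i"
      using c(1) is_ideal_uminus[OF is_ideal_ideal_power] by blast
    show "x ^ Suc b + (\<Sum>i = 1..Suc b. - c i * x ^ (Suc b - i)) = 0"
      by (subst c(2)) (simp only: mult_minus_left sum_negf add.right_inverse)
  qed
qed

text \<open>Cayley-Hamilton for multiplication by x on the ideal M generated by F: the determinant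
  of x - A annihilates M. Instead of faithfulness of M, the condition x^P in M gives x^P det(x - A)
  = 0. Up to terms in J (J + (x))^(K-1), this determinant is x^K, where K is the number of
  generators.\<close>

lemma determinant_trick:
  fixes x :: "'a::comm_ring_1"
  assumes J: "is_ideal J" and F: "finite F"
    and stable: "\<And>f. f \<in> F \<Longrightarrow> x * f \<in> ideal_mult J (ideal_gen F)"
    and xP: "x ^ P \<in> ideal_gen F"
  shows "x \<in> integral_closure J"
proof -
  let ?L = "ideal_gen (insert x J)"
  define K where "K = card F"
  obtain e where e: "bij_betw e {..<K} F"
    using ex_bij_betw_nat_finite[OF F] by (auto simp: K_def lessThan_atLeast0)
  have eF: "e i \<in> F" if "i < K" for i using bij_betwE[OF e] that by simp
  define a where "a i = (SOME a. (\<forall>f\<in>F. a f \<in> J) \<and> x * e i = (\<Sum>f\<in>F. a f * f))" for i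
  have a: "(\<forall>f\<in>F. a i f \<in> J) \<and> x * e i = (\<Sum>f\<in>F. a i f * f)" if "i < K" for i
    unfolding a_def using someI_ex[OF ideal_mult_finite_gen[OF J F stable[OF eF[OF that]]]] .
  define A where "A i j = a i (e j)" for i j
  have A: "A i j \<in> J" if "i < K" "j < K" for i j using a[OF that(1)] eF[OF that(2)] by (simp add: A_def)
  have xe: "x * e i = (\<Sum>j<K. A i j * e j)" if "i < K" for i
    using a[OF that] sum.reindex_bij_betw[OF e, of "\<lambda>f. a i f * f"] by (simp add: A_def)
  define m where "m i j = (if i = j then x else 0) - A i j" for i j
  let ?M = "mat K K (\<lambda>(i, j). m i j)"
  have me: "(\<Sum>l<K. m j l * e l) = 0" if "j < K" for j
  proof -
    have "(\<Sum>l<K. m j l * e l) = (\<Sum>l<K. if l = j then x * e l else 0) - (\<Sum>l<K. A j l * e l)"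
      unfolding m_def sum_subtractf[symmetric] by (intro sum.cong) (auto simp: algebra_simps)
    then show ?thesis using that xe[OF that] by simp
  qed
  have kill: "det ?M * e i = 0" if i: "i < K" for i
  proof -
    have adj: "(\<Sum>j<K. adj_mat ?M $$ (i, j) * m j l) = (if i = l then det ?M else 0)" if "l < K" for l
    proof -
      have "(adj_mat ?M * ?M) $$ (i, l) = (\<Sum>j<K. adj_mat ?M $$ (i, j) * m j l)"
        using i that adj_mat(1)[of ?M K] by (simp add: scalar_prod_def lessThan_atLeast0)
      then show ?thesis using i that adj_mat(3)[of ?M K] by (auto split: if_splits)
    qed
    have "det ?M * e i = (\<Sum>l<K. (if i = l then det ?M else 0) * e l)"
      using i by (simp add: if_distrib[of "\<lambda>x. x * _"] cong: if_cong)
    also have "\<dots> = (\<Sum>l<K. \<Sum>j<K. adj_mat ?M $$ (i, j) * (m j l * e l))"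
      by (intro sum.cong refl) (simp add: adj[symmetric] sum_distrib_right mult.assoc)
    also have "\<dots> = (\<Sum>j<K. adj_mat ?M $$ (i, j) * (\<Sum>l<K. m j l * e l))"
      by (subst sum.swap) (simp add: sum_distrib_left)
    finally show ?thesis using me by simp
  qed
  \<comment> \<open>The annihilator of the determinant, as a colon ideal of the zero ideal. It
    contains the generators F, hence all of M.\<close>
  have "is_ideal {y. y * det ?M \<in> {0}}"
    by (rule is_ideal_colon) (simp add: is_ideal_def)
  moreover have "F \<subseteq> {y. y * det ?M \<in> {0}}"
    using kill e by (auto simp: bij_betw_def mult.commute)
  ultimately have "ideal_gen F \<subseteq> {y. y * det ?M \<in> {0}}" by (intro ideal_gen_minimal)
  then have xdet: "x ^ P * det ?M = 0" using xP by auto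
  have JL: "J \<subseteq> ?L" and xL: "x \<in> ?L" by (auto intro: ideal_gen_superset)
  have mL: "m i j \<in> ?L" if "i < K" "j < K" for i j
    unfolding m_def diff_conv_add_uminus using A[OF that] JL xL
    by (intro is_ideal_add[OF is_ideal_ideal_gen] is_ideal_uminus[OF is_ideal_ideal_gen])
       (auto intro: is_ideal_0[OF is_ideal_ideal_gen])
  let ?Q = "\<lambda>a. ideal_mult J (ideal_power ?L a)"
  show ?thesis
  proof (cases "K = 0")
    case True
    then have "det ?M = 1" by (simp add: det_dim_zero)
    then have "x ^ P = 0" using xdet by simp
    then have "x ^ Suc P \<in> ?Q P" using is_ideal_0[OF is_ideal_ideal_mult] by simp
    then show ?thesis by (rule in_integral_closureI[OF J])
  next
    case False
    then obtain b where b: "K = Suc b" by (cases K) auto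
    \<comment> \<open>For t = 0 the difference is 0, so the truncated exponent t - 1 = 0 does no
      harm there.\<close>
    have diag: "(\<Prod>i<t. m i i) - x ^ t \<in> ?Q (t - 1)" if "t \<le> K" for t
      using that
    proof (induction t)
      case 0
      show ?case by (simp add: is_ideal_0[OF is_ideal_ideal_mult])
    next
      case (Suc t)
      have "(\<Prod>i<Suc t. m i i) - x ^ Suc t = x * ((\<Prod>i<t. m i i) - x ^ t) + (- A t t) * (\<Prod>i<t. m i i)"
        by (simp add: m_def algebra_simps)
      also have "\<dots> \<in> ?Q t"
      proof (rule is_ideal_add[OF is_ideal_ideal_mult])
        show "- A t t * (\<Prod>i<t. m i i) \<in> ?Q t"
          using A[of t t] Suc.prems mL
          by (intro ideal_multI is_ideal_uminus[OF J] prod_in_ideal_power) auto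
        show "x * ((\<Prod>i<t. m i i) - x ^ t) \<in> ?Q t"
        proof (cases t)
          case 0
          then show ?thesis by (simp add: is_ideal_0[OF is_ideal_ideal_mult])
        next
          case (Suc t')
          have "x * ((\<Prod>i<t. m i i) - x ^ t) \<in> ideal_mult ?L (?Q t')"
            using Suc.IH Suc.prems Suc xL by (intro ideal_multI) auto
          also have "ideal_mult ?L (?Q t') = ?Q t"
            unfolding Suc ideal_mult_assoc[symmetric] ideal_power.simps
            by (simp only: ideal_mult_commute[of J ?L])
          finally show ?thesis .
        qed
      qed
      finally show ?case by simp
    qed
    have "det ?M - x ^ K \<in> ?Q b"
    proof -
      let ?P = "{p. p permutes {0..<K}}"
      have lt: "p i < K" if "p permutes {0..<K}" "i < K" for p i
        using permutes_in_image[OF that(1), of i] that(2) by simp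
      have fin: "finite ?P" by (rule finite_permutations) simp
      have "det ?M = (\<Sum>p\<in>?P. signof p * (\<Prod>j<K. m (p j) j))"
        by (subst det_col[of _ K]) (auto intro!: sum.cong prod.cong simp: lt)
      also have "\<dots> = signof id * (\<Prod>j<K. m (id j) j) + (\<Sum>p\<in>?P - {id}. signof p * (\<Prod>j<K. m (p j) j))"
        by (rule sum.remove[OF fin]) (simp add: permutes_id)
      finally have "det ?M - x ^ K = ((\<Prod>i<K. m i i) - x ^ K) + (\<Sum>p\<in>?P - {id}. signof p * (\<Prod>j<K. m (p j) j))"
        by simp
      also have "\<dots> \<in> ?Q b"
      proof (rule is_ideal_add[OF is_ideal_ideal_mult])
        show "(\<Prod>i<K. m i i) - x ^ K \<in> ?Q b" using diag[of K] b by simp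
        show "(\<Sum>p\<in>?P - {id}. signof p * (\<Prod>j<K. m (p j) j)) \<in> ?Q b"
        proof (rule is_ideal_sum[OF is_ideal_ideal_mult], rule is_ideal_mult_left[OF is_ideal_ideal_mult])
          fix p assume p: "p \<in> ?P - {id}"
          then obtain j where "p j \<noteq> j" by (metis Diff_iff eq_id_iff singletonI)
          then have j: "j < K" using permutes_not_in[of p "{0..<K}" j] p by auto
          have pj: "p i < K" if "i < K" for i using p lt that by auto
          have "(\<Prod>i<K. m (p i) i) = m (p j) j * (\<Prod>i\<in>{..<K} - {j}. m (p i) i)"
            by (rule prod.remove) (use j in auto)
          also have "\<dots> \<in> ideal_mult J (ideal_power ?L (card ({..<K} - {j})))"
          proof (intro ideal_multI prod_in_ideal_power_card)
            show "m (p j) j \<in> J"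
              using \<open>p j \<noteq> j\<close> is_ideal_uminus[OF J A[OF pj[OF j] j]] by (simp add: m_def)
          qed (use mL pj in auto)
          also have "card ({..<K} - {j}) = b" using j b by simp
          finally show "(\<Prod>j<K. m (p j) j) \<in> ?Q b" .
        qed
      qed
      finally show ?thesis .
    qed
    \<comment> \<open>Multiplying by x^P cancels the determinant and leaves x^(P+K) in J (J +
      (x))^(P+b), where K = b + 1; this is the form required by
      \<open>in_integral_closureI\<close>.\<close>
    then have "(- (x ^ P)) * (det ?M - x ^ K) \<in> ideal_mult (ideal_power ?L P) (?Q b)"
      using power_in_ideal_power[OF xL]
      by (intro ideal_multI is_ideal_uminus[OF is_ideal_ideal_power])
    also have "ideal_mult (ideal_power ?L P) (?Q b) = ?Q (P + b)"
      using ideal_power_add[OF is_ideal_ideal_gen, of "insert x J" P b]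
      by (simp only: ideal_mult_assoc[symmetric] ideal_mult_commute[of "ideal_power ?L P" J])
         (simp only: ideal_mult_assoc)
    also have "(- (x ^ P)) * (det ?M - x ^ K) = x ^ Suc (P + b)"
      using xdet b by (simp add: algebra_simps power_add)
    finally show ?thesis by (rule in_integral_closureI[OF J])
  qed
qed

lemma integral_closure_mono:
  assumes "J \<subseteq> I" shows "integral_closure J \<subseteq> integral_closure I"
  using ideal_power_mono[OF assms] unfolding integral_closure_def by blast

text \<open>The ideal \<open>L = I + (x)\<close> satisfies \<open>L\<^bsup>P+1\<^esup> = J L\<^bsup>P\<^esup>\<close> for large \<open>P\<close>: the equation of \<open>x\<close>
  gives \<open>L\<^bsup>k\<^esup> = I L\<^bsup>k-1\<^esup>\<close>, and by the pigeonhole principle large powers of \<open>I\<close> are multiples of \<open>J\<close>.\<close>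

lemma integral_closure_eqI:
  assumes J: "is_ideal J" and JI: "J \<subseteq> I" and I: "I = ideal_gen G" and G: "finite G" and N: "N \<ge> 1"
    and pow: "\<And>g. g \<in> G \<Longrightarrow> g ^ N \<in> ideal_power J N"
  shows "integral_closure J = integral_closure I"
proof
  show "integral_closure J \<subseteq> integral_closure I" by (rule integral_closure_mono[OF JI])
  have idI: "is_ideal I" by (simp add: I is_ideal_ideal_gen)
  show "integral_closure I \<subseteq> integral_closure J"
  proof
    fix x assume "x \<in> integral_closure I"
    then obtain k c where k: "k \<ge> 1" and c: "\<And>i. i \<in> {1..k} \<Longrightarrow> c i \<in> ideal_power I i"
      and eq: "x ^ k + (\<Sum>i = 1..k. c i * x ^ (k - i)) = 0"
      unfolding integral_closure_def by blast
    define L where "L = ideal_gen (insert x G)"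
    have L: "is_ideal L" by (simp add: L_def is_ideal_ideal_gen)
    have xL: "x \<in> L" unfolding L_def by (rule ideal_gen_superset) simp
    have IL: "I \<subseteq> L" unfolding I L_def by (rule ideal_gen_mono) auto
    have Ladd: "ideal_mult (ideal_power L a) (ideal_power L b) = ideal_power L (a + b)" for a b
      by (rule ideal_power_add[OF L])
    \<comment> \<open>Chosen for the pigeonhole argument: among t + 1 factors from G some generator
      g must occur at least N times, and g^N can be replaced by an element of J^N.\<close>
    define t where "t = card G * N"
    have xk: "x ^ k \<in> ideal_mult I (ideal_power L (k - 1))"
    proof -
      have "x ^ k = - (\<Sum>i = 1..k. c i * x ^ (k - i))" using eq by (simp add: eq_neg_iff_add_eq_0)
      also have "\<dots> \<in> ideal_mult I (ideal_power L (k - 1))"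
      proof (rule is_ideal_uminus[OF is_ideal_ideal_mult], rule is_ideal_sum[OF is_ideal_ideal_mult])
        fix i assume i: "i \<in> {1..k}"
        then obtain i' where i': "i = Suc i'" by (cases i) auto
        have "c i * x ^ (k - i) \<in> ideal_mult (ideal_power I i) (ideal_power L (k - i))"
          using c[OF i] power_in_ideal_power[OF xL] by (rule ideal_multI)
        also have "\<dots> = ideal_mult I (ideal_mult (ideal_power I i') (ideal_power L (k - i)))"
          by (simp add: i' ideal_mult_assoc)
        also have "\<dots> \<subseteq> ideal_mult I (ideal_mult (ideal_power L i') (ideal_power L (k - i)))"
          by (intro ideal_mult_mono order_refl ideal_power_mono IL)
        also have "\<dots> = ideal_mult I (ideal_power L (k - 1))"
          using i i' by (simp add: Ladd)
        finally show "c i * x ^ (k - i) \<in> ideal_mult I (ideal_power L (k - 1))" .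
      qed
      finally show ?thesis .
    qed
    \<comment> \<open>A product of k generators of L either has a factor from G or equals x^k, and
      x^k is handled by the equation of integral dependence, whose coefficients all contain a factor
      from I.\<close>
    have Lk: "ideal_power L k \<subseteq> ideal_mult I (ideal_power L (k - 1))"
      unfolding L_def
    proof (rule ideal_power_ideal_gen_minimal[OF is_ideal_ideal_mult], unfold L_def[symmetric])
      fix f assume f: "\<And>j. j < k \<Longrightarrow> f j \<in> insert x G"
      show "(\<Prod>j<k. f j) \<in> ideal_mult I (ideal_power L (k - 1))"
      proof (cases "\<exists>j<k. f j \<in> G")
        case True
        then obtain j where j: "j < k" "f j \<in> G" by blast
        have "(\<Prod>j<k. f j) = f j * prod f ({..<k} - {j})" by (rule prod.remove) (use j in auto)
        also have "\<dots> \<in> ideal_mult I (ideal_power L (card ({..<k} - {j})))"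
          using j(2) f unfolding I L_def
          by (intro ideal_multI prod_in_ideal_power_card ideal_gen_superset) auto
        finally show ?thesis using j by simp
      next
        case False
        then have "f j = x" if "j < k" for j using f[OF that] that by auto
        then show ?thesis using xk by simp
      qed
    qed
    have Lkt: "ideal_power L (k + r) \<subseteq> ideal_mult (ideal_power I (Suc r)) (ideal_power L (k - 1))" for r
    proof (induction r)
      case 0
      have "ideal_mult I UNIV = I"
        using ideal_power_add[OF idI, of 1 0] ideal_power_add[OF idI, of 0 1] ideal_mult_minimal[OF idI, of I UNIV]
          is_ideal_mult_right[OF idI] ideal_multI[of _ I 1 UNIV] by auto
      then show ?case using Lk by simp
    next
      case (Suc r)
      have "ideal_power L (k + Suc r) = ideal_mult L (ideal_power L (k + r))" by simp
      also have "\<dots> \<subseteq> ideal_mult L (ideal_mult (ideal_power I (Suc r)) (ideal_power L (k - 1)))"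
        by (intro ideal_mult_mono Suc order_refl)
      also have "\<dots> = ideal_mult (ideal_power I (Suc r)) (ideal_mult L (ideal_power L (k - 1)))"
        by (metis ideal_mult_assoc ideal_mult_commute)
      also have "ideal_mult L (ideal_power L (k - 1)) = ideal_power L k"
        using k by (cases k) auto
      also have "ideal_mult (ideal_power I (Suc r)) (ideal_power L k) \<subseteq>
          ideal_mult (ideal_power I (Suc r)) (ideal_mult I (ideal_power L (k - 1)))"
        by (intro ideal_mult_mono Lk order_refl)
      also have "\<dots> = ideal_mult (ideal_power I (Suc (Suc r))) (ideal_power L (k - 1))"
        unfolding ideal_power.simps(2)[of I "Suc r"] by (metis ideal_mult_assoc ideal_mult_commute)
      finally show ?case .
    qed
    have It: "ideal_power I (Suc t) \<subseteq> ideal_mult J (ideal_power I t)"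
      unfolding I
    proof (rule ideal_power_ideal_gen_minimal[OF is_ideal_ideal_mult], unfold I[symmetric])
      fix f assume f: "\<And>j. j < Suc t \<Longrightarrow> f j \<in> G"
      have "\<exists>g\<in>G. N \<le> card {j \<in> {..<Suc t}. f j = g}"
      proof (rule ccontr)
        assume "\<not> ?thesis"
        then have less: "card {j \<in> {..<Suc t}. f j = g} \<le> N" if "g \<in> G" for g using that by force
        have "Suc t = card (\<Union>g\<in>G. {j \<in> {..<Suc t}. f j = g})"
        proof -
          have "(\<Union>g\<in>G. {j \<in> {..<Suc t}. f j = g}) = {..<Suc t}" using f by auto
          then show ?thesis by simp
        qed
        also have "\<dots> \<le> (\<Sum>g\<in>G. card {j \<in> {..<Suc t}. f j = g})" by (rule card_UN_le[OF G])
        also have "\<dots> \<le> (\<Sum>g\<in>G. N)" using less by (rule sum_mono)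
        finally show False by (simp add: t_def)
      qed
      then obtain g where g: "g \<in> G" "N \<le> card {j \<in> {..<Suc t}. f j = g}" by blast
      obtain B where B: "B \<subseteq> {j \<in> {..<Suc t}. f j = g}" "card B = N"
        using obtain_subset_with_card_n[OF g(2)] by blast
      have finB: "B \<subseteq> {..<Suc t}" "finite B" using B(1) finite_subset[OF B(1)] by auto
      have NT: "N \<le> Suc t" using card_mono[OF _ finB(1)] B(2) by simp
      have "(\<Prod>j<Suc t. f j) = prod f B * prod f ({..<Suc t} - B)"
        using prod.subset_diff[OF finB(1)] by (simp add: mult.commute)
      also have "prod f B = (\<Prod>j\<in>B. g)" using B(1) by (intro prod.cong) auto
      also have "\<dots> = g ^ N" using B(2) by simp
      finally have "(\<Prod>j<Suc t. f j) = g ^ N * prod f ({..<Suc t} - B)" .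
      also have "\<dots> \<in> ideal_mult (ideal_power J N) (ideal_power I (card ({..<Suc t} - B)))"
        using f pow[OF g(1)] unfolding I
        by (intro ideal_multI prod_in_ideal_power_card ideal_gen_superset) auto
      also have "card ({..<Suc t} - B) = Suc t - N" using finB B(2) by (simp add: card_Diff_subset)
      also have "ideal_mult (ideal_power J N) (ideal_power I (Suc t - N)) =
          ideal_mult J (ideal_mult (ideal_power J (N - 1)) (ideal_power I (Suc t - N)))"
        using N by (cases N) (simp_all add: ideal_mult_assoc)
      also have "\<dots> \<subseteq> ideal_mult J (ideal_mult (ideal_power I (N - 1)) (ideal_power I (Suc t - N)))"
        by (intro ideal_mult_mono order_refl ideal_power_mono JI)
      also have "\<dots> = ideal_mult J (ideal_power I t)"
        using N NT by (simp add: ideal_power_add[OF idI])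
      finally show "(\<Prod>j<Suc t. f j) \<in> ideal_mult J (ideal_power I t)" .
    qed
    \<comment> \<open>With this exponent P + 1 = k + t: trading L^k for I L^(k-1) exactly t + 1
      times leaves I^(t+1) L^(k-1), and one factor of I^(t+1) becomes a factor of J.\<close>
    define P where "P = k - 1 + t"
    have LP: "ideal_mult L (ideal_power L P) \<subseteq> ideal_mult J (ideal_power L P)"
    proof -
      have "ideal_mult L (ideal_power L P) = ideal_power L (k + t)"
        using k by (cases k) (auto simp: P_def)
      also have "\<dots> \<subseteq> ideal_mult (ideal_power I (Suc t)) (ideal_power L (k - 1))" by (rule Lkt)
      also have "\<dots> \<subseteq> ideal_mult (ideal_mult J (ideal_power I t)) (ideal_power L (k - 1))"
        by (intro ideal_mult_mono It order_refl)
      also have "\<dots> \<subseteq> ideal_mult (ideal_mult J (ideal_power L t)) (ideal_power L (k - 1))"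
        by (intro ideal_mult_mono ideal_power_mono IL order_refl)
      also have "\<dots> = ideal_mult J (ideal_power L P)"
        by (simp add: ideal_mult_assoc Ladd P_def add.commute)
      finally show ?thesis .
    qed
    \<comment> \<open>The determinant trick is applied to the module L^P, which is finitely
      generated because G is finite and which contains x^P.\<close>
    define F where "F = (\<lambda>f. \<Prod>k<P. f k) ` Pi\<^sub>E {..<P} (\<lambda>_. insert x G)"
    have F: "ideal_power L P = ideal_gen F" unfolding L_def F_def by (rule ideal_power_ideal_gen)
    show "x \<in> integral_closure J"
    proof (rule determinant_trick[OF J])
      show "finite F" unfolding F_def using G by (intro finite_imageI finite_PiE) auto
      show "x * f \<in> ideal_mult J (ideal_gen F)" if "f \<in> F" for f
        using LP ideal_multI[OF xL ideal_gen_superset[OF that]] unfolding F by blast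
      show "x ^ P \<in> ideal_gen F" unfolding F[symmetric] by (rule power_in_ideal_power[OF xL])
    qed
  qed
qed

section \<open>Comparison of ideals containing determinant powers\<close>

lemma det_cols_in_minor_ideal:
  fixes \<chi> :: "('b \<Rightarrow> 'a::comm_ring_1) \<Rightarrow> ('c \<Rightarrow> 'a)"
  assumes B: "finite B" and \<rho>: "\<rho> \<in> {..<t} \<rightarrow> C" "inj_on \<rho> {..<t}"
    and M: "\<And>r c. r < t \<Longrightarrow> c < t \<Longrightarrow> M r c = (\<Sum>b\<in>B. x c b * \<chi> (basis_vec b) (\<rho> r))"
  shows "det (mat t t (\<lambda>(r, c). M r c)) \<in> minor_ideal B C t \<chi>"
proof -
  have "mat t t (\<lambda>(r, c). M r c) = mat t t (\<lambda>(r, c). \<Sum>b\<in>B. x c b * \<chi> (basis_vec b) (\<rho> r))"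
    by (intro eq_matI) (auto simp: M)
  then have "det (mat t t (\<lambda>(r, c). M r c)) = (\<Sum>\<kappa>\<in>Pi\<^sub>E {..<t} (\<lambda>_. B).
      (\<Prod>c<t. x c (\<kappa> c)) * det (mat t t (\<lambda>(r, c). \<chi> (basis_vec (\<kappa> c)) (\<rho> r))))"
    using B by (simp only: det_sum_cols)
  also have "\<dots> \<in> minor_ideal B C t \<chi>"
    unfolding minor_ideal_def
  proof (rule is_ideal_sum[OF is_ideal_ideal_gen], rule is_ideal_mult_left[OF is_ideal_ideal_gen])
    fix \<kappa> assume \<kappa>: "\<kappa> \<in> Pi\<^sub>E {..<t} (\<lambda>_. B)"
    let ?M = "mat t t (\<lambda>(r, c). \<chi> (basis_vec (\<kappa> c)) (\<rho> r))"
    show "det ?M \<in> ideal_gen (minors B C t \<chi>)"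
    proof (cases "inj_on \<kappa> {..<t}")
      case True
      have "\<kappa> \<in> {..<t} \<rightarrow> B" using \<kappa> by auto
      then have "det ?M \<in> minors B C t \<chi>" using True \<rho> unfolding minors_def by blast
      then show ?thesis by (rule ideal_gen_superset)
    next
      case False
      then obtain a b where ab: "a < t" "b < t" "a \<noteq> b" "\<kappa> a = \<kappa> b" by (auto simp: inj_on_def)
      have "det ?M = 0"
        by (rule det_identical_columns[of _ t a b]) (use ab in \<open>auto intro!: eq_vecI\<close>)
      then show ?thesis by (simp add: is_ideal_0[OF is_ideal_ideal_gen])
    qed
  qed
  finally show ?thesis .
qed

lemma finite_minors:
  assumes "finite B" "finite C"
  shows "finite (minors B C t \<chi>)"
proof -
  let ?h = "\<lambda>(\<rho>, \<kappa>). det (mat t t (\<lambda>(i, j). \<chi> (basis_vec (\<kappa> j)) (\<rho> i)))"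
  have "minors B C t \<chi> \<subseteq> ?h ` (Pi\<^sub>E {..<t} (\<lambda>_. C) \<times> Pi\<^sub>E {..<t} (\<lambda>_. B))"
  proof
    fix y assume "y \<in> minors B C t \<chi>"
    then obtain \<rho> \<kappa> where y: "y = ?h (\<rho>, \<kappa>)" and "\<rho> \<in> {..<t} \<rightarrow> C" "\<kappa> \<in> {..<t} \<rightarrow> B"
      unfolding minors_def by auto
    moreover have "?h (\<rho>, \<kappa>) = ?h (restrict \<rho> {..<t}, restrict \<kappa> {..<t})"
      by (auto intro!: arg_cong[of _ _ det] eq_matI)
    ultimately show "y \<in> ?h ` (Pi\<^sub>E {..<t} (\<lambda>_. C) \<times> Pi\<^sub>E {..<t} (\<lambda>_. B))"
      by (intro image_eqI[of _ _ "(restrict \<rho> {..<t}, restrict \<kappa> {..<t})"]) auto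
  qed
  moreover have "finite (?h ` (Pi\<^sub>E {..<t} (\<lambda>_. C) \<times> Pi\<^sub>E {..<t} (\<lambda>_. B)))"
    using assms by (auto intro!: finite_PiE)
  ultimately show ?thesis by (rule finite_subset)
qed

definition col_span :: "nat \<Rightarrow> ((nat \<Rightarrow> 'a::comm_ring_1) \<Rightarrow> (nat \<Rightarrow> 'a)) \<Rightarrow> (nat \<Rightarrow> 'a) set" where
  "col_span m \<phi> = range (\<lambda>g i. \<Sum>j<m. g j * \<phi> (basis_vec j) i)"

lemma col_span_0: "(\<lambda>_. 0) \<in> col_span m \<phi>"
  unfolding col_span_def by (intro image_eqI[of _ _ "\<lambda>_. 0"]) auto

lemma col_span_add: "x \<in> col_span m \<phi> \<Longrightarrow> y \<in> col_span m \<phi> \<Longrightarrow> (\<lambda>i. x i + y i) \<in> col_span m \<phi>"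
proof -
  assume "x \<in> col_span m \<phi>" "y \<in> col_span m \<phi>"
  then obtain g h where "x = (\<lambda>i. \<Sum>j<m. g j * \<phi> (basis_vec j) i)" "y = (\<lambda>i. \<Sum>j<m. h j * \<phi> (basis_vec j) i)"
    by (auto simp: col_span_def)
  then show ?thesis unfolding col_span_def
    by (intro image_eqI[of _ _ "\<lambda>j. g j + h j"]) (simp_all add: distrib_right sum.distrib)
qed

lemma col_in_col_span:
  assumes "j < m" shows "\<phi> (basis_vec j) \<in> col_span m \<phi>"
proof -
  have "\<phi> (basis_vec j) = (\<lambda>i. \<Sum>j'<m. of_bool (j' = j) * \<phi> (basis_vec j') i)"
  proof
    fix i
    have "(\<Sum>j'<m. of_bool (j' = j) * \<phi> (basis_vec j') i) = (\<Sum>j'<m. if j' = j then \<phi> (basis_vec j') i else 0)"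
      by (intro sum.cong) auto
    then show "\<phi> (basis_vec j) i = (\<Sum>j'<m. of_bool (j' = j) * \<phi> (basis_vec j') i)"
      using assms by simp
  qed
  then show ?thesis unfolding col_span_def by (rule image_eqI[of _ _ "\<lambda>j'. of_bool (j' = j)"]) simp
qed

lemma col_span_coeffs:
  assumes "\<And>j. j < n \<Longrightarrow> y j \<in> col_span m \<phi>"
  shows "\<exists>g. \<forall>j<n. y j = (\<lambda>i. \<Sum>l<m. g j l * \<phi> (basis_vec l) i)"
proof -
  have ex: "\<exists>g. y j = (\<lambda>i. \<Sum>l<m. g l * \<phi> (basis_vec l) i)" if "j < n" for j
    using assms[OF that] by (auto simp: col_span_def)
  define g where "g j = (SOME g. y j = (\<lambda>i. \<Sum>l<m. g l * \<phi> (basis_vec l) i))" for j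
  have "y j = (\<lambda>i. \<Sum>l<m. g j l * \<phi> (basis_vec l) i)" if "j < n" for j
    unfolding g_def using someI_ex[OF ex[OF that]] .
  then show ?thesis by blast
qed

lemma det_col_span_in_max_minor_ideal:
  assumes "\<And>j. j < n \<Longrightarrow> y j \<in> col_span m \<phi>"
  shows "det (mat n n (\<lambda>(i, j). y j i)) \<in> max_minor_ideal {..<m} {..<n} \<phi>"
proof -
  obtain g where g: "\<And>j. j < n \<Longrightarrow> y j = (\<lambda>i. \<Sum>l<m. g j l * \<phi> (basis_vec l) i)"
    using col_span_coeffs[of n y m \<phi>, OF assms] by blast
  have "det (mat n n (\<lambda>(i, j). y j i)) \<in> minor_ideal {..<m} {..<n} n \<phi>"
    by (rule det_cols_in_minor_ideal[of _ "\<lambda>i. i" _ _ _ g]) (auto simp: g)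
  then show ?thesis by (simp add: max_minor_ideal_def)
qed

text \<open>A minor of full size n is taken with respect to an arbitrary ordering of the rows. The
  resulting sign is absorbed by rescaling one column, which stays in the column span.\<close>

lemma minorsE_col_span:
  assumes "x \<in> minors {..<m} {..<n} n \<phi>"
  obtains y where "\<And>j. j < n \<Longrightarrow> y j \<in> col_span m \<phi>" "x = det (mat n n (\<lambda>(i, j). y j i))"
proof -
  from assms obtain \<rho> \<kappa> where x: "x = det (mat n n (\<lambda>(i, j). \<phi> (basis_vec (\<kappa> j)) (\<rho> i)))"
    and \<rho>: "\<rho> \<in> {..<n} \<rightarrow> {..<n}" "inj_on \<rho> {..<n}" and \<kappa>: "\<kappa> \<in> {..<n} \<rightarrow> {..<m}"
    unfolding minors_def by auto
  define p where "p i = (if i < n then \<rho> i else i)" for i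
  have "bij_betw \<rho> {..<n} {..<n}"
    using \<rho> endo_inj_surj[of "{..<n}" \<rho>] by (auto simp: bij_betw_def)
  then have "bij_betw p {..<n} {..<n}" by (rule bij_betw_cong[THEN iffD1, rotated]) (simp add: p_def)
  then have p: "p permutes {0..<n}"
    unfolding atLeast0LessThan by (rule bij_imp_permutes) (simp add: p_def)
  let ?Y = "mat n n (\<lambda>(i, j). \<phi> (basis_vec (\<kappa> j)) i)"
  have pl: "p i < n" if "i < n" for i using permutes_in_image[OF p, of i] that by simp
  have "x = det (mat n n (\<lambda>(i, j). ?Y $$ (p i, j)))"
    unfolding x using pl by (intro arg_cong[of _ _ det] eq_matI) (auto simp: p_def)
  also have "\<dots> = signof p * det ?Y" by (rule det_permute_rows[OF _ p]) simp
  finally have xs: "x = signof p * det ?Y" .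
  show ?thesis
  \<comment> \<open>For n = 0 there is no column to carry the sign, and the only minor is the empty
    determinant.\<close>
  proof (cases "n = 0")
    case True
    then show ?thesis using that[of "\<lambda>_ _. 0"] by (simp add: x)
  next
    case False
    define y where "y j = (\<lambda>i. (if j = 0 then signof p else 1) * \<phi> (basis_vec (\<kappa> j)) i)" for j
    have "y j \<in> col_span m \<phi>" if "j < n" for j
    proof -
      have "\<kappa> j < m" using \<kappa> that by auto
      then obtain g where "\<phi> (basis_vec (\<kappa> j)) = (\<lambda>i. \<Sum>l<m. g l * \<phi> (basis_vec l) i)"
        using col_in_col_span[of "\<kappa> j" m \<phi>] unfolding col_span_def by blast
      then have "y j = (\<lambda>i. \<Sum>l<m. ((if j = 0 then signof p else 1) * g l) * \<phi> (basis_vec l) i)"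
        by (simp add: y_def sum_distrib_left mult.assoc)
      then show ?thesis unfolding col_span_def by (intro image_eqI) auto
    qed
    moreover have "det (mat n n (\<lambda>(i, j). y j i)) = signof p * det ?Y"
    proof -
      have "det (mat n n (\<lambda>(i, j). y j i)) = (\<Sum>r<n. y 0 r * cofactor ?Y r 0)"
        using det_replace_col_sum[of 0 n "y 0" "\<lambda>i j. \<phi> (basis_vec (\<kappa> j)) i"] False
        by (auto simp: y_def intro!: trans[OF arg_cong[of _ _ det] det_replace_col_sum] eq_matI)
      also have "\<dots> = signof p * (\<Sum>r<n. ?Y $$ (r, 0) * cofactor ?Y r 0)"
        using False by (auto simp: y_def sum_distrib_left mult.assoc intro!: sum.cong)
      also have "(\<Sum>r<n. ?Y $$ (r, 0) * cofactor ?Y r 0) = det ?Y"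
        by (rule laplace_expansion_column[symmetric]) (use False in auto)
      finally show ?thesis .
    qed
    ultimately show ?thesis using that[of y] xs by simp
  qed
qed

lemma minors_family_col_span:
  assumes "\<And>k. k < s \<Longrightarrow> f k \<in> minors {..<m} {..<n} n \<phi>"
  obtains w where "\<And>k j. k < s \<Longrightarrow> j < n \<Longrightarrow> w k j \<in> col_span m \<phi>"
    "\<And>k. k < s \<Longrightarrow> f k = det (mat n n (\<lambda>(i, j). w k j i))"
proof -
  let ?P = "\<lambda>k y. (\<forall>j<n. y j \<in> col_span m \<phi>) \<and> f k = det (mat n n (\<lambda>(i, j). y j i))"
  have ex: "\<exists>y. ?P k y" if k: "k < s" for k
    using minorsE_col_span[OF assms[OF k]] by blast
  define w where "w k = (SOME y. ?P k y)" for k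
  have "?P k (w k)" if "k < s" for k unfolding w_def using someI_ex[OF ex[OF that]] .
  then show ?thesis using that by blast
qed

lemma contains_rationals_inverse:
  assumes "contains_rationals TYPE('a::comm_ring_1)" "c > 0"
  obtains u :: "'a::comm_ring_1" where "u * of_int c = 1"
proof -
  obtain h :: "rat \<Rightarrow> 'a" where h: "inj_comm_ring_hom h"
    using assms(1) by (auto simp: contains_rationals_def)
  interpret inj_comm_ring_hom h by (rule h)
  have "h (1 / of_int c) * of_int c = h (1 / of_int c * of_int c)"
    unfolding hom_mult by (simp add: hom_of_int)
  also have "\<dots> = 1" using assms(2) by simp
  finally show ?thesis by (rule that)
qed

lemma contains_rationals_cancel:
  fixes X :: "'a::comm_ring_1 set"
  assumes "contains_rationals TYPE('a)" "c > 0" "is_ideal X" "of_int c * x \<in> X"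
  shows "x \<in> X"
proof -
  obtain u :: 'a where "u * of_int c = 1" using contains_rationals_inverse[OF assms(1,2)] .
  then have "x = u * (of_int c * x)" by (simp add: mult.assoc[symmetric])
  then show ?thesis using is_ideal_mult_left[OF assms(3,4), of u] by simp
qed

lemma max_minor_ideal_lessThan:
  "max_minor_ideal {..<m} {..<n} \<phi> = ideal_gen (minors {..<m} {..<n} n \<phi>)"
  by (simp add: max_minor_ideal_def minor_ideal_def)

text \<open>Both comparisons with a power of \<open>I(\<phi>)\<close> only use that the ideal contains the powers
  of the determinants of all \<open>n \<times> n\<close> matrices with columns in the column span of \<open>\<phi>\<close>.\<close>

lemma comparison_with_power:
  fixes \<phi> :: "(nat \<Rightarrow> 'a::comm_ring_1) \<Rightarrow> (nat \<Rightarrow> 'a)" and m n s :: nat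
  defines "I \<equiv> max_minor_ideal {..<m} {..<n} \<phi>"
  assumes X: "is_ideal X" and sub: "X \<subseteq> ideal_power I s"
    and pow: "\<And>y. (\<And>j. j < n \<Longrightarrow> y j \<in> col_span m \<phi>) \<Longrightarrow> det (mat n n (\<lambda>(i, j). y j i)) ^ s \<in> X"
  shows "integral_closure X = integral_closure (ideal_power I s)"
    and "contains_rationals TYPE('a) \<Longrightarrow> X = ideal_power I s"
proof -
  let ?G = "minors {..<m} {..<n} n \<phi>"
  have G: "finite ?G" by (rule finite_minors) auto
  have gpow: "g ^ s \<in> X" if g: "g \<in> ?G" for g
  proof -
    obtain y where y: "\<And>j. j < n \<Longrightarrow> y j \<in> col_span m \<phi>" "g = det (mat n n (\<lambda>(i, j). y j i))"
      using minorsE_col_span[OF g] by blast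
    show ?thesis unfolding y(2) by (rule pow[OF y(1)])
  qed
  show "integral_closure X = integral_closure (ideal_power I s)"
  \<comment> \<open>The criterion needs a positive exponent. For s = 0 the zeroth power of any
    determinant already puts 1 into X.\<close>
  proof (cases "s = 0")
    case True
    have "1 \<in> X" using pow[of "\<lambda>_ _. 0"] col_span_0[of m \<phi>] True by simp
    then show ?thesis using is_ideal_eq_UNIV[OF X] True by simp
  next
    case False
    show ?thesis
    proof (rule integral_closure_eqI[OF X sub])
      show "ideal_power I s = ideal_gen ((\<lambda>f. \<Prod>k<s. f k) ` Pi\<^sub>E {..<s} (\<lambda>_. ?G))"
        unfolding I_def max_minor_ideal_lessThan by (rule ideal_power_ideal_gen)
      show "finite ((\<lambda>f. \<Prod>k<s. f k) ` Pi\<^sub>E {..<s} (\<lambda>_. ?G))"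
        using G by (intro finite_imageI finite_PiE) auto
      \<comment> \<open>The criterion is used with N = s: g is a product of s minors, the s-th power
        of each lies in X, and so g^s is a product of s elements of X.\<close>
      fix g assume "g \<in> (\<lambda>f. \<Prod>k<s. f k) ` Pi\<^sub>E {..<s} (\<lambda>_. ?G)"
      then obtain f where g: "g = (\<Prod>k<s. f k)" and f: "f \<in> Pi\<^sub>E {..<s} (\<lambda>_. ?G)" by blast
      have "f k ^ s \<in> X" if "k < s" for k
        using gpow[of "f k"] PiE_mem[OF f, of k] that by simp
      then show "g ^ s \<in> ideal_power X s"
        unfolding g prod_power_distrib by (rule prod_in_ideal_power)
    qed (use False in simp)
  qed
  assume rat: "contains_rationals TYPE('a)"
  have "ideal_power I s \<subseteq> X"
    unfolding I_def max_minor_ideal_lessThan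
  proof (rule ideal_power_ideal_gen_minimal[OF X])
    fix f assume f: "\<And>k. k < s \<Longrightarrow> f k \<in> ?G"
    obtain w where w: "\<And>k j. k < s \<Longrightarrow> j < n \<Longrightarrow> w k j \<in> col_span m \<phi>"
      "\<And>k. k < s \<Longrightarrow> f k = det (mat n n (\<lambda>(i, j). w k j i))"
      using minors_family_col_span[of s f m n \<phi>, OF f] by blast
    have "of_int (polarization_const n s) * (\<Prod>k<s. det (mat n n (\<lambda>(i, j). w k j i))) \<in> X"
      by (rule polarization[OF X col_span_0 col_span_add pow w(1)])
    then have "(\<Prod>k<s. det (mat n n (\<lambda>(i, j). w k j i))) \<in> X"
      by (rule contains_rationals_cancel[OF rat polarization_const_pos X])
    then show "(\<Prod>k<s. f k) \<in> X" using w(2) by simp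
  qed
  then show "X = ideal_power I s" using sub by blast
qed

text \<open>The argument of \<open>comparison_with_power\<close> for two maps. The exponent in the
  criterion is now q * n, and polarization is applied to each map in turn, with the contribution of
  the other map moved into a colon ideal.\<close>

lemma comparison_with_product:
  fixes \<phi> \<psi> :: "(nat \<Rightarrow> 'a::comm_ring_1) \<Rightarrow> (nat \<Rightarrow> 'a)" and m n p q :: nat
  defines "I \<equiv> max_minor_ideal {..<m} {..<n} \<phi>" and "J \<equiv> max_minor_ideal {..<p} {..<q} \<psi>"
  assumes X: "is_ideal X" and sub: "X \<subseteq> ideal_mult (ideal_power I q) (ideal_power J n)"
    and pow: "\<And>y z. (\<And>j. j < n \<Longrightarrow> y j \<in> col_span m \<phi>) \<Longrightarrow> (\<And>j. j < q \<Longrightarrow> z j \<in> col_span p \<psi>) \<Longrightarrow>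
      det (mat n n (\<lambda>(i, j). y j i)) ^ q * det (mat q q (\<lambda>(i, j). z j i)) ^ n \<in> X"
  shows "integral_closure X = integral_closure (ideal_mult (ideal_power I q) (ideal_power J n))"
    and "contains_rationals TYPE('a) \<Longrightarrow> X = ideal_mult (ideal_power I q) (ideal_power J n)"
proof -
  let ?G = "minors {..<m} {..<n} n \<phi>" and ?H = "minors {..<p} {..<q} q \<psi>"
  let ?PG = "(\<lambda>f. \<Prod>k<q. f k) ` Pi\<^sub>E {..<q} (\<lambda>_. ?G)" and ?PH = "(\<lambda>f. \<Prod>k<n. f k) ` Pi\<^sub>E {..<n} (\<lambda>_. ?H)"
  have GH: "finite ?G" "finite ?H" by (rule finite_minors; simp)+
  have gpow: "g ^ q * h ^ n \<in> X" if g: "g \<in> ?G" and h: "h \<in> ?H" for g h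
  proof -
    obtain y where y: "\<And>j. j < n \<Longrightarrow> y j \<in> col_span m \<phi>" "g = det (mat n n (\<lambda>(i, j). y j i))"
      using minorsE_col_span[OF g] by blast
    obtain z where z: "\<And>j. j < q \<Longrightarrow> z j \<in> col_span p \<psi>" "h = det (mat q q (\<lambda>(i, j). z j i))"
      using minorsE_col_span[OF h] by blast
    show ?thesis unfolding y(2) z(2) by (rule pow[OF y(1) z(1)])
  qed
  have gen: "ideal_mult (ideal_power I q) (ideal_power J n) = ideal_gen {x * y | x y. x \<in> ?PG \<and> y \<in> ?PH}"
    unfolding I_def J_def max_minor_ideal_lessThan ideal_power_ideal_gen by (rule ideal_mult_ideal_gen)
  show "integral_closure X = integral_closure (ideal_mult (ideal_power I q) (ideal_power J n))"
  proof (cases "q * n = 0")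
    case True
    have "1 \<in> X" using pow[of "\<lambda>_ _. 0" "\<lambda>_ _. 0"] col_span_0[of m \<phi>] col_span_0[of p \<psi>] True
      by (auto simp: det_dim_zero)
    then have "X = UNIV" by (rule is_ideal_eq_UNIV[OF X])
    then have "X = ideal_mult (ideal_power I q) (ideal_power J n)" using sub by blast
    then show ?thesis by simp
  next
    case False
    show ?thesis
    proof (rule integral_closure_eqI[OF X sub gen])
      have "{x * y | x y. x \<in> ?PG \<and> y \<in> ?PH} = (\<lambda>(x, y). x * y) ` (?PG \<times> ?PH)" by auto
      then show "finite {x * y | x y. x \<in> ?PG \<and> y \<in> ?PH}"
        using GH by (simp add: finite_PiE)
      fix x assume "x \<in> {x * y | x y. x \<in> ?PG \<and> y \<in> ?PH}"
      then obtain f h where x: "x = (\<Prod>k<q. f k) * (\<Prod>l<n. h l)"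
        and f: "f \<in> Pi\<^sub>E {..<q} (\<lambda>_. ?G)" and h: "h \<in> Pi\<^sub>E {..<n} (\<lambda>_. ?H)" by blast
      \<comment> \<open>Every pair (k, l) contributes \<open>f k ^ q * h l ^ n\<close>, which lies
        in X. Over all q * n pairs each factor of x is then raised exactly to the power q *
        n.\<close>
      have "x ^ (q * n) = (\<Prod>k<q. \<Prod>l<n. f k ^ q * h l ^ n)"
        unfolding x power_mult_distrib prod.distrib
        by (simp add: prod_power_distrib power_mult[symmetric] mult.commute)
      also have "\<dots> = (\<Prod>r<q * n. f (r div n) ^ q * h (r mod n) ^ n)"
        unfolding prod_lessThan_mult by (intro prod.cong refl) simp
      also have "\<dots> \<in> ideal_power X (q * n)"
      proof (rule prod_in_ideal_power, rule gpow)
        fix r assume r: "r < q * n"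
        then have "n > 0" by (cases n) auto
        then show "f (r div n) \<in> ?G" "h (r mod n) \<in> ?H"
          using f h less_mult_imp_div_less[OF r] by (auto simp: PiE_iff)
      qed
      finally show "x ^ (q * n) \<in> ideal_power X (q * n)" .
    qed (use False in simp)
  qed
  assume rat: "contains_rationals TYPE('a)"
  have "ideal_mult (ideal_power I q) (ideal_power J n) \<subseteq> X"
    unfolding gen
  proof (rule ideal_gen_minimal[OF _ X], clarify)
    fix f h assume f: "f \<in> Pi\<^sub>E {..<q} (\<lambda>_. ?G)" and h: "h \<in> Pi\<^sub>E {..<n} (\<lambda>_. ?H)"
    have f': "f k \<in> ?G" if "k < q" for k using f that by (auto simp: PiE_iff)
    have h': "h k \<in> ?H" if "k < n" for k using h that by (auto simp: PiE_iff)
    obtain v where v: "\<And>k j. k < q \<Longrightarrow> j < n \<Longrightarrow> v k j \<in> col_span m \<phi>"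
      "\<And>k. k < q \<Longrightarrow> f k = det (mat n n (\<lambda>(i, j). v k j i))"
      using minors_family_col_span[of q f m n \<phi>, OF f'] by blast
    obtain w where w: "\<And>k j. k < n \<Longrightarrow> j < q \<Longrightarrow> w k j \<in> col_span p \<psi>"
      "\<And>k. k < n \<Longrightarrow> h k = det (mat q q (\<lambda>(i, j). w k j i))"
      using minors_family_col_span[of n h p q \<psi>, OF h'] by blast
    \<comment> \<open>First polarization, in the columns of \<phi>, with the matrix z over the
      column span of \<psi> held fixed.\<close>
    have 1: "(\<Prod>k<q. f k) * det (mat q q (\<lambda>(i, j). z j i)) ^ n \<in> X"
      if z: "\<And>j. j < q \<Longrightarrow> z j \<in> col_span p \<psi>" for z
    proof -
      let ?X = "{x. x * det (mat q q (\<lambda>(i, j). z j i)) ^ n \<in> X}"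
      have "of_int (polarization_const n q) * (\<Prod>k<q. det (mat n n (\<lambda>(i, j). v k j i))) \<in> ?X"
        by (rule polarization[OF is_ideal_colon[OF X] col_span_0 col_span_add _ v(1)]) (use pow z in auto)
      then have "(\<Prod>k<q. det (mat n n (\<lambda>(i, j). v k j i))) \<in> ?X"
        by (rule contains_rationals_cancel[OF rat polarization_const_pos is_ideal_colon[OF X]])
      then show ?thesis using v(2) by simp
    qed
    \<comment> \<open>Second polarization, in the columns of \<psi>. Its hypothesis on n-th powers
      of determinants is what the first polarization established.\<close>
    let ?X = "{x. x * (\<Prod>k<q. f k) \<in> X}"
    have "of_int (polarization_const q n) * (\<Prod>k<n. det (mat q q (\<lambda>(i, j). w k j i))) \<in> ?X"
      by (rule polarization[OF is_ideal_colon[OF X] col_span_0 col_span_add _ w(1)])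
         (use 1 in \<open>auto simp: mult.commute\<close>)
    then have "(\<Prod>k<n. det (mat q q (\<lambda>(i, j). w k j i))) \<in> ?X"
      by (rule contains_rationals_cancel[OF rat polarization_const_pos is_ideal_colon[OF X]])
    then show "(\<Prod>k<q. f k) * (\<Prod>k<n. h k) \<in> X" using w(2) by (simp add: mult.commute)
  qed
  then show "X = ideal_mult (ideal_power I q) (ideal_power J n)" using sub by blast
qed

section \<open>Comparison of ideals for functors given by multilinear maps\<close>

lemma sum_words_Suc: "(\<Sum>w\<in>words n (Suc l). F w) = (\<Sum>k<n. \<Sum>w\<in>words n l. F (k # w))"
proof -
  have "bij_betw (\<lambda>(k, w). k # w) ({..<n} \<times> words n l) (words n (Suc l))"
    unfolding bij_betw_def
  proof
    show "(\<lambda>(k, w). k # w) ` ({..<n} \<times> words n l) = words n (Suc l)"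
    proof
      show "words n (Suc l) \<subseteq> (\<lambda>(k, w). k # w) ` ({..<n} \<times> words n l)"
        by (auto elim!: words_SucE)
    qed (auto simp: Cons_in_words_Suc)
  qed (auto simp: inj_on_def)
  from sum.reindex_bij_betw[OF this, of F] show ?thesis
    by (simp add: sum.cartesian_product case_prod_beta)
qed

lemma prod_sum_words:
  fixes F :: "nat \<Rightarrow> nat \<Rightarrow> 'a::comm_semiring_1"
  shows "(\<Prod>b<d. \<Sum>l<m. F b l) = (\<Sum>j\<in>words m d. \<Prod>b<d. F b (j ! b))"
proof (induction d arbitrary: F)
  case 0
  then show ?case by (simp add: words_0)
next
  case (Suc d)
  have "(\<Prod>b<Suc d. \<Sum>l<m. F b l) = (\<Sum>l<m. F 0 l) * (\<Prod>b<d. \<Sum>l<m. F (Suc b) l)"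
    by (simp add: prod.lessThan_Suc_shift del: prod.lessThan_Suc)
  also have "\<dots> = (\<Sum>l<m. \<Sum>j\<in>words m d. F 0 l * (\<Prod>b<d. F (Suc b) (j ! b)))"
    unfolding Suc[of "\<lambda>b. F (Suc b)"] by (rule sum_product)
  also have "\<dots> = (\<Sum>j\<in>words m (Suc d). \<Prod>b<Suc d. F b (j ! b))"
    unfolding sum_words_Suc by (simp add: prod.lessThan_Suc_shift del: prod.lessThan_Suc)
  finally show ?case .
qed

lemma multilinear_sum:
  fixes g :: "nat \<Rightarrow> nat \<Rightarrow> 'a::comm_ring_1"
  shows "multilinear n d \<mu> (\<lambda>b i. \<Sum>l<m. g b l * f l i) \<beta> =
    (\<Sum>j\<in>words m d. (\<Prod>b<d. g b (j ! b)) * multilinear n d \<mu> (\<lambda>b. f (j ! b)) \<beta>)"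
proof -
  have "multilinear n d \<mu> (\<lambda>b i. \<Sum>l<m. g b l * f l i) \<beta> =
      (\<Sum>w\<in>words n d. \<Sum>j\<in>words m d. (\<Prod>b<d. g b (j ! b)) * ((\<Prod>b<d. f (j ! b) (w ! b)) * of_int (\<mu> w \<beta>)))"
    unfolding multilinear_def prod_sum_words
    by (simp add: prod.distrib sum_distrib_right mult.assoc)
  also have "\<dots> = (\<Sum>j\<in>words m d. (\<Prod>b<d. g b (j ! b)) * multilinear n d \<mu> (\<lambda>b. f (j ! b)) \<beta>)"
    unfolding multilinear_def by (subst sum.swap) (simp add: sum_distrib_left)
  finally show ?thesis .
qed

context multilinear_functor
begin

context
  fixes m :: nat and \<phi> :: "(nat \<Rightarrow> 'a::comm_ring_1) \<Rightarrow> (nat \<Rightarrow> 'a)"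
    and B :: "'b set" and \<chi> :: "('b \<Rightarrow> 'a) \<Rightarrow> ('c \<Rightarrow> 'a)"
  assumes finite_B: "finite B"
    and cols: "\<forall>\<kappa>\<in>B. \<exists>j\<in>words m d. \<forall>\<beta>\<in>C.
      \<chi> (basis_vec \<kappa>) \<beta> = multilinear n d \<mu> (\<lambda>b. \<phi> (basis_vec (j ! b))) \<beta>"
    and spanned: "\<forall>j\<in>words m d. \<exists>x. \<forall>\<beta>\<in>C.
      multilinear n d \<mu> (\<lambda>b. \<phi> (basis_vec (j ! b))) \<beta> = (\<Sum>\<kappa>\<in>B. x \<kappa> * \<chi> (basis_vec \<kappa>) \<beta>)"
begin

text \<open>By \<open>cols\<close>, each column of a minor of \<chi> is a multilinear value at
  columns of \<phi>, so \<open>det_multilinear_in_ideal_power\<close> applies with the column span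
  of \<phi> as the set of vectors. The rows of a maximal minor enumerate all of C.\<close>

lemma max_minor_ideal_subset_power:
  "max_minor_ideal B C \<chi> \<subseteq> ideal_power (max_minor_ideal {..<m} {..<n} \<phi>) s"
  unfolding max_minor_ideal_def[of B] minor_ideal_def
proof (rule ideal_gen_minimal[OF _ is_ideal_ideal_power], rule subsetI)
  fix x assume "x \<in> minors B C (card C) \<chi>"
  then obtain \<rho> \<kappa> where x: "x = det (mat (card C) (card C) (\<lambda>(i, j). \<chi> (basis_vec (\<kappa> j)) (\<rho> i)))"
    and \<rho>: "\<rho> \<in> {..<card C} \<rightarrow> C" "inj_on \<rho> {..<card C}" and \<kappa>: "\<kappa> \<in> {..<card C} \<rightarrow> B"
    unfolding minors_def by blast
  have bij: "bij_betw \<rho> {..<card C} C"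
    unfolding bij_betw_def using \<rho> finite_C
    by (intro conjI card_subset_eq) (auto simp: card_image)
  let ?P = "\<lambda>c j. j \<in> words m d \<and> (\<forall>\<beta>\<in>C.
      \<chi> (basis_vec (\<kappa> c)) \<beta> = multilinear n d \<mu> (\<lambda>b. \<phi> (basis_vec (j ! b))) \<beta>)"
  define j where "j c = (SOME j. ?P c j)" for c
  have ex: "\<exists>j. ?P c j" if "c < card C" for c
    using cols \<kappa> that by blast
  have j: "?P c (j c)" if "c < card C" for c
    unfolding j_def using someI_ex[OF ex[OF that]] .
  have "x = det (mat (card C) (card C) (\<lambda>(r, c). multilinear n d \<mu> (\<lambda>b. \<phi> (basis_vec (j c ! b))) (\<rho> r)))"
    unfolding x using j \<rho> by (intro arg_cong[of _ _ det] eq_matI) auto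
  also have "\<dots> \<in> ideal_power (max_minor_ideal {..<m} {..<n} \<phi>) s"
  proof (rule det_multilinear_in_ideal_power[OF bij, where V = "col_span m \<phi>"])
    show "\<phi> (basis_vec (j c ! b)) \<in> col_span m \<phi>" if "c < card C" "b < d" for c b
      using nth_words_less[of "j c" m d b] j[OF that(1)] that(2) by (intro col_in_col_span) blast
  qed (rule det_col_span_in_max_minor_ideal)
  finally show "x \<in> ideal_power (max_minor_ideal {..<m} {..<n} \<phi>) s" .
qed

text \<open>By \<open>det_multilinear_basis\<close>, det(Y)^s is the determinant of the functor at
  Y. Expanding the columns of Y in those of \<phi> and applying \<open>spanned\<close> shows that
  each column of that matrix is a combination of columns of \<chi>.\<close>

lemma det_power_in_max_minor_ideal:
  assumes y: "\<And>j. j < n \<Longrightarrow> y j \<in> col_span m \<phi>"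
  shows "det (mat n n (\<lambda>(i, j). y j i)) ^ s \<in> max_minor_ideal B C \<chi>"
proof -
  obtain \<rho> where \<rho>: "bij_betw \<rho> {..<card C} C"
    using ex_bij_betw_nat_finite[OF finite_C] by (auto simp: lessThan_atLeast0)
  obtain g where g: "\<And>j. j < n \<Longrightarrow> y j = (\<lambda>i. \<Sum>l<m. g j l * \<phi> (basis_vec l) i)"
    using col_span_coeffs[of n y m \<phi>, OF y] by blast
  let ?P = "\<lambda>j x. \<forall>\<beta>\<in>C. multilinear n d \<mu> (\<lambda>b. \<phi> (basis_vec (j ! b))) \<beta> = (\<Sum>\<kappa>\<in>B. x \<kappa> * \<chi> (basis_vec \<kappa>) \<beta>)"
  define x where "x j = (SOME x. ?P j x)" for j
  have x: "?P j (x j)" if "j \<in> words m d" for j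
    unfolding x_def using someI_ex[OF spanned[rule_format, OF that]] .
  define X where "X c \<kappa> = (\<Sum>j\<in>words m d. (\<Prod>b<d. g (can (\<rho> c) ! b) (j ! b)) * x j \<kappa>)" for c \<kappa>
  have "det (mat (card C) (card C) (\<lambda>(r, c). multilinear n d \<mu> (\<lambda>b. y (can (\<rho> c) ! b)) (\<rho> r)))
      \<in> minor_ideal B C (card C) \<chi>"
  proof (rule det_cols_in_minor_ideal[OF finite_B, where x = X])
    show "\<rho> \<in> {..<card C} \<rightarrow> C" "inj_on \<rho> {..<card C}" using \<rho> by (auto simp: bij_betw_def)
    fix r c assume rc: "r < card C" "c < card C"
    have \<rho>C: "\<rho> r \<in> C" "\<rho> c \<in> C" using bij_betwE[OF \<rho>] rc by auto
    have less: "can (\<rho> c) ! b < n" if "b < d" for b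
      by (rule nth_words_less[OF can_words[OF \<rho>C(2)] that])
    have "multilinear n d \<mu> (\<lambda>b. y (can (\<rho> c) ! b)) (\<rho> r) =
        multilinear n d \<mu> (\<lambda>b i. \<Sum>l<m. g (can (\<rho> c) ! b) l * \<phi> (basis_vec l) i) (\<rho> r)"
      unfolding multilinear_def using g[OF less]
      by (intro sum.cong refl arg_cong2[of _ _ _ _ "(*)"] prod.cong) simp
    also have "\<dots> = (\<Sum>j\<in>words m d. (\<Prod>b<d. g (can (\<rho> c) ! b) (j ! b)) *
        (\<Sum>\<kappa>\<in>B. x j \<kappa> * \<chi> (basis_vec \<kappa>) (\<rho> r)))"
      unfolding multilinear_sum using x \<rho>C(1) by (intro sum.cong refl arg_cong2[of _ _ _ _ "(*)"]) blast
    also have "\<dots> = (\<Sum>\<kappa>\<in>B. X c \<kappa> * \<chi> (basis_vec \<kappa>) (\<rho> r))"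
      unfolding X_def sum_distrib_left sum_distrib_right mult.assoc by (rule sum.swap)
    finally show "multilinear n d \<mu> (\<lambda>b. y (can (\<rho> c) ! b)) (\<rho> r) =
        (\<Sum>\<kappa>\<in>B. X c \<kappa> * \<chi> (basis_vec \<kappa>) (\<rho> r))" .
  qed
  then show ?thesis unfolding det_multilinear_basis[OF \<rho>] by (simp add: max_minor_ideal_def)
qed

lemma functor_comparison:
  shows "max_minor_ideal B C \<chi> \<subseteq> ideal_power (max_minor_ideal {..<m} {..<n} \<phi>) s"
    and "integral_closure (max_minor_ideal B C \<chi>) =
      integral_closure (ideal_power (max_minor_ideal {..<m} {..<n} \<phi>) s)"
    and "contains_rationals TYPE('a) \<Longrightarrow>
      max_minor_ideal B C \<chi> = ideal_power (max_minor_ideal {..<m} {..<n} \<phi>) s"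
proof -
  have X: "is_ideal (max_minor_ideal B C \<chi>)"
    by (simp add: max_minor_ideal_def minor_ideal_def is_ideal_ideal_gen)
  note * = comparison_with_power[OF X max_minor_ideal_subset_power det_power_in_max_minor_ideal]
  show "max_minor_ideal B C \<chi> \<subseteq> ideal_power (max_minor_ideal {..<m} {..<n} \<phi>) s"
    by (rule max_minor_ideal_subset_power)
  show "integral_closure (max_minor_ideal B C \<chi>) =
      integral_closure (ideal_power (max_minor_ideal {..<m} {..<n} \<phi>) s)" by (rule *(1))
  show "max_minor_ideal B C \<chi> = ideal_power (max_minor_ideal {..<m} {..<n} \<phi>) s"
    if "contains_rationals TYPE('a)" by (rule *(2)[OF _ that])
qed

end

end

section \<open>Symmetric powers\<close>

abbreviation unit_exponent :: "nat \<Rightarrow> nat \<Rightarrow>\<^sub>0 nat" where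
  "unit_exponent i \<equiv> Poly_Mapping.single i 1"

definition word_exponent :: "nat list \<Rightarrow> nat \<Rightarrow>\<^sub>0 nat" where
  "word_exponent w = (\<Sum>i\<leftarrow>w. unit_exponent i)"

lemma word_exponent_simps [simp]:
  "word_exponent [] = 0"
  "word_exponent (i # w) = unit_exponent i + word_exponent w"
  "word_exponent (u @ w) = word_exponent u + word_exponent w"
  by (simp_all add: word_exponent_def)

lemma lookup_word_exponent: "Poly_Mapping.lookup (word_exponent w) i = count_list w i"
  by (induction w) (auto simp: lookup_add lookup_single when_def)

lemma keys_word_exponent: "Poly_Mapping.keys (word_exponent w) = set w"
  by (auto simp: in_keys_iff lookup_word_exponent count_list_0_iff)

lemma word_exponent_in_sym_index: "w \<in> words n d \<Longrightarrow> word_exponent w \<in> sym_index n d"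
  using sum_count_set[of w "{..<n}"]
  by (simp add: words_def sym_index_def keys_word_exponent lookup_word_exponent)

definition exponent_word :: "nat \<Rightarrow> (nat \<Rightarrow>\<^sub>0 nat) \<Rightarrow> nat list" where
  "exponent_word n \<beta> = concat (map (\<lambda>j. replicate (Poly_Mapping.lookup \<beta> j) j) [0..<n])"

lemma count_exponent_word:
  "count_list (exponent_word n \<beta>) i = (if i < n then Poly_Mapping.lookup \<beta> i else 0)"
proof (induction n)
  case (Suc n)
  have "count_list (replicate k j) i = (if i = j then k else 0)" for k j :: nat
    by (induction k) auto
  then show ?case using Suc by (auto simp: exponent_word_def)
qed (simp add: exponent_word_def)

lemma word_exponent_exponent_word:
  assumes "\<beta> \<in> sym_index n d"
  shows "word_exponent (exponent_word n \<beta>) = \<beta>"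
proof (rule poly_mapping_eqI)
  fix i
  show "Poly_Mapping.lookup (word_exponent (exponent_word n \<beta>)) i = Poly_Mapping.lookup \<beta> i"
    using assms by (auto simp: lookup_word_exponent count_exponent_word sym_index_def in_keys_iff)
qed

lemma exponent_word_in_words:
  assumes "\<beta> \<in> sym_index n d"
  shows "exponent_word n \<beta> \<in> words n d"
proof -
  have set: "set (exponent_word n \<beta>) \<subseteq> {..<n}" by (auto simp: exponent_word_def)
  then have "length (exponent_word n \<beta>) = (\<Sum>i<n. count_list (exponent_word n \<beta>) i)"
    using sum_count_set[of "exponent_word n \<beta>" "{..<n}"] by simp
  also have "\<dots> = d" using assms by (simp add: count_exponent_word sym_index_def)
  finally show ?thesis using set by (simp add: words_def)
qed

lemma finite_sym_index: "finite (sym_index n d)"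
proof (rule finite_surj[OF finite_words])
  show "sym_index n d \<subseteq> word_exponent ` words n d"
    using word_exponent_exponent_word[symmetric] exponent_word_in_words by (intro subsetI image_eqI)
qed

lemma card_sym_index: "card (sym_index n d) = (d + n - 1) choose d"
proof -
  let ?f = "\<lambda>\<beta>. map (Poly_Mapping.lookup \<beta>) [0..<n]"
  have "bij_betw ?f (sym_index n d) {l. length l = n \<and> sum_list l = d}"
    unfolding bij_betw_def
  proof
    show "inj_on ?f (sym_index n d)"
    proof (rule inj_onI, rule poly_mapping_eqI)
      fix \<beta> \<gamma> i assume \<beta>: "\<beta> \<in> sym_index n d" "\<gamma> \<in> sym_index n d" and eq: "?f \<beta> = ?f \<gamma>"
      show "Poly_Mapping.lookup \<beta> i = Poly_Mapping.lookup \<gamma> i"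
      proof (cases "i < n")
        case True
        then show ?thesis using arg_cong[OF eq, of "\<lambda>l. l ! i"] by simp
      next
        case False
        then have "i \<notin> Poly_Mapping.keys \<beta>" "i \<notin> Poly_Mapping.keys \<gamma>" using \<beta> by (auto simp: sym_index_def)
        then show ?thesis by (simp add: in_keys_iff)
      qed
    qed
    show "?f ` sym_index n d = {l. length l = n \<and> sum_list l = d}"
    proof
      show "?f ` sym_index n d \<subseteq> {l. length l = n \<and> sum_list l = d}"
        by (auto simp: sym_index_def sum_list_sum_nth lessThan_atLeast0)
      show "{l. length l = n \<and> sum_list l = d} \<subseteq> ?f ` sym_index n d"
      proof clarify
        fix l :: "nat list" assume n: "n = length l" and d: "d = sum_list l"
        define \<beta> where "\<beta> = (\<Sum>j<length l. Poly_Mapping.single j (l ! j))"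
        have look: "Poly_Mapping.lookup \<beta> i = (if i < length l then l ! i else 0)" for i
          by (simp add: \<beta>_def lookup_sum lookup_single when_def)
        have "\<beta> \<in> sym_index (length l) (sum_list l)"
          by (auto simp: sym_index_def in_keys_iff look sum_list_sum_nth lessThan_atLeast0 split: if_splits)
        moreover have "l = map (Poly_Mapping.lookup \<beta>) [0..<length l]"
          by (intro nth_equalityI) (auto simp: look)
        ultimately show "l \<in> (\<lambda>\<beta>. map (Poly_Mapping.lookup \<beta>) [0..<length l]) ` sym_index (length l) (sum_list l)"
          by blast
      qed
    qed
  qed
  from bij_betw_same_card[OF this] show ?thesis unfolding card_length_sum_list .
qed

text \<open>The origin of the exponent s: the total degree of one variable over all monomials of a
  given degree. Dividing the monomials that contain this variable by it lowers the degree by one,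
  and Pascal's rule solves the resulting recursion.\<close>

lemma sum_lookup_sym_index_Suc:
  assumes i: "i < n"
  shows "(\<Sum>\<beta>\<in>sym_index n (Suc d). Poly_Mapping.lookup \<beta> i) = (n + d) choose d"
proof (induction d)
  have step: "(\<Sum>\<beta>\<in>sym_index n (Suc d). Poly_Mapping.lookup \<beta> i) =
      (\<Sum>\<beta>\<in>sym_index n d. Poly_Mapping.lookup \<beta> i) + card (sym_index n d)" for d
  proof -
    let ?S = "{\<beta> \<in> sym_index n (Suc d). Poly_Mapping.lookup \<beta> i > 0}"
    have "(\<Sum>\<beta>\<in>sym_index n (Suc d). Poly_Mapping.lookup \<beta> i) = (\<Sum>\<beta>\<in>?S. Poly_Mapping.lookup \<beta> i)"
      using finite_sym_index by (intro sum.mono_neutral_right) auto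
    also have "\<dots> = (\<Sum>\<gamma>\<in>sym_index n d. Poly_Mapping.lookup \<gamma> i + 1)"
    proof (rule sum.reindex_bij_witness[of _ "\<lambda>\<gamma>. \<gamma> + unit_exponent i" "\<lambda>\<beta>. \<beta> - unit_exponent i"])
      fix \<beta> assume \<beta>: "\<beta> \<in> ?S"
      show eq: "\<beta> - unit_exponent i + unit_exponent i = \<beta>"
        using \<beta> by (intro poly_mapping_eqI) (auto simp: lookup_add lookup_minus lookup_single when_def)
      have "(\<Sum>j<n. Poly_Mapping.lookup \<beta> j) =
          (\<Sum>j<n. Poly_Mapping.lookup (\<beta> - unit_exponent i) j) + (\<Sum>j<n. if j = i then 1 else 0)"
        unfolding sum.distrib[symmetric] using \<beta>
        by (intro sum.cong) (auto simp: lookup_minus lookup_single when_def)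
      then have "(\<Sum>j<n. Poly_Mapping.lookup (\<beta> - unit_exponent i) j) = d"
        using \<beta> i by (simp add: sym_index_def)
      moreover have "Poly_Mapping.keys (\<beta> - unit_exponent i) \<subseteq> Poly_Mapping.keys \<beta>"
        by (auto simp: in_keys_iff lookup_minus)
      then have "Poly_Mapping.keys (\<beta> - unit_exponent i) \<subseteq> {..<n}"
        using \<beta> by (auto simp: sym_index_def)
      ultimately show "\<beta> - unit_exponent i \<in> sym_index n d" by (simp add: sym_index_def)
      show "Poly_Mapping.lookup (\<beta> - unit_exponent i) i + 1 = Poly_Mapping.lookup \<beta> i"
        using \<beta> by (simp add: lookup_minus lookup_single)
    next
      fix \<gamma> assume \<gamma>: "\<gamma> \<in> sym_index n d"
      show "\<gamma> + unit_exponent i - unit_exponent i = \<gamma>" by simp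
      have "(\<Sum>j<n. Poly_Mapping.lookup (\<gamma> + unit_exponent i) j) =
          (\<Sum>j<n. Poly_Mapping.lookup \<gamma> j) + (\<Sum>j<n. if j = i then 1 else 0)"
        unfolding sum.distrib[symmetric] by (intro sum.cong) (auto simp: lookup_add lookup_single when_def)
      then have "(\<Sum>j<n. Poly_Mapping.lookup (\<gamma> + unit_exponent i) j) = Suc d"
        using \<gamma> i by (simp add: sym_index_def)
      moreover have "Poly_Mapping.keys (\<gamma> + unit_exponent i) \<subseteq> insert i (Poly_Mapping.keys \<gamma>)"
        by (auto simp: in_keys_iff lookup_add lookup_single when_def split: if_splits)
      then have "Poly_Mapping.keys (\<gamma> + unit_exponent i) \<subseteq> {..<n}"
        using \<gamma> i by (auto simp: sym_index_def)
      ultimately show "\<gamma> + unit_exponent i \<in> ?S"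
        by (simp add: sym_index_def lookup_add lookup_single)
    qed
    finally show ?thesis by (simp only: sum.distrib) simp
  qed
  {
    case 0
    have "(\<Sum>\<beta>\<in>sym_index n 0. Poly_Mapping.lookup \<beta> i) = 0"
      using i by (auto simp: sym_index_def)
    then show ?case using step[of 0] by (simp add: card_sym_index)
  next
    case (Suc d)
    have "card (sym_index n (Suc d)) = (n + d) choose Suc d" by (simp add: card_sym_index add.commute)
    then show ?case using step[of "Suc d"] Suc by simp
  }
qed

lemma sum_lookup_sym_index:
  assumes "i < n" "d \<ge> 1"
  shows "(\<Sum>\<beta>\<in>sym_index n d. Poly_Mapping.lookup \<beta> i) = (n + d - 1) choose (d - 1)"
  using sum_lookup_sym_index_Suc[OF assms(1), of "d - 1"] assms(2) by simp

definition sym_coeff :: "nat list \<Rightarrow> (nat \<Rightarrow>\<^sub>0 nat) \<Rightarrow> int" where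
  "sym_coeff w \<beta> = of_bool (word_exponent w = \<beta>)"

lemma word_exponent_update:
  assumes "b < length w" "w ! b = i"
  shows "unit_exponent i + word_exponent (w[b := j]) = unit_exponent j + word_exponent w"
proof -
  have "w = take b w @ i # drop (Suc b) w" using id_take_nth_drop[OF assms(1)] assms(2) by simp
  then have "word_exponent w = word_exponent (take b w) + (unit_exponent i + word_exponent (drop (Suc b) w))"
    by (metis word_exponent_simps(2,3))
  moreover have "word_exponent (w[b := j]) =
      word_exponent (take b w) + (unit_exponent j + word_exponent (drop (Suc b) w))"
    using upd_conv_take_nth_drop[OF assms(1), of j] by simp
  ultimately show ?thesis by (simp add: ac_simps)
qed

text \<open>On polynomials the substitution of \<open>Suc i\<close> for \<open>i\<close> is the
  operator X_(i+1) d/dX_i, whence the factor given by the exponent of X_i. The additive equation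
  between exponents expresses \<beta> = \<gamma> - e_i + e_(i+1) without truncated
  subtraction.\<close>

lemma raise_sym_coeff:
  assumes w: "w \<in> words n d"
  shows "raise i (\<lambda>w. sym_coeff w \<beta>) w = (\<Sum>\<gamma>\<in>sym_index n d.
    (of_bool (unit_exponent i + \<beta> = unit_exponent (Suc i) + \<gamma>) * int (Poly_Mapping.lookup \<gamma> i)) * sym_coeff w \<gamma>)"
proof -
  let ?E = "unit_exponent i + \<beta> = unit_exponent (Suc i) + word_exponent w"
  have upd: "word_exponent (w[b := Suc i]) = \<beta> \<longleftrightarrow> ?E" if "b < length w" "w ! b = i" for b
    using word_exponent_update[OF that, of "Suc i"] by (metis add_left_cancel)
  have "raise i (\<lambda>w. sym_coeff w \<beta>) w = (\<Sum>b<length w. of_bool (w ! b = i) * of_bool ?E)"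
    unfolding raise_def sym_coeff_def by (intro sum.cong refl) (auto simp: upd)
  also have "\<dots> = int (count_list w i) * of_bool ?E"
  proof -
    have "int (count_list w i) = (\<Sum>b<length w. of_bool (w ! b = i))"
      using Int_def[of "{..<length w}" "{b. w ! b = i}"]
      by (simp add: count_list_eq_card of_bool_def sum.If_cases)
    then show ?thesis by (simp add: sum_distrib_right)
  qed
  also have "\<dots> = (\<Sum>\<gamma>\<in>sym_index n d. if \<gamma> = word_exponent w
      then of_bool (unit_exponent i + \<beta> = unit_exponent (Suc i) + \<gamma>) * int (Poly_Mapping.lookup \<gamma> i) else 0)"
    using word_exponent_in_sym_index[OF w] finite_sym_index by (simp add: lookup_word_exponent)
  also have "\<dots> = (\<Sum>\<gamma>\<in>sym_index n d.
    (of_bool (unit_exponent i + \<beta> = unit_exponent (Suc i) + \<gamma>) * int (Poly_Mapping.lookup \<gamma> i)) * sym_coeff w \<gamma>)"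
    by (intro sum.cong refl) (auto simp: sym_coeff_def)
  finally show ?thesis .
qed

lemma multilinear_functor_sym:
  assumes d: "d \<ge> 1"
  shows "multilinear_functor n d ((n + d - 1) choose (d - 1)) (sym_index n d) sym_coeff
    (\<lambda>i \<beta> \<gamma>. of_bool (unit_exponent i + \<beta> = unit_exponent (Suc i) + \<gamma>) * int (Poly_Mapping.lookup \<gamma> i))
    Poly_Mapping.lookup (exponent_word n)"
proof
  show "finite (sym_index n d)" by (rule finite_sym_index)
  show "raise i (\<lambda>w. sym_coeff w \<beta>) w = (\<Sum>\<gamma>\<in>sym_index n d.
    (of_bool (unit_exponent i + \<beta> = unit_exponent (Suc i) + \<gamma>) * int (Poly_Mapping.lookup \<gamma> i)) * sym_coeff w \<gamma>)"
    if "w \<in> words n d" for w i \<beta> by (rule raise_sym_coeff[OF that])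
  show "of_bool (unit_exponent i + \<beta> = unit_exponent (Suc i) + \<beta>) * int (Poly_Mapping.lookup \<beta> i) = 0" for i \<beta>
  proof -
    have "unit_exponent i \<noteq> unit_exponent (Suc i)"
    proof
      assume "unit_exponent i = unit_exponent (Suc i)"
      from arg_cong[OF this, of "\<lambda>\<alpha>. Poly_Mapping.lookup \<alpha> i"] show False by (simp add: lookup_single)
    qed
    then show ?thesis by simp
  qed
  show "count_list w i = Poly_Mapping.lookup \<beta> i" if "sym_coeff w \<beta> \<noteq> 0" for w i \<beta>
    using that by (auto simp: sym_coeff_def lookup_word_exponent)
  show "(\<Sum>\<beta>\<in>sym_index n d. Poly_Mapping.lookup \<beta> i) = (n + d - 1) choose (d - 1)" if "i < n" for i
    by (rule sum_lookup_sym_index[OF that d])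
  show "exponent_word n \<beta> \<in> words n d" if "\<beta> \<in> sym_index n d" for \<beta>
    by (rule exponent_word_in_words[OF that])
  show "sym_coeff (exponent_word n \<gamma>) \<beta> = of_bool (\<beta> = \<gamma>)"
    if "\<beta> \<in> sym_index n d" "\<gamma> \<in> sym_index n d" for \<beta> \<gamma>
    using word_exponent_exponent_word[OF that(2)] by (auto simp: sym_coeff_def)
qed

lemma prod_nth_eq_prod_count:
  fixes f :: "nat \<Rightarrow> 'a::comm_monoid_mult"
  assumes "set w \<subseteq> {..<m}"
  shows "(\<Prod>b<length w. f (w ! b)) = (\<Prod>j<m. f j ^ count_list w j)"
  using assms
proof (induction w)
  case (Cons k w)
  have "(\<Prod>j<m. f j ^ count_list (k # w) j) = (\<Prod>j<m. (if j = k then f j else 1) * f j ^ count_list w j)"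
    by (intro prod.cong) auto
  also have "\<dots> = f k * (\<Prod>j<m. f j ^ count_list w j)"
    using Cons.prems by (simp add: prod.distrib)
  also have "\<dots> = (\<Prod>b<length (k # w). f ((k # w) ! b))"
    using Cons by (simp add: prod.lessThan_Suc_shift del: prod.lessThan_Suc)
  finally show ?case ..
qed simp

lemma lookup_prod_linear_form:
  fixes v :: "nat \<Rightarrow> nat \<Rightarrow> 'a::comm_ring_1"
  shows "Poly_Mapping.lookup (\<Prod>b<d. linear_form n (v b)) \<beta> = multilinear n d sym_coeff v \<beta>"
proof -
  have prod_single: "(\<Prod>b<length w. Poly_Mapping.single (unit_exponent (w ! b)) (x b)) =
      Poly_Mapping.single (word_exponent w) (\<Prod>b<length w. x b)" for w and x :: "nat \<Rightarrow> 'a"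
    by (induction w arbitrary: x)
       (simp_all add: prod.lessThan_Suc_shift mult_single del: prod.lessThan_Suc)
  have "(\<Prod>b<d. linear_form n (v b)) =
      (\<Sum>w\<in>words n d. \<Prod>b<d. Poly_Mapping.single (unit_exponent (w ! b)) (v b (w ! b)))"
    unfolding linear_form_def by (rule prod_sum_words)
  also have "\<dots> = (\<Sum>w\<in>words n d. Poly_Mapping.single (word_exponent w) (\<Prod>b<d. v b (w ! b)))"
  proof (intro sum.cong refl)
    fix w assume "w \<in> words n d"
    then have "length w = d" by (simp add: words_def)
    then show "(\<Prod>b<d. Poly_Mapping.single (unit_exponent (w ! b)) (v b (w ! b))) =
        Poly_Mapping.single (word_exponent w) (\<Prod>b<d. v b (w ! b))"
      using prod_single[of w "\<lambda>b. v b (w ! b)"] by simp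
  qed
  finally show ?thesis
    by (auto simp: multilinear_def lookup_sum lookup_single when_def sym_coeff_def intro!: sum.cong)
qed

lemma sym_power_map_basis_vec:
  assumes j: "j \<in> words m d"
  shows "sym_power_map m n d \<phi> (basis_vec (word_exponent j)) \<beta> =
    multilinear n d sym_coeff (\<lambda>b. \<phi> (basis_vec (j ! b))) \<beta>"
proof -
  have "sym_power_map m n d \<phi> (basis_vec (word_exponent j)) =
      Poly_Mapping.lookup (\<Prod>i<m. linear_form n (\<phi> (basis_vec i)) ^ count_list j i)"
    unfolding sym_power_map_def
    by (simp add: lin_extend_basis_vec[OF finite_sym_index word_exponent_in_sym_index[OF j]] lookup_word_exponent)
  also have "(\<Prod>i<m. linear_form n (\<phi> (basis_vec i)) ^ count_list j i) =
      (\<Prod>b<d. linear_form n (\<phi> (basis_vec (j ! b))))"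
    using prod_nth_eq_prod_count[of j m "\<lambda>i. linear_form n (\<phi> (basis_vec i))"] j by (simp add: words_def)
  finally show ?thesis by (simp add: lookup_prod_linear_form)
qed

lemma sym_power_comparison:
  fixes \<phi> :: "(nat \<Rightarrow> 'a::comm_ring_1) \<Rightarrow> (nat \<Rightarrow> 'a)" and m n d :: nat
  defines "I \<equiv> max_minor_ideal {..<m} {..<n} \<phi>"
    and "IS \<equiv> max_minor_ideal (sym_index m d) (sym_index n d) (sym_power_map m n d \<phi>)"
    and "s \<equiv> (n + d - 1) choose (d - 1)"
  assumes d: "d \<ge> 1"
  shows "IS \<subseteq> ideal_power I s" and "integral_closure IS = integral_closure (ideal_power I s)"
    and "contains_rationals TYPE('a) \<Longrightarrow> IS = ideal_power I s"
proof -
  interpret multilinear_functor n d s "sym_index n d" sym_coeff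
    "\<lambda>i \<beta> \<gamma>. of_bool (unit_exponent i + \<beta> = unit_exponent (Suc i) + \<gamma>) * int (Poly_Mapping.lookup \<gamma> i)"
    Poly_Mapping.lookup "exponent_word n"
    unfolding s_def by (rule multilinear_functor_sym[OF d])
  have cols: "\<forall>\<kappa>\<in>sym_index m d. \<exists>j\<in>words m d. \<forall>\<beta>\<in>sym_index n d.
      sym_power_map m n d \<phi> (basis_vec \<kappa>) \<beta> = multilinear n d sym_coeff (\<lambda>b. \<phi> (basis_vec (j ! b))) \<beta>"
  proof (intro ballI bexI)
    fix \<kappa> \<beta> assume \<kappa>: "\<kappa> \<in> sym_index m d"
    show "sym_power_map m n d \<phi> (basis_vec \<kappa>) \<beta> =
        multilinear n d sym_coeff (\<lambda>b. \<phi> (basis_vec (exponent_word m \<kappa> ! b))) \<beta>"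
      using sym_power_map_basis_vec[OF exponent_word_in_words[OF \<kappa>]]
      by (simp only: word_exponent_exponent_word[OF \<kappa>])
  qed (rule exponent_word_in_words)
  have spanned: "\<forall>j\<in>words m d. \<exists>x. \<forall>\<beta>\<in>sym_index n d.
      multilinear n d sym_coeff (\<lambda>b. \<phi> (basis_vec (j ! b))) \<beta> =
      (\<Sum>\<kappa>\<in>sym_index m d. x \<kappa> * sym_power_map m n d \<phi> (basis_vec \<kappa>) \<beta>)"
  proof (intro ballI exI)
    fix j \<beta> assume j: "j \<in> words m d"
    have "(\<Sum>\<kappa>\<in>sym_index m d. of_bool (\<kappa> = word_exponent j) * sym_power_map m n d \<phi> (basis_vec \<kappa>) \<beta>) =
        (\<Sum>\<kappa>\<in>sym_index m d. if \<kappa> = word_exponent j then sym_power_map m n d \<phi> (basis_vec \<kappa>) \<beta> else 0)"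
      by (intro sum.cong) auto
    then show "multilinear n d sym_coeff (\<lambda>b. \<phi> (basis_vec (j ! b))) \<beta> =
        (\<Sum>\<kappa>\<in>sym_index m d. of_bool (\<kappa> = word_exponent j) * sym_power_map m n d \<phi> (basis_vec \<kappa>) \<beta>)"
      using word_exponent_in_sym_index[OF j] finite_sym_index sym_power_map_basis_vec[OF j, of n \<phi> \<beta>] by simp
  qed
  note * = functor_comparison[of "sym_index m d" m "sym_power_map m n d \<phi>" \<phi>, OF finite_sym_index cols spanned]
  show "IS \<subseteq> ideal_power I s" unfolding IS_def I_def by (rule *(1))
  show "integral_closure IS = integral_closure (ideal_power I s)" unfolding IS_def I_def by (rule *(2))
  show "IS = ideal_power I s" if "contains_rationals TYPE('a)" unfolding IS_def I_def by (rule *(3)[OF that])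
qed

section \<open>Exterior powers\<close>

lemma mem_ext_index: "I \<in> ext_index n d \<longleftrightarrow> I \<subseteq> {..<n} \<and> card I = d"
  by (simp add: ext_index_def)

lemma finite_ext_index_member: "I \<in> ext_index n d \<Longrightarrow> finite I"
  by (auto simp: ext_index_def intro: finite_subset)

lemma finite_ext_index: "finite (ext_index n d)"
  by (rule finite_subset[of _ "Pow {..<n}"]) (auto simp: ext_index_def)

lemma length_ext_index: "I \<in> ext_index n d \<Longrightarrow> length (sorted_list_of_set I) = d"
  by (simp add: ext_index_def)

lemma set_ext_index: "I \<in> ext_index n d \<Longrightarrow> set (sorted_list_of_set I) = I"
  by (simp add: finite_ext_index_member)

lemma sorted_list_in_words: "I \<in> ext_index n d \<Longrightarrow> sorted_list_of_set I \<in> words n d"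
  by (simp add: words_def set_ext_index length_ext_index) (simp add: ext_index_def)

lemma nth_sorted_list_remove:
  assumes "finite I" "a < card I" "k < card I - 1"
  shows "sorted_list_of_set (I - {sorted_list_of_set I ! a}) ! k =
    sorted_list_of_set I ! (if k < a then k else Suc k)"
proof -
  let ?xs = "sorted_list_of_set I"
  have len: "length ?xs = card I" by simp
  have xs: "?xs = take a ?xs @ ?xs ! a # drop (Suc a) ?xs"
    using id_take_nth_drop[of a ?xs] assms(2) by simp
  have notin: "?xs ! a \<notin> set (take a ?xs)"
  proof
    assume "?xs ! a \<in> set (take a ?xs)"
    then obtain k where "k < a" "?xs ! k = ?xs ! a" using assms(2) by (auto simp: in_set_conv_nth)
    then show False using nth_eq_iff_index_eq[of ?xs k a] assms(2) by simp
  qed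
  have "sorted_list_of_set (I - {?xs ! a}) = remove1 (?xs ! a) ?xs"
    by (rule sorted_list_of_set_remove[OF assms(1)])
  also have "\<dots> = remove1 (?xs ! a) (take a ?xs @ ?xs ! a # drop (Suc a) ?xs)"
    using xs by (rule arg_cong)
  also have "\<dots> = take a ?xs @ drop (Suc a) ?xs"
    using notin by (simp add: remove1_append)
  finally show ?thesis using assms by (auto simp: nth_append)
qed

lemma card_less_sorted_list_nth:
  assumes "finite I" "a < card I"
  shows "card {b \<in> I. b < sorted_list_of_set I ! a} = a"
proof -
  let ?xs = "sorted_list_of_set I"
  have "{b \<in> I. b < ?xs ! a} = (\<lambda>k. ?xs ! k) ` {..<a}"
  proof
    show "{b \<in> I. b < ?xs ! a} \<subseteq> (\<lambda>k. ?xs ! k) ` {..<a}"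
    proof
      fix b assume b: "b \<in> {b \<in> I. b < ?xs ! a}"
      then have "b \<in> set ?xs" using assms(1) by simp
      then obtain k where k: "k < card I" "b = ?xs ! k" by (auto simp: in_set_conv_nth)
      then have "k < a"
        using b sorted_wrt_nth_less[of "(<)" ?xs a k] assms by (cases k a rule: linorder_cases) auto
      then show "b \<in> (\<lambda>k. ?xs ! k) ` {..<a}" using k(2) by blast
    qed
    show "(\<lambda>k. ?xs ! k) ` {..<a} \<subseteq> {b \<in> I. b < ?xs ! a}"
    proof
      fix b assume "b \<in> (\<lambda>k. ?xs ! k) ` {..<a}"
      then obtain k where k: "k < a" "b = ?xs ! k" by auto
      then have "b \<in> set ?xs" using assms(2) by simp
      then show "b \<in> {b \<in> I. b < ?xs ! a}"
        using sorted_wrt_nth_less[of "(<)" ?xs k a] k assms by simp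
    qed
  qed
  moreover have "inj_on (\<lambda>k. ?xs ! k) {..<a}"
    using assms(2) by (auto simp: inj_on_def nth_eq_iff_index_eq)
  ultimately show ?thesis by (simp add: card_image)
qed

text \<open>Only singletons contribute on the left. The number of elements of I below its a-th
  element is a, so the sign in \<open>wedge\<close> becomes the sign of a cofactor expansion along
  the first column.\<close>

lemma wedge_ext_vec:
  fixes v :: "nat \<Rightarrow> 'a::comm_ring_1"
  assumes I: "I \<subseteq> {..<n}"
  shows "wedge (ext_vec n v) g I =
    (\<Sum>a<card I. (-1) ^ a * v (sorted_list_of_set I ! a) * g (I - {sorted_list_of_set I ! a}))"
proof -
  let ?xs = "sorted_list_of_set I"
  let ?s = "\<lambda>A. (-1) ^ card {(a, b). a \<in> A \<and> b \<in> I - A \<and> b < a} :: 'a"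
  have fin: "finite I" using I finite_subset by auto
  have single: "ext_vec n v {x} = v x" if "x < n" for x
  proof -
    have "ext_vec n v {x} = (\<Sum>i<n. if i = x then v i else 0)"
      unfolding ext_vec_def basis_vec_def by (intro sum.cong) auto
    then show ?thesis using that by simp
  qed
  have zero: "ext_vec n v A = 0" if "\<And>x. A \<noteq> {x}" for A
    using that by (simp add: ext_vec_def basis_vec_def)
  have "wedge (ext_vec n v) g I = (\<Sum>A\<in>(\<lambda>x. {x}) ` I. ?s A * ext_vec n v A * g (I - A))"
    unfolding wedge_def using fin
  proof (intro sum.mono_neutral_right)
    show "\<forall>A\<in>Pow I - (\<lambda>x. {x}) ` I. ?s A * ext_vec n v A * g (I - A) = 0"
    proof
      fix A assume A: "A \<in> Pow I - (\<lambda>x. {x}) ` I"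
      then have "A \<noteq> {x}" for x by auto
      then show "?s A * ext_vec n v A * g (I - A) = 0" using zero[of A] by simp
    qed
  qed auto
  also have "\<dots> = (\<Sum>x\<in>I. ?s {x} * ext_vec n v {x} * g (I - {x}))"
    by (subst sum.reindex) (auto simp: inj_on_def)
  also have "\<dots> = (\<Sum>x\<in>I. (-1) ^ card {b \<in> I. b < x} * v x * g (I - {x}))"
  proof (intro sum.cong refl)
    fix x assume x: "x \<in> I"
    have "{(a, b). a \<in> {x} \<and> b \<in> I - {x} \<and> b < a} = (\<lambda>b. (x, b)) ` {b \<in> I. b < x}" by auto
    then have "card {(a, b). a \<in> {x} \<and> b \<in> I - {x} \<and> b < a} = card {b \<in> I. b < x}"
      by (simp only:) (rule card_image, simp add: inj_on_def)
    moreover have "x < n" using I x by auto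
    ultimately show "?s {x} * ext_vec n v {x} * g (I - {x}) = (-1) ^ card {b \<in> I. b < x} * v x * g (I - {x})"
      by (simp only: single)
  qed
  also have "\<dots> = (\<Sum>a<card I. (-1) ^ card {b \<in> I. b < ?xs ! a} * v (?xs ! a) * g (I - {?xs ! a}))"
  proof -
    have "bij_betw (\<lambda>a. ?xs ! a) {..<card I} I"
      using bij_betw_nth[of ?xs "{..<card I}" I] fin by simp
    from sum.reindex_bij_betw[OF this, of "\<lambda>x. (-1) ^ card {b \<in> I. b < x} * v x * g (I - {x})"]
    show ?thesis by simp
  qed
  also have "\<dots> = (\<Sum>a<card I. (-1) ^ a * v (?xs ! a) * g (I - {?xs ! a}))"
    using card_less_sorted_list_nth[OF fin] by (intro sum.cong refl) simp
  finally show ?thesis .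
qed

text \<open>The coordinates of a wedge product of vectors are the minors of their matrix: wedging
  with one more vector is Laplace expansion along the new first column.\<close>

lemma wedge_list_eq_det:
  fixes vs :: "(nat \<Rightarrow> 'a::comm_ring_1) list"
  assumes "I \<subseteq> {..<n}" "card I = length vs"
  shows "wedge_list (map (ext_vec n) vs) I =
    det (mat (length vs) (length vs) (\<lambda>(a, b). (vs ! b) (sorted_list_of_set I ! a)))"
  using assms
proof (induction vs arbitrary: I)
  case Nil
  then have "I = {}" using finite_subset[of I "{..<n}"] by auto
  then show ?case by (simp add: wedge_list_def basis_vec_def det_dim_zero)
next
  case (Cons v vs)
  let ?d = "length vs" and ?xs = "sorted_list_of_set I"
  let ?M = "mat (Suc ?d) (Suc ?d) (\<lambda>(a, b). ((v # vs) ! b) (?xs ! a))"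
  have fin: "finite I" using Cons.prems finite_subset by auto
  have cardI: "card I = Suc ?d" using Cons.prems by simp
  have "wedge_list (map (ext_vec n) (v # vs)) I =
      (\<Sum>a<Suc ?d. (-1) ^ a * v (?xs ! a) * wedge_list (map (ext_vec n) vs) (I - {?xs ! a}))"
    using wedge_ext_vec[OF Cons.prems(1), of v "wedge_list (map (ext_vec n) vs)"] cardI
    by (simp add: wedge_list_def)
  also have "\<dots> = (\<Sum>a<Suc ?d. ?M $$ (a, 0) * cofactor ?M a 0)"
  proof (intro sum.cong refl)
    fix a assume "a \<in> {..<Suc ?d}"
    then have a: "a < card I" using cardI by simp
    have "?xs ! a \<in> set ?xs" using a by simp
    then have "?xs ! a \<in> I" using fin by simp
    then have "card (I - {?xs ! a}) = ?d" using cardI by simp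
    then have "wedge_list (map (ext_vec n) vs) (I - {?xs ! a}) =
        det (mat ?d ?d (\<lambda>(k, b). (vs ! b) (sorted_list_of_set (I - {?xs ! a}) ! k)))"
      using Cons.prems(1) by (intro Cons.IH) auto
    also have "mat ?d ?d (\<lambda>(k, b). (vs ! b) (sorted_list_of_set (I - {?xs ! a}) ! k)) = mat_delete ?M a 0"
      unfolding mat_delete_def using a cardI
      by (intro eq_matI) (auto simp: nth_sorted_list_remove[OF fin a])
    finally show "(-1) ^ a * v (?xs ! a) * wedge_list (map (ext_vec n) vs) (I - {?xs ! a}) =
        ?M $$ (a, 0) * cofactor ?M a 0"
      using a cardI by (simp add: cofactor_def)
  qed
  also have "\<dots> = det ?M" by (rule laplace_expansion_column[symmetric]) auto
  finally show ?case by simp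
qed

definition ext_coeff :: "nat \<Rightarrow> nat list \<Rightarrow> nat set \<Rightarrow> int" where
  "ext_coeff d w I = det (mat d d (\<lambda>(a, b). of_bool (w ! b = sorted_list_of_set I ! a)))"

text \<open>A determinant is linear in each single column, so this is the chunk expansion with
  chunks of length 1.\<close>

lemma multilinear_ext_coeff:
  fixes v :: "nat \<Rightarrow> nat \<Rightarrow> 'a::comm_ring_1"
  assumes I: "I \<in> ext_index n d"
  shows "multilinear n d (ext_coeff d) v I = det (mat d d (\<lambda>(a, b). v b (sorted_list_of_set I ! a)))"
proof -
  let ?xs = "sorted_list_of_set I"
  have less: "?xs ! a < n" if "a < d" for a
    by (rule nth_words_less[OF sorted_list_in_words[OF I] that])
  have "det (mat d d (\<lambda>(a, b). v b (?xs ! a))) =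
      det (mat d d (\<lambda>(r, c). \<Sum>w\<in>words n 1. (\<Prod>b<1. v (c * 1 + b) (w ! b)) * of_int (of_bool (w ! 0 = ?xs ! r))))"
  proof (rule det_mat_cong)
    fix r c assume rc: "r < d" "c < d"
    have "(\<Sum>w\<in>words n 1. (\<Prod>b<1. v (c * 1 + b) (w ! b)) * (of_int (of_bool (w ! 0 = ?xs ! r)) :: 'a)) =
        (\<Sum>k<n. if k = ?xs ! r then v c k else 0)"
      unfolding One_nat_def sum_words_Suc words_0 by (intro sum.cong refl) auto
    also have "\<dots> = v c (?xs ! r)" using less[OF rc(1)] by simp
    finally show "v c (?xs ! r) =
        (\<Sum>w\<in>words n 1. (\<Prod>b<1. v (c * 1 + b) (w ! b)) * of_int (of_bool (w ! 0 = ?xs ! r)))" ..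
  qed
  also have "\<dots> = (\<Sum>w\<in>words n (d * 1). (\<Prod>p<d * 1. v p (w ! p)) *
      of_int (chunk_det d 1 (\<lambda>_ w r. of_bool (w ! 0 = ?xs ! r)) w))"
    by (rule det_chunk_expansion[where \<mu> = "\<lambda>_ w r. of_bool (w ! 0 = ?xs ! r)"])
  also have "\<dots> = multilinear n d (ext_coeff d) v I"
    unfolding multilinear_def chunk_det_def ext_coeff_def by simp
  finally show ?thesis ..
qed

lemma ext_power_map_basis_vec:
  assumes J: "J \<in> ext_index m d" and I: "I \<in> ext_index n d"
  shows "ext_power_map m n d \<phi> (basis_vec J) I =
    multilinear n d (ext_coeff d) (\<lambda>b. \<phi> (basis_vec (sorted_list_of_set J ! b))) I"
proof -
  have "ext_power_map m n d \<phi> (basis_vec J) I =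
      wedge_list (map (ext_vec n) (map (\<lambda>j. \<phi> (basis_vec j)) (sorted_list_of_set J))) I"
    unfolding ext_power_map_def by (simp add: lin_extend_basis_vec[OF finite_ext_index J] comp_def)
  also have "\<dots> = det (mat d d (\<lambda>(a, b). \<phi> (basis_vec (sorted_list_of_set J ! b)) (sorted_list_of_set I ! a)))"
    using I length_ext_index[OF J]
    by (subst wedge_list_eq_det) (auto simp: mem_ext_index intro!: arg_cong[of _ _ det] eq_matI)
  finally show ?thesis by (simp add: multilinear_ext_coeff[OF I])
qed

lemma count_list_distinct: "distinct xs \<Longrightarrow> count_list xs i = of_bool (i \<in> set xs)"
  by (induction xs) auto

lemma ext_coeff_count_list:
  assumes I: "I \<in> ext_index n d" and w: "length w = d" and nz: "ext_coeff d w I \<noteq> 0"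
  shows "count_list w i = of_bool (i \<in> I)"
proof -
  let ?xs = "sorted_list_of_set I"
  have cl: "count_list u i = (\<Sum>p<length u. of_bool (u ! p = i))" for u
    using Int_def[of "{..<length u}" "{p. u ! p = i}"]
    by (simp add: count_list_eq_card of_bool_def sum.If_cases)
  obtain \<pi> where \<pi>: "\<pi> permutes {..<d}" "\<And>b. b < d \<Longrightarrow> w ! b = ?xs ! \<pi> b"
    using nz unfolding ext_coeff_def
    by (elim det_nonzero_permutes[where A = "\<lambda>a b. of_bool (w ! b = ?xs ! a)"]) auto
  have "count_list w i = (\<Sum>b<d. of_bool (?xs ! \<pi> b = i))" using \<pi>(2) by (simp add: cl w)
  also have "\<dots> = (\<Sum>b<d. of_bool (?xs ! b = i))"
    using sum.permute[OF \<pi>(1), of "\<lambda>b. of_bool (?xs ! b = i)"] unfolding comp_def by (rule sym)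
  also have "\<dots> = count_list ?xs i" using I by (simp add: cl mem_ext_index)
  also have "\<dots> = of_bool (i \<in> set ?xs)" by (simp add: count_list_distinct)
  finally show ?thesis using set_ext_index[OF I] by simp
qed

lemma ext_coeff_sorted_list:
  assumes I: "I \<in> ext_index n d" and J: "J \<in> ext_index n d"
  shows "ext_coeff d (sorted_list_of_set J) I = of_bool (I = J)"
proof (cases "I = J")
  case True
  have "mat d d (\<lambda>(a, b). of_bool (sorted_list_of_set I ! b = sorted_list_of_set I ! a)) = (1\<^sub>m d :: int mat)"
    using length_ext_index[OF I] by (intro eq_matI) (auto simp: nth_eq_iff_index_eq)
  then show ?thesis using True by (simp add: ext_coeff_def)
next
  case False
  have "ext_coeff d (sorted_list_of_set J) I = 0"
  proof (rule ccontr)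
    assume "ext_coeff d (sorted_list_of_set J) I \<noteq> 0"
    then have "of_bool (i \<in> I) = count_list (sorted_list_of_set J) i" for i
      using ext_coeff_count_list[OF I length_ext_index[OF J]] by simp
    moreover have "count_list (sorted_list_of_set J) i = of_bool (i \<in> J)" for i
      using set_ext_index[OF J] by (simp add: count_list_distinct)
    ultimately have "(of_bool (i \<in> I) :: nat) = of_bool (i \<in> J)" for i by simp
    then have "i \<in> I \<longleftrightarrow> i \<in> J" for i by (simp only: of_bool_eq_iff)
    then have "I = J" by blast
    then show False using False by simp
  qed
  then show ?thesis using False by simp
qed

text \<open>Nothing lies strictly between \<open>i\<close> and \<open>Suc i\<close>, so the list
  stays sorted after the replacement. Hence no sign appears in
  \<open>raise_ext_coeff\<close>.\<close>

lemma sorted_list_replace: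
  assumes I: "I \<in> ext_index n d" and a: "a < d" "sorted_list_of_set I ! a = Suc i" and i: "i \<notin> I"
  shows "sorted_list_of_set (insert i (I - {Suc i})) = (sorted_list_of_set I)[a := i]"
proof (rule strict_sorted_equal)
  let ?xs = "sorted_list_of_set I"
  have len: "length ?xs = d" by (rule length_ext_index[OF I])
  have mono: "?xs ! k < ?xs ! l" if "k < l" "l < d" for k l
    using sorted_wrt_nth_less[of "(<)" ?xs k l] that len by simp
  show "sorted_wrt (<) (?xs[a := i])"
    unfolding sorted_wrt_iff_nth_less
  proof (intro allI impI)
    fix k l assume kl: "k < l" "l < length (?xs[a := i])"
    have "?xs ! k \<noteq> i" using i set_ext_index[OF I] nth_mem[of k ?xs] kl len by auto
    moreover have "?xs ! k < ?xs ! l" using mono kl len by simp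
    ultimately show "?xs[a := i] ! k < ?xs[a := i] ! l"
      using kl len a by (cases "k = a"; cases "l = a") auto
  qed
  show "sorted_wrt (<) (sorted_list_of_set (insert i (I - {Suc i})))" by simp
  have "set (?xs[a := i]) = insert i (set ?xs - {?xs ! a})"
    using a(1) len by (intro set_update_distinct) auto
  then have "set (?xs[a := i]) = insert i (I - {Suc i})"
    by (simp only: set_ext_index[OF I] a(2))
  moreover have "set (sorted_list_of_set (insert i (I - {Suc i}))) = insert i (I - {Suc i})"
    using finite_ext_index_member[OF I] by (intro set_sorted_list_of_set) simp
  ultimately show "set (sorted_list_of_set (insert i (I - {Suc i}))) = set (?xs[a := i])"
    by (simp only:)
qed

text \<open>Raising replaces the columns at the positions of w that carry \<open>i\<close>; by
  \<open>sum_det_replace_col_eq_row\<close> the sum over columns may be taken over rows instead.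
  There only the row of \<open>Suc i\<close> contributes, replaced by the row belonging to
  \<open>i\<close>. If i is in I, two rows coincide and the term vanishes; otherwise it is the
  coefficient for I with \<open>Suc i\<close> exchanged for \<open>i\<close>.\<close>

lemma raise_ext_coeff:
  assumes w: "w \<in> words n d" and i: "Suc i < n" and I: "I \<in> ext_index n d"
  shows "raise i (\<lambda>w. ext_coeff d w I) w = (\<Sum>J\<in>ext_index n d.
    of_bool (Suc i \<in> I \<and> i \<notin> I \<and> J = insert i (I - {Suc i})) * ext_coeff d w J)"
proof -
  let ?xs = "sorted_list_of_set I"
  have len: "length w = d" "length ?xs = d" using w length_ext_index[OF I] by (auto simp: words_def)
  define U where "U a b = (of_bool (w ! b = ?xs ! a) :: int)" for a b
  define V where "V a b = (of_bool (w ! b = i \<and> ?xs ! a = Suc i) :: int)" for a b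
  have "raise i (\<lambda>w. ext_coeff d w I) w = (\<Sum>c<d. det (mat d d (\<lambda>(a, b). if b = c then V a c else U a b)))"
    unfolding raise_def len
  proof (intro sum.cong refl)
    fix c assume "c \<in> {..<d}"
    then have c: "c < d" by simp
    show "(if w ! c = i then ext_coeff d (w[c := Suc i]) I else 0) =
        det (mat d d (\<lambda>(a, b). if b = c then V a c else U a b))"
    proof (cases "w ! c = i")
      case True
      then show ?thesis unfolding ext_coeff_def using c len
        by (auto simp: U_def V_def nth_list_update intro!: arg_cong[of _ _ det] eq_matI)
    next
      case False
      then have "(\<Sum>r<d. V r c * cofactor (mat d d (\<lambda>(a, b). U a b)) r c) = 0" by (simp add: V_def)
      then show ?thesis using False det_replace_col_sum[OF c, of "\<lambda>a. V a c" U] by simp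
    qed
  qed
  also have "\<dots> = (\<Sum>r<d. det (mat d d (\<lambda>(a, b). if a = r then V r b else U a b)))"
    by (rule sum_det_replace_col_eq_row)
  also have "\<dots> = (\<Sum>J\<in>ext_index n d.
    of_bool (Suc i \<in> I \<and> i \<notin> I \<and> J = insert i (I - {Suc i})) * ext_coeff d w J)" (is "_ = ?R")
  proof -
    have row0: "det (mat d d (\<lambda>(a, b). if a = r then V r b else U a b)) = 0"
      if "r < d" "?xs ! r \<noteq> Suc i" for r
      using det_replace_row_sum[OF that(1), of "V r" U] that(2) by (simp add: V_def)
    show ?thesis
    proof (cases "Suc i \<in> I")
      case False
      then have "?xs ! r \<noteq> Suc i" if "r < d" for r
        using nth_mem[of r ?xs] that len set_ext_index[OF I] by auto
      then show ?thesis using False row0 by simp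
    next
      case True
      then obtain r where r: "r < d" "?xs ! r = Suc i"
        using set_ext_index[OF I] len by (metis in_set_conv_nth)
      have "?xs ! r' \<noteq> Suc i" if "r' < d" "r' \<noteq> r" for r'
        using nth_eq_iff_index_eq[of ?xs r' r] that r len by simp
      then have "(\<Sum>r<d. det (mat d d (\<lambda>(a, b). if a = r then V r b else U a b))) =
          (\<Sum>r'\<in>{r}. det (mat d d (\<lambda>(a, b). if a = r' then V r' b else U a b)))"
        using r row0 by (intro sum.mono_neutral_right) auto
      then have sum: "(\<Sum>r<d. det (mat d d (\<lambda>(a, b). if a = r then V r b else U a b))) =
          det (mat d d (\<lambda>(a, b). if a = r then V r b else U a b))" by simp
      show ?thesis
      proof (cases "i \<in> I")
        case iI: True
        then obtain r' where r': "r' < d" "?xs ! r' = i"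
          using set_ext_index[OF I] len by (metis in_set_conv_nth)
        then have "r \<noteq> r'" using r by auto
        have "det (mat d d (\<lambda>(a, b). if a = r then V r b else U a b)) = 0"
          by (rule det_identical_rows[of _ d r r'])
             (use r r' \<open>r \<noteq> r'\<close> in \<open>auto simp: U_def V_def intro!: eq_vecI\<close>)
        then show ?thesis using sum iI by simp
      next
        case False
        let ?J = "insert i (I - {Suc i})"
        have J: "?J \<in> ext_index n d"
        proof -
          have "card ?J = Suc (card I - 1)"
            using False True finite_ext_index_member[OF I] by (simp add: card_Diff_singleton)
          moreover have "card I > 0" using True finite_ext_index_member[OF I] by (auto simp: card_gt_0_iff)
          ultimately show ?thesis using I i by (auto simp: mem_ext_index)
        qed
        have "?R = (\<Sum>J\<in>ext_index n d. if J = ?J then ext_coeff d w J else 0)"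
          using True False by (intro sum.cong) auto
        also have "\<dots> = ext_coeff d w ?J" using J finite_ext_index by simp
        also have "\<dots> = det (mat d d (\<lambda>(a, b). if a = r then V r b else U a b))"
          unfolding ext_coeff_def sorted_list_replace[OF I r False] using r len
          by (intro arg_cong[of _ _ det] eq_matI) (auto simp: U_def V_def nth_list_update)
        finally show ?thesis using sum by simp
      qed
    qed
  qed
  finally show ?thesis .
qed

text \<open>The origin of the exponent e: the number of basis elements of the exterior power that
  involve a given basis vector.\<close>

lemma card_ext_index_containing:
  assumes i: "i < n" and d: "d \<ge> 1"
  shows "(\<Sum>I\<in>ext_index n d. of_bool (i \<in> I)) = (n - 1) choose (d - 1)"
proof -
  have "(\<Sum>I\<in>ext_index n d. of_bool (i \<in> I)) = card {I \<in> ext_index n d. i \<in> I}"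
    using finite_ext_index[of n d] Int_def[of "ext_index n d" "{I. i \<in> I}"]
    by (simp add: of_bool_def sum.If_cases)
  also have "\<dots> = card {K. K \<subseteq> {..<n} - {i} \<and> card K = d - 1}"
  proof (rule bij_betw_same_card[of "\<lambda>I. I - {i}"], rule bij_betw_byWitness[of _ "insert i"])
    show "(\<lambda>I. I - {i}) ` {I \<in> ext_index n d. i \<in> I} \<subseteq> {K. K \<subseteq> {..<n} - {i} \<and> card K = d - 1}"
      by (auto simp: mem_ext_index card_Diff_singleton)
    show "insert i ` {K. K \<subseteq> {..<n} - {i} \<and> card K = d - 1} \<subseteq> {I \<in> ext_index n d. i \<in> I}"
    proof
      fix I assume "I \<in> insert i ` {K. K \<subseteq> {..<n} - {i} \<and> card K = d - 1}"
      then obtain K where K: "I = insert i K" "K \<subseteq> {..<n} - {i}" "card K = d - 1" by auto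
      have "finite K" "i \<notin> K" using K(2) finite_subset[of K "{..<n} - {i}"] by auto
      then show "I \<in> {I \<in> ext_index n d. i \<in> I}" using K i d by (auto simp: mem_ext_index)
    qed
  qed auto
  also have "\<dots> = (n - 1) choose (d - 1)"
    using n_subsets[of "{..<n} - {i}" "d - 1"] i by simp
  finally show ?thesis .
qed

lemma multilinear_functor_ext:
  assumes d: "d \<ge> 1"
  shows "multilinear_functor n d ((n - 1) choose (d - 1)) (ext_index n d) (ext_coeff d)
    (\<lambda>i I J. of_bool (Suc i \<in> I \<and> i \<notin> I \<and> J = insert i (I - {Suc i})))
    (\<lambda>I i. of_bool (i \<in> I)) sorted_list_of_set"
proof
  show "finite (ext_index n d)" by (rule finite_ext_index)
  show "raise i (\<lambda>w. ext_coeff d w I) w = (\<Sum>J\<in>ext_index n d.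
      of_bool (Suc i \<in> I \<and> i \<notin> I \<and> J = insert i (I - {Suc i})) * ext_coeff d w J)"
    if "w \<in> words n d" "Suc i < n" "I \<in> ext_index n d" for w i I
    by (rule raise_ext_coeff[OF that])
  show "of_bool (Suc i \<in> I \<and> i \<notin> I \<and> I = insert i (I - {Suc i})) = (0 :: int)" for i I
    by auto
  show "count_list w i = of_bool (i \<in> I)"
    if "w \<in> words n d" "I \<in> ext_index n d" "ext_coeff d w I \<noteq> 0" for w i I
    using ext_coeff_count_list[OF that(2) _ that(3)] that(1) by (simp add: words_def)
  show "(\<Sum>I\<in>ext_index n d. of_bool (i \<in> I)) = (n - 1) choose (d - 1)" if "i < n" for i
    by (rule card_ext_index_containing[OF that d])
  show "sorted_list_of_set I \<in> words n d" if "I \<in> ext_index n d" for I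
    by (rule sorted_list_in_words[OF that])
  show "ext_coeff d (sorted_list_of_set J) I = of_bool (I = J)"
    if "I \<in> ext_index n d" "J \<in> ext_index n d" for I J
    by (rule ext_coeff_sorted_list[OF that])
qed

text \<open>A word with distinct letters is a rearrangement of a sorted one and gives the same
  column up to sign; a word with a repeated letter gives 0.\<close>

lemma ext_power_map_spans:
  fixes \<phi> :: "(nat \<Rightarrow> 'a::comm_ring_1) \<Rightarrow> (nat \<Rightarrow> 'a)"
  assumes j: "j \<in> words m d"
  shows "\<exists>x. \<forall>I\<in>ext_index n d. multilinear n d (ext_coeff d) (\<lambda>b. \<phi> (basis_vec (j ! b))) I =
    (\<Sum>J\<in>ext_index m d. x J * ext_power_map m n d \<phi> (basis_vec J) I)"
proof (cases "distinct j")
  case True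
  let ?J = "set j"
  have len: "length j = d" and "?J \<subseteq> {..<m}" using j by (auto simp: words_def)
  then have J: "?J \<in> ext_index m d" using True by (simp add: mem_ext_index distinct_card)
  have "mset j = mset (sorted_list_of_set ?J)"
    using True set_eq_iff_mset_eq_distinct[of j "sorted_list_of_set ?J"] by simp
  from mset_eq_permutation[OF this] obtain \<pi>
    where \<pi>: "\<pi> permutes {..<length (sorted_list_of_set ?J)}" "permute_list \<pi> (sorted_list_of_set ?J) = j" .
  have nth: "j ! b = sorted_list_of_set ?J ! \<pi> b" if "b < d" for b
    using permute_list_nth[OF \<pi>(1), of b] \<pi>(2) that length_ext_index[OF J] by simp
  have \<pi>d: "\<pi> b < d" if "b < d" for b
    using permutes_in_image[OF \<pi>(1), of b] that length_ext_index[OF J] by simp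
  \<comment> \<open>The sign of the rearrangement, as the determinant of its permutation
    matrix.\<close>
  define c :: int where "c = det (mat d d (\<lambda>(a, b). of_bool (\<pi> b = a)))"
  show ?thesis
  proof (intro exI ballI)
    fix I assume I: "I \<in> ext_index n d"
    let ?y = "\<lambda>b a. \<phi> (basis_vec (sorted_list_of_set ?J ! b)) (sorted_list_of_set I ! a)"
    have "multilinear n d (ext_coeff d) (\<lambda>b. \<phi> (basis_vec (j ! b))) I =
        det (mat d d (\<lambda>(a, b). ?y (\<pi> b) a))"
      unfolding multilinear_ext_coeff[OF I] using nth
      by (intro arg_cong[of _ _ det] eq_matI) auto
    also have "\<dots> = det (mat d d (\<lambda>(a, b). ?y b a)) * of_int c"
      unfolding c_def by (rule det_cols_reindex[where y = ?y]) (rule \<pi>d)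
    also have "det (mat d d (\<lambda>(a, b). ?y b a)) = ext_power_map m n d \<phi> (basis_vec ?J) I"
      unfolding ext_power_map_basis_vec[OF J I] multilinear_ext_coeff[OF I] ..
    also have "ext_power_map m n d \<phi> (basis_vec ?J) I * of_int c =
        (\<Sum>J\<in>ext_index m d. if J = ?J then of_int c * ext_power_map m n d \<phi> (basis_vec J) I else 0)"
      using J finite_ext_index by (simp add: mult.commute)
    also have "\<dots> = (\<Sum>J\<in>ext_index m d. (if J = ?J then of_int c else 0) * ext_power_map m n d \<phi> (basis_vec J) I)"
      by (intro sum.cong) auto
    finally show "multilinear n d (ext_coeff d) (\<lambda>b. \<phi> (basis_vec (j ! b))) I =
      (\<Sum>J\<in>ext_index m d. (if J = ?J then of_int c else 0) * ext_power_map m n d \<phi> (basis_vec J) I)" .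
  qed
next
  case False
  then obtain a b where ab: "a < d" "b < d" "a \<noteq> b" "j ! a = j ! b"
    using j by (auto simp: distinct_conv_nth words_def)
  show ?thesis
  proof (intro exI ballI)
    fix I assume I: "I \<in> ext_index n d"
    have "multilinear n d (ext_coeff d) (\<lambda>b. \<phi> (basis_vec (j ! b))) I = 0"
      unfolding multilinear_ext_coeff[OF I]
      by (rule det_identical_columns[of _ d a b]) (use ab in \<open>auto intro!: eq_vecI\<close>)
    then show "multilinear n d (ext_coeff d) (\<lambda>b. \<phi> (basis_vec (j ! b))) I =
      (\<Sum>J\<in>ext_index m d. 0 * ext_power_map m n d \<phi> (basis_vec J) I)" by simp
  qed
qed

lemma ext_power_comparison:
  fixes \<phi> :: "(nat \<Rightarrow> 'a::comm_ring_1) \<Rightarrow> (nat \<Rightarrow> 'a)" and m n d :: nat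
  defines "I \<equiv> max_minor_ideal {..<m} {..<n} \<phi>"
    and "IE \<equiv> max_minor_ideal (ext_index m d) (ext_index n d) (ext_power_map m n d \<phi>)"
    and "e \<equiv> (n - 1) choose (d - 1)"
  assumes d: "d \<ge> 1"
  shows "IE \<subseteq> ideal_power I e" and "integral_closure IE = integral_closure (ideal_power I e)"
    and "contains_rationals TYPE('a) \<Longrightarrow> IE = ideal_power I e"
proof -
  have cols: "\<forall>J\<in>ext_index m d. \<exists>j\<in>words m d. \<forall>K\<in>ext_index n d.
      ext_power_map m n d \<phi> (basis_vec J) K = multilinear n d (ext_coeff d) (\<lambda>b. \<phi> (basis_vec (j ! b))) K"
  proof (intro ballI bexI)
    fix J K assume "J \<in> ext_index m d" "K \<in> ext_index n d"
    then show "ext_power_map m n d \<phi> (basis_vec J) K =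
        multilinear n d (ext_coeff d) (\<lambda>b. \<phi> (basis_vec (sorted_list_of_set J ! b))) K"
      by (rule ext_power_map_basis_vec)
  qed (rule sorted_list_in_words)
  have spans: "\<forall>j\<in>words m d. \<exists>x. \<forall>K\<in>ext_index n d.
      multilinear n d (ext_coeff d) (\<lambda>b. \<phi> (basis_vec (j ! b))) K =
      (\<Sum>J\<in>ext_index m d. x J * ext_power_map m n d \<phi> (basis_vec J) K)"
    by (intro ballI ext_power_map_spans)
  note * = multilinear_functor.functor_comparison[OF multilinear_functor_ext[OF d],
      where B = "ext_index m d" and m = m and \<chi> = "ext_power_map m n d \<phi>" and \<phi> = \<phi>,
      OF finite_ext_index cols spans]
  show "IE \<subseteq> ideal_power I e" unfolding IE_def I_def e_def by (rule *(1))
  show "integral_closure IE = integral_closure (ideal_power I e)" unfolding IE_def I_def e_def by (rule *(2))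
  show "IE = ideal_power I e" if "contains_rationals TYPE('a)"
    unfolding IE_def I_def e_def by (rule *(3)[OF that])
qed

section \<open>Tensor products\<close>

text \<open>The determinant whose column a is the tensor product of the basis vectors with indices
  \<open>w ! a\<close> and \<open>u ! a\<close>, the rows being ordered by r \<mapsto> (f r, h r).
  It is the coefficient of the pair of words (w, u) in a maximal minor of a tensor product.\<close>

definition tensor_coeff :: "nat \<Rightarrow> (nat \<Rightarrow> nat) \<Rightarrow> (nat \<Rightarrow> nat) \<Rightarrow> nat list \<Rightarrow> nat list \<Rightarrow> int" where
  "tensor_coeff N f h w u = det (mat N N (\<lambda>(r, a). of_bool (w ! a = f r \<and> u ! a = h r)))"

lemma tensor_coeff_swap: "tensor_coeff N f h w u = tensor_coeff N h f u w"
  by (simp add: tensor_coeff_def conj_commute)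

lemma bij_betw_swap_pair:
  assumes "bij_betw (\<lambda>r. (f r, h r)) A (B \<times> C)"
  shows "bij_betw (\<lambda>r. (h r, f r)) A (C \<times> B)"
proof -
  have "bij_betw prod.swap (B \<times> C) (C \<times> B)"
    by (rule bij_betw_byWitness[of _ prod.swap]) auto
  from bij_betw_trans[OF assms this] show ?thesis by (simp add: comp_def)
qed

lemma tensor_coeff_chunk_det:
  "tensor_coeff N f h w u = chunk_det N 1 (\<lambda>a x r. of_bool (x ! 0 = f r \<and> u ! a = h r)) w"
  by (simp add: tensor_coeff_def chunk_det_def)

text \<open>With u fixed, raising in w acts on the target as an elementary matrix tensored with the
  identity, which has trace 0. Each index of the first factor belongs to q basis tensors, whence the
  weight q.\<close>

lemma highest_weight_tensor_coeff:
  assumes bij: "bij_betw (\<lambda>r. (f r, h r)) {..<N} ({..<n} \<times> {..<q})"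
  shows "highest_weight n q (\<lambda>w. tensor_coeff N f h w u)"
proof -
  have "N = card ({..<n} \<times> {..<q})" using bij_betw_same_card[OF bij] by simp
  then have N: "N = n * q" by simp
  have sum: "(\<Sum>k<N. F (f k) (h k)) = (\<Sum>i<n. \<Sum>j<q. F i j)" for F :: "nat \<Rightarrow> nat \<Rightarrow> 'b::comm_monoid_add"
    using sum.reindex_bij_betw[OF bij, of "\<lambda>(i, j). F i j"] by (simp add: sum.cartesian_product)
  have h: "h r < q" "f r < n" if "r < N" for r using bij_betwE[OF bij] that by auto
  show ?thesis
    unfolding tensor_coeff_chunk_det
  proof (rule highest_weight_chunk_det[where wt = "\<lambda>r i. of_bool (f r = i)"
        and L = "\<lambda>i r k. of_bool (f r = Suc i \<and> f k = i \<and> h k = h r)"])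
    show "N * 1 = n * q" using N by simp
    fix a w i r assume w: "w \<in> words n 1" and i: "Suc i < n" and r: "r < N"
    obtain x where x: "w = [x]" using w by (auto simp: words_def length_Suc_conv)
    have "(\<Sum>k<N. of_bool (f r = Suc i \<and> f k = i \<and> h k = h r) * of_bool (w ! 0 = f k \<and> u ! a = h k) :: int) =
        (\<Sum>i'<n. \<Sum>j<q. of_bool (f r = Suc i \<and> i' = i \<and> j = h r) * of_bool (x = i' \<and> u ! a = j))"
      unfolding x nth_Cons_0
      by (rule sum[of "\<lambda>i' j. of_bool (f r = Suc i \<and> i' = i \<and> j = h r) * of_bool (x = i' \<and> u ! a = j)"])
    also have "\<dots> = (\<Sum>i'<n. \<Sum>j<q. if j = h r then
        if i' = i then of_bool (f r = Suc i \<and> x = i \<and> u ! a = h r) else 0 else 0)"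
      by (intro sum.cong refl) auto
    also have "\<dots> = of_bool (f r = Suc i \<and> x = i \<and> u ! a = h r)"
      using h[OF r] i by simp
    finally show "raise i (\<lambda>w. of_bool (w ! 0 = f r \<and> u ! a = h r)) w =
        (\<Sum>k<N. of_bool (f r = Suc i \<and> f k = i \<and> h k = h r) * of_bool (w ! 0 = f k \<and> u ! a = h k))"
      by (auto simp: x raise_Cons raise_Nil)
  next
    fix i show "(\<Sum>k<N. of_bool (f k = Suc i \<and> f k = i \<and> h k = h k) :: int) = 0"
      by (intro sum.neutral) auto
  next
    fix a w i r assume "w \<in> words n 1" "(of_bool (w ! 0 = f r \<and> u ! a = h r) :: int) \<noteq> 0"
    then show "count_list w i = of_bool (f r = i)"
      by (auto simp: words_def length_Suc_conv split: if_splits)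
  next
    fix i assume i: "i < n"
    have "(\<Sum>r<N. of_bool (f r = i)) = (\<Sum>i'<n. \<Sum>j<q. of_bool (i' = i))"
      by (rule sum[of "\<lambda>i' _. of_bool (i' = i)"])
    also have "\<dots> = (\<Sum>i'<n. if i' = i then q else 0)" by (intro sum.cong) auto
    finally show "(\<Sum>r<N. of_bool (f r = i)) = q" using i by simp
  qed
qed

text \<open>The determinant is linear in the N vectors of each factor separately. It is first
  expanded in the second factor, with the vectors of the first as coefficients, and then in the
  first.\<close>

lemma det_tensor_expansion:
  fixes v w :: "nat \<Rightarrow> nat \<Rightarrow> 'a::comm_ring_1"
  assumes bij: "bij_betw (\<lambda>r. (f r, h r)) {..<N} ({..<n} \<times> {..<q})"
  shows "det (mat N N (\<lambda>(r, a). v a (f r) * w a (h r))) =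
    (\<Sum>U\<in>words q N. (\<Prod>a<N. w a (U ! a)) *
      (\<Sum>W\<in>words n N. (\<Prod>a<N. v a (W ! a)) * of_int (tensor_coeff N f h W U)))"
proof -
  have less: "h r < q" "f r < n" if "r < N" for r using bij_betwE[OF bij] that by auto
  have letter: "(\<Sum>y\<in>words k 1. x (y ! 0) * z (y ! 0) (of_bool (y ! 0 = c))) = x c * z c 1"
    if "c < k" "\<And>y. z y 0 = 0" for k c and x :: "nat \<Rightarrow> 'a" and z :: "nat \<Rightarrow> 'a \<Rightarrow> 'a"
  proof -
    have "(\<Sum>y\<in>words k 1. x (y ! 0) * z (y ! 0) (of_bool (y ! 0 = c))) =
        (\<Sum>y<k. x y * z y (of_bool (y = c)))"
      unfolding One_nat_def sum_words_Suc words_0 by simp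
    also have "\<dots> = (\<Sum>y<k. if y = c then x c * z c 1 else 0)"
      using that(2) by (intro sum.cong) auto
    finally show ?thesis using that(1) by simp
  qed
  have "det (mat N N (\<lambda>(r, a). v a (f r) * w a (h r))) =
      det (mat N N (\<lambda>(r, a). \<Sum>y\<in>words q 1. w a (y ! 0) * (v a (f r) * of_bool (y ! 0 = h r))))"
  proof (rule det_mat_cong)
    fix r a assume "r < N" "a < N"
    then show "v a (f r) * w a (h r) = (\<Sum>y\<in>words q 1. w a (y ! 0) * (v a (f r) * of_bool (y ! 0 = h r)))"
      using letter[of "h r" q "\<lambda>_ x. v a (f r) * x" "w a"] less by (simp add: mult.commute)
  qed
  also have "\<dots> = (\<Sum>U\<in>Pi\<^sub>E {..<N} (\<lambda>_. words q 1). (\<Prod>a<N. w a (U a ! 0)) *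
      det (mat N N (\<lambda>(r, a). v a (f r) * of_bool (U a ! 0 = h r))))"
    by (rule det_sum_cols) (rule finite_words)
  also have "\<dots> = (\<Sum>U\<in>words q (N * 1). (\<Prod>a<N. w a (restrict (chunk 1 U) {..<N} a ! 0)) *
      det (mat N N (\<lambda>(r, a). v a (f r) * of_bool (restrict (chunk 1 U) {..<N} a ! 0 = h r))))"
    by (rule sum_PiE_words)
  also have "\<dots> = (\<Sum>U\<in>words q N. (\<Prod>a<N. w a (U ! a)) *
      (\<Sum>W\<in>words n N. (\<Prod>a<N. v a (W ! a)) * of_int (tensor_coeff N f h W U)))"
    unfolding mult_1_right
  proof (intro sum.cong refl arg_cong2[of _ _ _ _ "(*)"])
    fix U
    show "(\<Prod>a<N. w a (restrict (chunk 1 U) {..<N} a ! 0)) = (\<Prod>a<N. w a (U ! a))" by simp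
    have "det (mat N N (\<lambda>(r, a). v a (f r) * of_bool (restrict (chunk 1 U) {..<N} a ! 0 = h r))) =
      det (mat N N (\<lambda>(r, c). \<Sum>W\<in>words n 1. (\<Prod>b<1. v (c * 1 + b) (W ! b)) *
        of_int (of_bool (W ! 0 = f r \<and> U ! c = h r))))"
    proof (rule det_mat_cong)
      fix r c assume rc: "r < N" "c < N"
      have "(\<Sum>W\<in>words n 1. (\<Prod>b<1. v (c * 1 + b) (W ! b)) * (of_int (of_bool (W ! 0 = f r \<and> U ! c = h r)) :: 'a)) =
          (\<Sum>W\<in>words n 1. v c (W ! 0) * (of_bool (W ! 0 = f r) * of_bool (U ! c = h r)))"
        by (intro sum.cong refl) auto
      also have "\<dots> = v c (f r) * of_bool (U ! c = h r)"
        using letter[of "f r" n "\<lambda>_ x. x * of_bool (U ! c = h r)" "v c"] less(2)[OF rc(1)] by simp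
      finally show "v c (f r) * of_bool (restrict (chunk 1 U) {..<N} c ! 0 = h r) =
          (\<Sum>W\<in>words n 1. (\<Prod>b<1. v (c * 1 + b) (W ! b)) * of_int (of_bool (W ! 0 = f r \<and> U ! c = h r)))"
        using rc by simp
    qed
    also have "\<dots> = (\<Sum>W\<in>words n (N * 1). (\<Prod>p<N * 1. v p (W ! p)) *
        of_int (chunk_det N 1 (\<lambda>c W r. of_bool (W ! 0 = f r \<and> U ! c = h r)) W))"
      by (rule det_chunk_expansion[where \<mu> = "\<lambda>c W r. of_bool (W ! 0 = f r \<and> U ! c = h r)"])
    finally show "det (mat N N (\<lambda>(r, a). v a (f r) * of_bool (restrict (chunk 1 U) {..<N} a ! 0 = h r))) =
        (\<Sum>W\<in>words n N. (\<Prod>a<N. v a (W ! a)) * of_int (tensor_coeff N f h W U))"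
      unfolding tensor_coeff_chunk_det mult_1_right .
  qed
  finally show ?thesis .
qed

text \<open>Expanding in the words of the first factor leaves coefficient functions of U. The choice
  of \<open>W\<close> ensures that these are again highest weight functions, now for the second
  factor, so they can be expanded in brackets of that factor.\<close>

lemma det_tensor_in_product:
  fixes v w :: "nat \<Rightarrow> nat \<Rightarrow> 'a::comm_ring_1"
  assumes bij: "bij_betw (\<lambda>r. (f r, h r)) {..<N} ({..<n} \<times> {..<q})"
    and v: "\<And>a. a < N \<Longrightarrow> v a \<in> V" and w: "\<And>a. a < N \<Longrightarrow> w a \<in> V'"
    and I: "\<And>x. (\<And>j. j < n \<Longrightarrow> x j \<in> V) \<Longrightarrow> det (mat n n (\<lambda>(i, j). x j i)) \<in> I"
    and J: "\<And>x. (\<And>j. j < q \<Longrightarrow> x j \<in> V') \<Longrightarrow> det (mat q q (\<lambda>(i, j). x j i)) \<in> J"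
  shows "det (mat N N (\<lambda>(r, a). v a (f r) * w a (h r))) \<in> ideal_mult (ideal_power I q) (ideal_power J n)"
proof -
  have "N = card ({..<n} \<times> {..<q})" using bij_betw_same_card[OF bij] by simp
  then have N: "N = n * q" "N = q * n" by simp_all
  \<comment> \<open>The coefficients arise from values of \<open>tensor_coeff\<close> by subtracting
    integer multiples; being a highest weight function in the second word is preserved by
    this.\<close>
  let ?W = "{g. highest_weight q n g}"
  have mem: "tensor_coeff N f h W \<in> ?W" for W
    using highest_weight_tensor_coeff[OF bij_betw_swap_pair[OF bij], of W]
    by (simp add: tensor_coeff_swap[of N h f])
  obtain ps where ps: "\<forall>(T, g)\<in>set ps. tableau n q T \<and> g \<in> ?W"
    "\<forall>(v :: nat \<Rightarrow> nat \<Rightarrow> 'a) U.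
      (\<Sum>W\<in>words n (n * q). (\<Prod>p<n * q. v p (W ! p)) * of_int (tensor_coeff N f h W U)) =
      (\<Sum>(T, g)\<leftarrow>ps. (\<Prod>k<q. det (mat n n (\<lambda>(i, j). v (T k j) i))) * of_int (g U))"
    using highest_weight_sum_expansion[of n q "tensor_coeff N f h" ?W, where 'a = 'a,
        OF highest_weight_tensor_coeff[OF bij] mem] highest_weight_diff by blast
  have "det (mat N N (\<lambda>(r, a). v a (f r) * w a (h r))) =
      (\<Sum>U\<in>words q N. (\<Prod>a<N. w a (U ! a)) *
        (\<Sum>(T, g)\<leftarrow>ps. (\<Prod>k<q. det (mat n n (\<lambda>(i, j). v (T k j) i))) * of_int (g U)))"
    unfolding det_tensor_expansion[OF bij] using ps(2) N(1) by simp
  also have "\<dots> = (\<Sum>(T, g)\<leftarrow>ps. (\<Prod>k<q. det (mat n n (\<lambda>(i, j). v (T k j) i))) *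
      (\<Sum>U\<in>words q N. (\<Prod>a<N. w a (U ! a)) * of_int (g U)))"
    by (induction ps) (auto simp: algebra_simps sum.distrib sum_distrib_left)
  also have "\<dots> \<in> ideal_mult (ideal_power I q) (ideal_power J n)"
  proof (rule is_ideal_sum_list[OF is_ideal_ideal_mult])
    fix Tg assume "Tg \<in> set ps"
    obtain T g where Tg: "Tg = (T, g)" by force
    then have T: "tableau n q T" and g: "highest_weight q n g" using ps(1) \<open>Tg \<in> set ps\<close> by auto
    have "(\<Prod>k<q. det (mat n n (\<lambda>(i, j). v (T k j) i))) \<in> ideal_power I q"
      using tableau_less[OF T] v[unfolded N(1)] by (intro prod_in_ideal_power I) auto
    moreover have "(\<Sum>U\<in>words q (q * n). (\<Prod>a<q * n. w a (U ! a)) * of_int (g U)) \<in> ideal_power J n"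
    proof (rule highest_weight_sum_in_ideal[OF g is_ideal_ideal_power])
      fix T assume T: "tableau q n T"
      show "(\<Prod>k<n. det (mat q q (\<lambda>(i, j). w (T k j) i))) \<in> ideal_power J n"
        using tableau_less[OF T] w[unfolded N(2)] by (intro prod_in_ideal_power J) auto
    qed
    ultimately show "(case Tg of (T, g) \<Rightarrow> (\<Prod>k<q. det (mat n n (\<lambda>(i, j). v (T k j) i))) *
      (\<Sum>U\<in>words q N. (\<Prod>a<N. w a (U ! a)) * of_int (g U))) \<in> ideal_mult (ideal_power I q) (ideal_power J n)"
      unfolding Tg N(2) by (simp add: ideal_multI)
  qed
  finally show ?thesis .
qed

text \<open>The identity for the determinant of a Kronecker product, obtained by applying
  \<open>highest_weight_sum_basis\<close> once in each factor. The words \<omega> and \<eta> list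
  the first and second indices of the basis tensors, and their coefficient is the determinant of the
  identity matrix.\<close>

lemma det_tensor_basis:
  fixes y z :: "nat \<Rightarrow> nat \<Rightarrow> 'a::comm_ring_1"
  assumes bij: "bij_betw (\<lambda>r. (f r, h r)) {..<N} ({..<n} \<times> {..<q})"
  shows "det (mat N N (\<lambda>(r, a). y (f a) (f r) * z (h a) (h r))) =
    det (mat n n (\<lambda>(i, j). y j i)) ^ q * det (mat q q (\<lambda>(i, j). z j i)) ^ n"
proof -
  have "N = card ({..<n} \<times> {..<q})" using bij_betw_same_card[OF bij] by simp
  then have N: "N = n * q" "N = q * n" by simp_all
  have less: "h r < q" "f r < n" if "r < N" for r using bij_betwE[OF bij] that by auto
  define \<omega> \<eta> where "\<omega> = map f [0..<N]" and "\<eta> = map h [0..<N]"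
  have \<omega>: "\<omega> \<in> words n N" and \<eta>: "\<eta> \<in> words q N" using less by (auto simp: words_def \<omega>_def \<eta>_def)
  have nth: "\<omega> ! a = f a" "\<eta> ! a = h a" if "a < N" for a using that by (simp_all add: \<omega>_def \<eta>_def)
  have "det (mat N N (\<lambda>(r, a). y (f a) (f r) * z (h a) (h r))) =
      det (mat N N (\<lambda>(r, a). y (\<omega> ! a) (f r) * z (\<eta> ! a) (h r)))"
    by (intro arg_cong[of _ _ det] eq_matI) (auto simp: nth)
  also have "\<dots> = (\<Sum>U\<in>words q N. (\<Prod>a<N. z (\<eta> ! a) (U ! a)) *
      (det (mat n n (\<lambda>(i, j). y j i)) ^ q * of_int (tensor_coeff N f h \<omega> U)))"
    unfolding det_tensor_expansion[OF bij, of "\<lambda>a. y (\<omega> ! a)" "\<lambda>a. z (\<eta> ! a)"]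
    using highest_weight_sum_basis[OF highest_weight_tensor_coeff[OF bij], of \<omega>, where y = y] \<omega>
    by (simp only: N(1))
  also have "\<dots> = det (mat n n (\<lambda>(i, j). y j i)) ^ q *
      (\<Sum>U\<in>words q N. (\<Prod>a<N. z (\<eta> ! a) (U ! a)) * of_int (tensor_coeff N h f U \<omega>))"
    by (simp only: sum_distrib_left mult.left_commute tensor_coeff_swap[of N h f])
  also have "\<dots> = det (mat n n (\<lambda>(i, j). y j i)) ^ q *
      (det (mat q q (\<lambda>(i, j). z j i)) ^ n * of_int (tensor_coeff N h f \<eta> \<omega>))"
    using highest_weight_sum_basis[OF highest_weight_tensor_coeff[OF bij_betw_swap_pair[OF bij]], of \<eta>, where y = z] \<eta>
    by (simp only: N(2))
  also have "tensor_coeff N h f \<eta> \<omega> = 1"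
  proof -
    have "mat N N (\<lambda>(r, a). of_bool (\<eta> ! a = h r \<and> \<omega> ! a = f r)) = (1\<^sub>m N :: int mat)"
      using bij_betw_imp_inj_on[OF bij] by (intro eq_matI) (auto simp: nth inj_on_def)
    then show ?thesis by (simp add: tensor_coeff_def)
  qed
  finally show ?thesis by simp
qed

lemma tensor_map_basis_vec:
  assumes "\<kappa> \<in> tensor_index m p"
  shows "tensor_map m p \<phi> \<psi> (basis_vec \<kappa>) (i, k) = \<phi> (basis_vec (fst \<kappa>)) i * \<psi> (basis_vec (snd \<kappa>)) k"
proof -
  have "finite (tensor_index m p)" by (simp add: tensor_index_def)
  then show ?thesis using assms
    by (simp add: tensor_map_def lin_extend_basis_vec tensor_vec_def case_prod_beta)
qed

lemma tensor_comparison: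
  fixes \<phi> \<psi> :: "(nat \<Rightarrow> 'a::comm_ring_1) \<Rightarrow> (nat \<Rightarrow> 'a)" and m n p q :: nat
  defines "I \<equiv> max_minor_ideal {..<m} {..<n} \<phi>" and "J \<equiv> max_minor_ideal {..<p} {..<q} \<psi>"
    and "IT \<equiv> max_minor_ideal (tensor_index m p) (tensor_index n q) (tensor_map m p \<phi> \<psi>)"
  shows "IT \<subseteq> ideal_mult (ideal_power I q) (ideal_power J n)"
    and "integral_closure IT = integral_closure (ideal_mult (ideal_power I q) (ideal_power J n))"
    and "contains_rationals TYPE('a) \<Longrightarrow> IT = ideal_mult (ideal_power I q) (ideal_power J n)"
proof -
  let ?B = "tensor_index m p" and ?C = "tensor_index n q" and ?\<chi> = "tensor_map m p \<phi> \<psi>"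
  let ?N = "card ?C"
  have finB: "finite ?B" and finC: "finite ?C" by (simp_all add: tensor_index_def)
  have IT: "is_ideal IT" by (simp add: IT_def max_minor_ideal_def minor_ideal_def is_ideal_ideal_gen)
  have \<chi>: "?\<chi> (basis_vec \<kappa>) x = \<phi> (basis_vec (fst \<kappa>)) (fst x) * \<psi> (basis_vec (snd \<kappa>)) (snd x)"
    if "\<kappa> \<in> ?B" for \<kappa> x using tensor_map_basis_vec[OF that, of \<phi> \<psi> "fst x" "snd x"] by simp
  show sub: "IT \<subseteq> ideal_mult (ideal_power I q) (ideal_power J n)"
    unfolding IT_def max_minor_ideal_def[of ?B] minor_ideal_def
  proof (rule ideal_gen_minimal[OF _ is_ideal_ideal_mult], rule subsetI)
    fix x assume "x \<in> minors ?B ?C ?N ?\<chi>"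
    then obtain \<rho> \<kappa> where x: "x = det (mat ?N ?N (\<lambda>(i, j). ?\<chi> (basis_vec (\<kappa> j)) (\<rho> i)))"
      and \<rho>: "\<rho> \<in> {..<?N} \<rightarrow> ?C" "inj_on \<rho> {..<?N}" and \<kappa>: "\<kappa> \<in> {..<?N} \<rightarrow> ?B"
      unfolding minors_def by blast
    have "bij_betw \<rho> {..<?N} ?C"
      unfolding bij_betw_def using \<rho> finC by (intro conjI card_subset_eq) (auto simp: card_image)
    then have bij: "bij_betw (\<lambda>r. (fst (\<rho> r), snd (\<rho> r))) {..<?N} ({..<n} \<times> {..<q})"
      by (simp add: tensor_index_def)
    have \<kappa>B: "\<kappa> c \<in> ?B" if "c < ?N" for c using \<kappa> that by auto
    have "x = det (mat ?N ?N (\<lambda>(r, a). \<phi> (basis_vec (fst (\<kappa> a))) (fst (\<rho> r)) * \<psi> (basis_vec (snd (\<kappa> a))) (snd (\<rho> r))))"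
      unfolding x by (intro arg_cong[of _ _ det] eq_matI) (auto simp: \<chi> \<kappa>B)
    also have "\<dots> \<in> ideal_mult (ideal_power I q) (ideal_power J n)"
    proof (rule det_tensor_in_product[OF bij, where V = "col_span m \<phi>" and V' = "col_span p \<psi>"])
      show "\<phi> (basis_vec (fst (\<kappa> a))) \<in> col_span m \<phi>" "\<psi> (basis_vec (snd (\<kappa> a))) \<in> col_span p \<psi>"
        if "a < ?N" for a
        using \<kappa>B[OF that] by (auto simp: tensor_index_def intro!: col_in_col_span)
    qed (auto simp: I_def J_def intro: det_col_span_in_max_minor_ideal)
    finally show "x \<in> ideal_mult (ideal_power I q) (ideal_power J n)" .
  qed
  have pow: "det (mat n n (\<lambda>(i, j). y j i)) ^ q * det (mat q q (\<lambda>(i, j). z j i)) ^ n \<in> IT"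
    if y: "\<And>j. j < n \<Longrightarrow> y j \<in> col_span m \<phi>" and z: "\<And>j. j < q \<Longrightarrow> z j \<in> col_span p \<psi>" for y z
  proof -
    obtain \<rho> where \<rho>: "bij_betw \<rho> {..<?N} ?C"
      using ex_bij_betw_nat_finite[OF finC] by (auto simp: lessThan_atLeast0)
    then have bij: "bij_betw (\<lambda>r. (fst (\<rho> r), snd (\<rho> r))) {..<?N} ({..<n} \<times> {..<q})"
      by (simp add: tensor_index_def)
    have less: "fst (\<rho> r) < n" "snd (\<rho> r) < q" if "r < ?N" for r
      using bij_betwE[OF \<rho>] that by (force simp: tensor_index_def)+
    obtain g where g: "\<And>j. j < n \<Longrightarrow> y j = (\<lambda>i. \<Sum>l<m. g j l * \<phi> (basis_vec l) i)"
      using col_span_coeffs[of n y m \<phi>, OF y] by blast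
    obtain h where h: "\<And>j. j < q \<Longrightarrow> z j = (\<lambda>i. \<Sum>l<p. h j l * \<psi> (basis_vec l) i)"
      using col_span_coeffs[of q z p \<psi>, OF z] by blast
    have "det (mat ?N ?N (\<lambda>(r, a). y (fst (\<rho> a)) (fst (\<rho> r)) * z (snd (\<rho> a)) (snd (\<rho> r)))) \<in> minor_ideal ?B ?C ?N ?\<chi>"
    proof (rule det_cols_in_minor_ideal[OF finB,
          where x = "\<lambda>a \<kappa>. g (fst (\<rho> a)) (fst \<kappa>) * h (snd (\<rho> a)) (snd \<kappa>)"])
      show "\<rho> \<in> {..<?N} \<rightarrow> ?C" "inj_on \<rho> {..<?N}" using \<rho> by (auto simp: bij_betw_def)
      fix r a assume "r < ?N" "a < ?N"
      then have "y (fst (\<rho> a)) (fst (\<rho> r)) * z (snd (\<rho> a)) (snd (\<rho> r)) =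
          (\<Sum>\<kappa>\<in>?B. (g (fst (\<rho> a)) (fst \<kappa>) * \<phi> (basis_vec (fst \<kappa>)) (fst (\<rho> r))) *
            (h (snd (\<rho> a)) (snd \<kappa>) * \<psi> (basis_vec (snd \<kappa>)) (snd (\<rho> r))))"
        by (simp add: g h less sum_product sum.cartesian_product tensor_index_def case_prod_beta)
      also have "\<dots> = (\<Sum>\<kappa>\<in>?B. g (fst (\<rho> a)) (fst \<kappa>) * h (snd (\<rho> a)) (snd \<kappa>) * ?\<chi> (basis_vec \<kappa>) (\<rho> r))"
        by (intro sum.cong refl) (simp add: \<chi> mult_ac)
      finally show "y (fst (\<rho> a)) (fst (\<rho> r)) * z (snd (\<rho> a)) (snd (\<rho> r)) =
          (\<Sum>\<kappa>\<in>?B. g (fst (\<rho> a)) (fst \<kappa>) * h (snd (\<rho> a)) (snd \<kappa>) * ?\<chi> (basis_vec \<kappa>) (\<rho> r))" .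
    qed
    then show ?thesis
      unfolding det_tensor_basis[OF bij] by (simp add: IT_def max_minor_ideal_def)
  qed
  note * = comparison_with_product[OF IT sub[unfolded I_def J_def] pow]
  show "integral_closure IT = integral_closure (ideal_mult (ideal_power I q) (ideal_power J n))"
    unfolding I_def J_def by (rule *(1))
  show "IT = ideal_mult (ideal_power I q) (ideal_power J n)" if "contains_rationals TYPE('a)"
    unfolding I_def J_def by (rule *(2)[OF _ _ that])
qed

theorem theorem1:
  fixes \<phi> \<psi> :: "(nat \<Rightarrow> 'a::comm_ring_1) \<Rightarrow> (nat \<Rightarrow> 'a)"
    and m n p q d s e :: nat
    and I\<^sub>\<phi> I\<^sub>\<psi> I\<^sub>T I\<^sub>S I\<^sub>E :: "'a set"
  assumes "lin_map {..<m} {..<n} \<phi>"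
    and "lin_map {..<p} {..<q} \<psi>"
    and "d \<ge> 1"
  defines "s \<equiv> (n + d - 1) choose (d - 1)"
    and "e \<equiv> (n - 1) choose (d - 1)"
    and "I\<^sub>\<phi> \<equiv> max_minor_ideal {..<m} {..<n} \<phi>"
    and "I\<^sub>\<psi> \<equiv> max_minor_ideal {..<p} {..<q} \<psi>"
    and "I\<^sub>T \<equiv> max_minor_ideal (tensor_index m p) (tensor_index n q) (tensor_map m p \<phi> \<psi>)"
    and "I\<^sub>S \<equiv> max_minor_ideal (sym_index m d) (sym_index n d) (sym_power_map m n d \<phi>)"
    and "I\<^sub>E \<equiv> max_minor_ideal (ext_index m d) (ext_index n d) (ext_power_map m n d \<phi>)"
  shows "(I\<^sub>T \<subseteq> ideal_mult (ideal_power I\<^sub>\<phi> q) (ideal_power I\<^sub>\<psi> n) \<and>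
          I\<^sub>S \<subseteq> ideal_power I\<^sub>\<phi> s \<and>
          I\<^sub>E \<subseteq> ideal_power I\<^sub>\<phi> e \<and>
          integral_closure I\<^sub>T =
            integral_closure (ideal_mult (ideal_power I\<^sub>\<phi> q) (ideal_power I\<^sub>\<psi> n)) \<and>
          integral_closure I\<^sub>S = integral_closure (ideal_power I\<^sub>\<phi> s) \<and>
          integral_closure I\<^sub>E = integral_closure (ideal_power I\<^sub>\<phi> e)) \<and>
         (contains_rationals TYPE('a) \<longrightarrow>
          I\<^sub>T = ideal_mult (ideal_power I\<^sub>\<phi> q) (ideal_power I\<^sub>\<psi> n) \<and>
          I\<^sub>S = ideal_power I\<^sub>\<phi> s \<and>
          I\<^sub>E = ideal_power I\<^sub>\<phi> e)"
proof -
  note T = tensor_comparison[of m p n q \<phi> \<psi>]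
  note S = sym_power_comparison[OF assms(3), of m n \<phi>]
  note E = ext_power_comparison[OF assms(3), of m n \<phi>]
  show ?thesis
    unfolding s_def e_def I\<^sub>\<phi>_def I\<^sub>\<psi>_def I\<^sub>T_def I\<^sub>S_def I\<^sub>E_def
    using T S E by (intro conjI impI)
qed

end
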